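(* Let $C\ge1$, and for $1\le i\le C$ let $N_i\in\{1,2,\dots\}\cup\{\infty\}$ and let $\mathcal{S}_i$ be a Polish space. For each $r\in\mathbb{R}_+\cup\{\infty\}$ let $(X^r_{n,i})_{1\le n\le N_i,\,1\le i\le C}$ be a multi-exchangeable system, $X^r_{n,i}$ taking values in $\mathcal{S}_i$, with measure vector $(\Lambda_i^{N_i,r})_{1\le i\le C}$ (defined below). Then, as $r\to\infty$ through $\mathbb{R}_+$, \[ (X^r_{n,i})_{1\le n\le N_i,\,1\le i\le C}\longrightarrow (X^\infty_{n,i})_{1\le n\le N_i,\,1\le i\le C}\quad\text{in law} \] (in the product space $\prod_{i=1}^C\mathcal{S}_i^{N_i}$ with the product topology) if and only if \[ (\Lambda_i^{N_i,r})_{1\le i\le C}\longrightarrow(\Lambda_i^{N_i,\infty})_{1\le i\le C}\quad\text{in law} \] (in $\mathcal{P}(\mathcal{S}_1)\times\cdots\times\mathcal{P}(\mathcal{S}_C)$ with the weak topologies).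
   Context: For $k\ge1$, $\Sigma(k)$ is the set of permutations of $\{1,\dots,k\}$ and $\Sigma(\infty)$ is the set of permutations of $\{1,2,\dots\}$ with finite support; $1\le n\le\infty$ means $n\ge1$. A system $(X_{n,i})_{1\le n\le N_i,\,1\le i\le C}$ of random variables, $X_{n,i}$ with values in $\mathcal{S}_i$, is multi-exchangeable if $\mathcal{L}\big((X_{\sigma_i(n),i})_{1\le n\le N_i,1\le i\le C}\big)=\mathcal{L}\big((X_{n,i})_{1\le n\le N_i,1\le i\le C}\big)$ for all $\sigma_i\in\Sigma(N_i)$, $1\le i\le C$. In particular each class $(X_{n,i})_{n}$ is exchangeable; if $N_i=\infty$, by de Finetti's theorem the limit $\Lambda_i^\infty=\lim_{N\to\infty}\frac1N\sum_{n=1}^N\delta_{X_{n,i}}$ exists a.s. in the weak topology of $\mathcal{P}(\mathcal{S}_i)$ (the directing measure). The measure vector of the system is $(\Lambda_i^{N_i})_{1\le i\le C}$ with values in $\mathcal{P}(\mathcal{S}_1)\times\cdots\times\mathcal{P}(\mathcal{S}_C)$, where $\Lambda_i^{N_i}=\frac1{N_i}\sum_{n=1}^{N_i}\delta_{X_{n,i}}$ (empirical measure) if $N_i<\infty$ and $\Lambda_i^{N_i}=\Lambda_i^\infty$ (directing measure) if $N_i=\infty$; for the system indexed by $r$ this vector is denoted $(\Lambda_i^{N_i,r})_{1\le i\le C}$. Spaces of probability measures carry the weak topology. *)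

theory Defs
  imports "HOL-Probability.Probability"
begin

definition Polish_space :: "'a topology \<Rightarrow> bool" where
  "Polish_space X \<longleftrightarrow> completely_metrizable_space X \<and> separable_space X"

definition borel_of :: "'a topology \<Rightarrow> 'a measure" where
  "borel_of X = sigma (topspace X) {U. openin X U}"

definition bcont :: "'a topology \<Rightarrow> ('a \<Rightarrow> real) set" where
  "bcont X = {f. continuous_map X euclideanreal f \<and> (\<exists>B. \<forall>x\<in>topspace X. \<bar>f x\<bar> \<le> B)}"

definition prob_measures :: "'a topology \<Rightarrow> 'a measure set" where
  "prob_measures X = {\<mu>. prob_space \<mu> \<and> sets \<mu> = sets (borel_of X)}"

text \<open>Weak topology: the coarsest topology on P(S) making all maps
  mu |-> integral of f over mu (f bounded continuous) continuous.\<close>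
definition weak_top :: "'a topology \<Rightarrow> 'a measure topology" where
  "weak_top X = pullback_topology (prob_measures X)
     (\<lambda>\<mu>. restrict (\<lambda>f. integral\<^sup>L \<mu> f) (bcont X))
     (product_topology (\<lambda>_. euclideanreal) (bcont X))"

definition conv_in_law ::
  "'b topology \<Rightarrow> (real \<Rightarrow> 'w measure) \<Rightarrow> (real \<Rightarrow> 'w \<Rightarrow> 'b) \<Rightarrow> 'w measure \<Rightarrow> ('w \<Rightarrow> 'b) \<Rightarrow> bool"
  where
  "conv_in_law T M Y Minf Yinf \<longleftrightarrow>
     (\<forall>g\<in>bcont T. ((\<lambda>r. integral\<^sup>L (distr (M r) (borel_of T) (Y r)) g)
                     \<longlongrightarrow> integral\<^sup>L (distr Minf (borel_of T) Yinf) g) at_top)"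

definition sys_index :: "nat \<Rightarrow> (nat \<Rightarrow> enat) \<Rightarrow> (nat \<times> nat) set" where
  "sys_index C N = {(n, i). 1 \<le> i \<and> i \<le> C \<and> 1 \<le> n \<and> enat n \<le> N i}"

definition random_system ::
  "(nat \<Rightarrow> 'a topology) \<Rightarrow> nat \<Rightarrow> (nat \<Rightarrow> enat) \<Rightarrow> 'w measure \<Rightarrow> ('w \<Rightarrow> nat \<times> nat \<Rightarrow> 'a) \<Rightarrow> bool"
  where
  "random_system S C N M X \<longleftrightarrow> prob_space M \<and>
     (\<forall>(n, i)\<in>sys_index C N. (\<lambda>\<omega>. X \<omega> (n, i)) \<in> M \<rightarrow>\<^sub>M borel_of (S i))"

definition multi_exchangeable ::
  "(nat \<Rightarrow> 'a topology) \<Rightarrow> nat \<Rightarrow> (nat \<Rightarrow> enat) \<Rightarrow> 'w measure \<Rightarrow> ('w \<Rightarrow> nat \<times> nat \<Rightarrow> 'a) \<Rightarrow> bool"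
  where
  "multi_exchangeable S C N M X \<longleftrightarrow>
     (\<forall>\<sigma> :: nat \<Rightarrow> nat \<Rightarrow> nat.
        (\<forall>i\<in>{1..C}. \<sigma> i permutes {n. 1 \<le> n \<and> enat n \<le> N i} \<and> finite {n. \<sigma> i n \<noteq> n}) \<longrightarrow>
        distr M (PiM (sys_index C N) (\<lambda>(n, i). borel_of (S i)))
              (\<lambda>\<omega>. restrict (\<lambda>(n, i). X \<omega> (\<sigma> i n, i)) (sys_index C N))
        = distr M (PiM (sys_index C N) (\<lambda>(n, i). borel_of (S i)))
              (\<lambda>\<omega>. restrict (X \<omega>) (sys_index C N)))"

definition empirical :: "'a topology \<Rightarrow> (nat \<Rightarrow> 'a) \<Rightarrow> nat \<Rightarrow> 'a measure" where
  "empirical X x k = measure_of (topspace X) (sets (borel_of X))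
     (\<lambda>A. ennreal (real (card {n\<in>{1..k}. x n \<in> A}) / real k))"

text \<open>Directing measure: the (a.s. existing, unique) weak limit of the empirical measures;
  on the null set where it does not exist an arbitrary fixed choice is made.\<close>
definition directing :: "'a topology \<Rightarrow> (nat \<Rightarrow> 'a) \<Rightarrow> 'a measure" where
  "directing X x =
     (if \<exists>\<mu>. limitin (weak_top X) (\<lambda>k. empirical X x k) \<mu> sequentially
      then (SOME \<mu>. limitin (weak_top X) (\<lambda>k. empirical X x k) \<mu> sequentially)
      else return (borel_of X) (x 1))"

definition measure_vec ::
  "(nat \<Rightarrow> 'a topology) \<Rightarrow> nat \<Rightarrow> (nat \<Rightarrow> enat) \<Rightarrow> ('w \<Rightarrow> nat \<times> nat \<Rightarrow> 'a) \<Rightarrow> 'w \<Rightarrow> nat \<Rightarrow> 'a measure"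
  where
  "measure_vec S C N X \<omega> = restrict (\<lambda>i. case N i of
       enat k \<Rightarrow> empirical (S i) (\<lambda>n. X \<omega> (n, i)) k
     | \<infinity> \<Rightarrow> directing (S i) (\<lambda>n. X \<omega> (n, i))) {1..C}"

end

(* A topology generated by countably many functions into the unit interval has its weak convergence
   determined by the integrals of monomials in these functions. This applies to a Polish space, to its
   space of probability measures, and to countable products of either, so both sides of the theorem
   become statements about moments.

   Directing measures exist almost surely because averages of bounded functions converge (the mean
   square increments of exchangeable averages are explicit) and because empirical measures are tight.

   From left to right, products of directing measures are replaced by products of averages over K
   indices, with an error in mean of order 1/sqrt(K) that does not depend on r. From right to left,
   coordinates are removed one at a time: by exchangeability all new coordinates of a class contribute
   equally, so the class measure replaces the coordinate, up to repeated indices in a finite class. *)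

theory Submission
  imports Defs
begin

section \<open>Uniform algebras of functions and the portmanteau theorem\<close>

text \<open>Polynomials in the generating functions are not uniformly dense in
  \<open>bcont T\<close> when the space is not compact. The way around is one-sided. A sequence from
  a uniformly closed algebra exhausts the indicator of an open set from below; the resulting lower
  bounds on open sets give the portmanteau theorem, and no mass is lost because the limit is a
  probability measure on the same space. The same device proves Borel measurability of maps into
  spaces of probability measures, which enter only through a countable generating family.

  Exchangeability enters only through transpositions of two indices within one class. Second moments
  of functions bounded by 1 control all averages by a constant that does not see the law; this is
  why one estimate serves every r.

  In a finite class, drawing distinct indices differs from sampling the empirical measure. The
  moment with one more coordinate is therefore obtained by solving a linear equation. Its
  coefficients depend only on the class size and the number of coordinates already present, so
  convergence passes through it.\<close>

lemma space_borel_of [simp]: "space (borel_of T) = topspace T"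
  unfolding borel_of_def by (rule space_measure_of) (auto dest: openin_subset)

lemma sets_borel_of: "sets (borel_of T) = sigma_sets (topspace T) {U. openin T U}"
  unfolding borel_of_def by (rule sets_measure_of) (auto dest: openin_subset)

lemma openin_sets_borel_of: "openin T U \<Longrightarrow> U \<in> sets (borel_of T)"
  by (auto simp: sets_borel_of)

lemma measurable_borel_ofI:
  assumes "f \<in> space M \<rightarrow> topspace T" "\<And>U. openin T U \<Longrightarrow> f -` U \<inter> space M \<in> sets M"
  shows "f \<in> M \<rightarrow>\<^sub>M borel_of T"
  unfolding borel_of_def
  by (rule measurable_measure_of) (use assms in \<open>auto dest: openin_subset\<close>)

lemma continuous_map_measurable:
  assumes "continuous_map T euclideanreal f"
  shows "f \<in> borel_measurable (borel_of T)"
proof (rule borel_measurableI)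
  fix S :: "real set" assume "open S"
  then have "openin T {x \<in> topspace T. f x \<in> S}"
    using assms by (auto simp: continuous_map_def)
  moreover have "{x \<in> topspace T. f x \<in> S} = f -` S \<inter> space (borel_of T)" by auto
  ultimately show "f -` S \<inter> space (borel_of T) \<in> sets (borel_of T)"
    using openin_sets_borel_of by metis
qed

section \<open>Bounded continuous functions and probability measures on a topological space\<close>

lemma bcontI:
  assumes "continuous_map T euclideanreal f" "\<And>x. x \<in> topspace T \<Longrightarrow> \<bar>f x\<bar> \<le> B"
  shows "f \<in> bcont T"
  using assms by (auto simp: bcont_def)

lemma bcontE:
  assumes "f \<in> bcont T"
  obtains B where "B > 0" "continuous_map T euclideanreal f" "\<And>x. x \<in> topspace T \<Longrightarrow> \<bar>f x\<bar> \<le> B"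
proof -
  from assms obtain B where "continuous_map T euclideanreal f" "\<forall>x\<in>topspace T. \<bar>f x\<bar> \<le> B"
    by (auto simp: bcont_def)
  then show thesis by (intro that[of "max B 1"]) fastforce+
qed

lemma bcont_measurable: "f \<in> bcont T \<Longrightarrow> f \<in> borel_measurable (borel_of T)"
  by (auto simp: bcont_def intro: continuous_map_measurable)

lemma bcont_const: "(\<lambda>_. c) \<in> bcont T"
  by (rule bcontI[where B="\<bar>c\<bar>"]) auto

lemma bcont_add:
  assumes "f \<in> bcont T" "g \<in> bcont T"
  shows "(\<lambda>x. f x + g x) \<in> bcont T"
proof -
  obtain A B where "continuous_map T euclideanreal f" "continuous_map T euclideanreal g"
    "\<And>x. x \<in> topspace T \<Longrightarrow> \<bar>f x\<bar> \<le> A" "\<And>x. x \<in> topspace T \<Longrightarrow> \<bar>g x\<bar> \<le> B"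
    using assms by (metis bcontE)
  then show ?thesis
    by (intro bcontI[where B="A+B"] continuous_map_add) (auto intro: order_trans[OF abs_triangle_ineq add_mono])
qed

lemma bcont_mult:
  assumes "f \<in> bcont T" "g \<in> bcont T"
  shows "(\<lambda>x. f x * g x) \<in> bcont T"
proof -
  obtain A B where "continuous_map T euclideanreal f" "continuous_map T euclideanreal g"
    "\<And>x. x \<in> topspace T \<Longrightarrow> \<bar>f x\<bar> \<le> A" "\<And>x. x \<in> topspace T \<Longrightarrow> \<bar>g x\<bar> \<le> B"
    using assms by (metis bcontE)
  then show ?thesis
    by (intro bcontI[where B="A*B"] continuous_map_real_mult) (auto simp: abs_mult intro!: mult_mono intro: order_trans[OF abs_ge_zero])
qed

lemma bcont_compose:
  assumes "f \<in> bcont T" "continuous_on UNIV \<phi>"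
  shows "(\<lambda>x. \<phi> (f x) :: real) \<in> bcont T"
proof -
  obtain B where B: "B > 0" "continuous_map T euclideanreal f" "\<And>x. x \<in> topspace T \<Longrightarrow> \<bar>f x\<bar> \<le> B"
    using assms(1) by (metis bcontE)
  have "compact (\<phi> ` {-B..B})"
    by (intro compact_continuous_image continuous_on_subset[OF assms(2)]) auto
  then obtain A where A: "\<And>x. x \<in> {-B..B} \<Longrightarrow> \<bar>\<phi> x\<bar> \<le> A"
    by (metis (no_types, lifting) bounded_iff compact_imp_bounded image_eqI real_norm_def)
  have "continuous_map T euclideanreal (\<phi> \<circ> f)"
    by (rule continuous_map_compose[OF B(2)]) (use assms(2) in auto)
  then show ?thesis
    unfolding comp_def
  proof (rule bcontI)
    fix x assume "x \<in> topspace T"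
    then have "f x \<in> {-B..B}" using B(3)[of x] by (simp add: abs_le_iff)
    then show "\<bar>\<phi> (f x)\<bar> \<le> A" by (rule A)
  qed
qed

lemma bcont_prod_list:
  assumes "\<And>w. w \<in> set ws \<Longrightarrow> w \<in> bcont T"
  shows "(\<lambda>x. \<Prod>w\<leftarrow>ws. w x) \<in> bcont T"
  using assms by (induction ws) (auto intro: bcont_const bcont_mult)

lemma prob_measuresD:
  assumes "\<mu> \<in> prob_measures T"
  shows "prob_space \<mu>" "sets \<mu> = sets (borel_of T)" "space \<mu> = topspace T"
  using assms sets_eq_imp_space_eq[of \<mu> "borel_of T"] by (auto simp: prob_measures_def)

lemma prob_measures_integrable:
  assumes "\<mu> \<in> prob_measures T" "f \<in> bcont T"
  shows "integrable \<mu> f"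
proof -
  note P = prob_measuresD[OF assms(1)]
  interpret prob_space \<mu> by fact
  obtain B where "\<And>x. x \<in> topspace T \<Longrightarrow> \<bar>f x\<bar> \<le> B" using assms(2) by (metis bcontE)
  moreover have "f \<in> borel_measurable \<mu>"
    using bcont_measurable[OF assms(2)] P(2) measurable_cong_sets by blast
  ultimately show ?thesis
    by (intro integrable_const_bound[where B=B]) (auto simp: P)
qed

text \<open>This says that the topology is the initial one for W, phrased through basic
  neighbourhoods with one radius for finitely many functions. The range in the unit interval bounds
  every monomial by 1, whatever its degree.\<close>

definition generates :: "'a topology \<Rightarrow> ('a \<Rightarrow> real) set \<Rightarrow> bool" where
  "generates T W \<longleftrightarrow>
     (\<forall>w\<in>W. continuous_map T euclideanreal w \<and> (\<forall>x\<in>topspace T. 0 \<le> w x \<and> w x \<le> 1)) \<and>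
     (\<forall>U. openin T U \<longrightarrow> (\<forall>x\<in>U. \<exists>W0 \<epsilon>. finite W0 \<and> W0 \<subseteq> W \<and> \<epsilon> > 0 \<and>
        (\<forall>y\<in>topspace T. (\<forall>w\<in>W0. \<bar>w y - w x\<bar> < \<epsilon>) \<longrightarrow> y \<in> U)))"

lemma generates_bcont: "generates T W \<Longrightarrow> w \<in> W \<Longrightarrow> w \<in> bcont T"
  by (rule bcontI[where B=1]) (auto simp: generates_def)

lemma generates_range: "generates T W \<Longrightarrow> w \<in> W \<Longrightarrow> x \<in> topspace T \<Longrightarrow> 0 \<le> w x \<and> w x \<le> 1"
  by (auto simp: generates_def)

lemma generatesE:
  assumes "generates T W" "openin T U" "x \<in> U"
  obtains W0 \<epsilon> where "finite W0" "W0 \<subseteq> W" "\<epsilon> > 0"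
    "\<And>y. y \<in> topspace T \<Longrightarrow> (\<And>w. w \<in> W0 \<Longrightarrow> \<bar>w y - w x\<bar> < \<epsilon>) \<Longrightarrow> y \<in> U"
  using assms unfolding generates_def by metis

text \<open>Closure under uniform limits is an axiom, so membership in Q can be an analytic
  property. Below, Q is a set of multipliers preserving convergence of integrals, a set of functions
  with measurable composite, and all of \<open>bcont T\<close>.\<close>

locale uniform_algebra =
  fixes T :: "'a topology" and Q :: "('a \<Rightarrow> real) set"
  assumes sub: "Q \<subseteq> bcont T"
    and const: "\<And>c. (\<lambda>_. c) \<in> Q"
    and add: "\<And>f g. f \<in> Q \<Longrightarrow> g \<in> Q \<Longrightarrow> (\<lambda>x. f x + g x) \<in> Q"
    and mult: "\<And>f g. f \<in> Q \<Longrightarrow> g \<in> Q \<Longrightarrow> (\<lambda>x. f x * g x) \<in> Q"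
    and unif: "\<And>f. f \<in> bcont T \<Longrightarrow>
      (\<And>\<epsilon>. \<epsilon> > 0 \<Longrightarrow> \<exists>g\<in>Q. \<forall>x\<in>topspace T. \<bar>f x - g x\<bar> \<le> \<epsilon>) \<Longrightarrow> f \<in> Q"
begin

text \<open>Weierstrass on an interval [-B, B] containing the values of f: polynomials in f lie in
  the algebra and approximate the composite uniformly.\<close>

lemma compose:
  assumes f: "f \<in> Q" and \<phi>: "continuous_on UNIV \<phi>"
  shows "(\<lambda>x. \<phi> (f x)) \<in> Q"
proof (rule unif)
  show "(\<lambda>x. \<phi> (f x)) \<in> bcont T" using bcont_compose[OF _ \<phi>] f sub by auto
  fix \<epsilon> :: real assume "\<epsilon> > 0"
  obtain B where B: "\<And>x. x \<in> topspace T \<Longrightarrow> \<bar>f x\<bar> \<le> B" using f sub by (metis bcontE subsetD)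
  obtain p where p: "real_polynomial_function p" "\<And>x. x \<in> {-B..B} \<Longrightarrow> \<bar>\<phi> x - p x\<bar> < \<epsilon>"
    using Stone_Weierstrass_real_polynomial_function[OF compact_Icc continuous_on_subset[OF \<phi> subset_UNIV] \<open>\<epsilon> > 0\<close>]
    by metis
  from p(1) have "(\<lambda>x. p (f x)) \<in> Q"
  proof induction
    case (linear h)
    then interpret bounded_linear h .
    have "h (f x) = f x * h 1" for x using scaleR[of "f x" 1] by simp
    then show ?case using mult[OF f const] by simp
  qed (auto intro: const add mult)
  moreover have "\<forall>x\<in>topspace T. \<bar>\<phi> (f x) - p (f x)\<bar> \<le> \<epsilon>"
    using p(2) B by (smt (verit) atLeastAtMost_iff)
  ultimately show "\<exists>g\<in>Q. \<forall>x\<in>topspace T. \<bar>\<phi> (f x) - g x\<bar> \<le> \<epsilon>" by auto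
qed

lemma sum: "(\<And>i. i \<in> I \<Longrightarrow> f i \<in> Q) \<Longrightarrow> (\<lambda>x. \<Sum>i\<in>I. f i x) \<in> Q"
  by (induction I rule: infinite_finite_induct) (auto intro: const add)

lemma prod_list: "(\<And>i. i \<in> set l \<Longrightarrow> f i \<in> Q) \<Longrightarrow> (\<lambda>x. \<Prod>i\<leftarrow>l. f i x) \<in> Q"
  by (induction l) (auto intro: const mult)

text \<open>An open set is the union of the sets where suitable products of tent functions are
  positive, and rational centres and radii leave only countably many of them. Adding them up and
  cutting off at 1 produces members of the algebra below the indicator of U that converge to it
  pointwise. A sequence is wanted because dominated convergence will be applied to it.\<close>

lemma open_approx:
  assumes gen: "generates T W" and "countable W" "W \<subseteq> Q" and U: "openin T U"
  obtains h :: "nat \<Rightarrow> 'a \<Rightarrow> real" where "\<And>k. h k \<in> Q"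
    "\<And>k x. x \<in> topspace T \<Longrightarrow> 0 \<le> h k x \<and> h k x \<le> 1"
    "\<And>k x. x \<in> topspace T \<Longrightarrow> x \<notin> U \<Longrightarrow> h k x = 0"
    "\<And>x. x \<in> U \<Longrightarrow> (\<lambda>k. h k x) \<longlonglongrightarrow> 1"
proof -
  \<comment> \<open>A code is a list of pairs of a function and a rational centre, together with one
    radius \<delta>; \<open>u\<close> is positive exactly where every listed function is within
    \<delta> of its centre.\<close>
  define u where "u = (\<lambda>(l::(('a \<Rightarrow> real) \<times> rat) list, \<delta>::rat) y.
     \<Prod>p\<leftarrow>l. max 0 (of_rat \<delta> - \<bar>fst p y - of_rat (snd p)\<bar> :: real))"
  define P where "P = {p. fst p \<in> lists (W \<times> UNIV) \<and> (\<forall>y\<in>topspace T. u p y > 0 \<longrightarrow> y \<in> U)}"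
  \<comment> \<open>The zero function makes \<open>V\<close> nonempty, so that
    \<open>from_nat_into\<close> enumerates it in every case.\<close>
  define V where "V = insert (\<lambda>_. 0) (u ` P)"
  have "P \<subseteq> lists (W \<times> (UNIV :: rat set)) \<times> UNIV" by (auto simp: P_def)
  moreover have "countable (lists (W \<times> (UNIV :: rat set)) \<times> (UNIV :: rat set))"
    using \<open>countable W\<close> by (intro countable_SIGMA countable_lists) auto
  ultimately have "countable P" by (rule countable_subset)
  then have V: "countable V" "V \<noteq> {}" by (auto simp: V_def)
  have uQ: "u p \<in> Q" if "p \<in> P" for p
  proof -
    have "(\<lambda>y. \<Prod>q\<leftarrow>fst p. max 0 (of_rat (snd p) - \<bar>fst q y - of_rat (snd q)\<bar> :: real)) \<in> Q"
    proof (rule prod_list)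
      fix q assume "q \<in> set (fst p)"
      then have "fst q \<in> Q" using that \<open>W \<subseteq> Q\<close> by (fastforce simp: P_def in_lists_conv_set)
      from compose[OF this, of "\<lambda>t. max 0 (of_rat (snd p) - \<bar>t - of_rat (snd q)\<bar>)"]
      show "(\<lambda>y. max 0 (of_rat (snd p) - \<bar>fst q y - of_rat (snd q)\<bar>)) \<in> Q"
        by (simp add: continuous_intros)
    qed
    then show ?thesis by (simp add: u_def case_prod_beta)
  qed
  then have VQ: "v \<in> Q" if "v \<in> V" for v using that const by (auto simp: V_def)
  have u0: "u p y \<ge> 0" for p y
    by (auto simp: u_def case_prod_beta intro!: prod_list_nonneg)
  then have V0: "v y \<ge> 0" if "v \<in> V" for v y using that by (auto simp: V_def)
  have Vzero: "v y = 0" if "v \<in> V" "y \<in> topspace T" "y \<notin> U" for v y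
  proof (cases "v = (\<lambda>_. 0)")
    case False
    with that obtain p where "p \<in> P" "v = u p" by (auto simp: V_def)
    then have "\<not> v y > 0" using that by (auto simp: P_def)
    with V0[OF that(1), of y] show ?thesis by simp
  qed simp
  have Vpos: "\<exists>v\<in>V. v x > 0" if "x \<in> U" for x
  proof -
    obtain W0 \<epsilon> where W0: "finite W0" "W0 \<subseteq> W" "\<epsilon> > 0"
      "\<And>y. y \<in> topspace T \<Longrightarrow> (\<And>w. w \<in> W0 \<Longrightarrow> \<bar>w y - w x\<bar> < \<epsilon>) \<Longrightarrow> y \<in> U"
      using generatesE[OF gen U \<open>x \<in> U\<close>] by metis
    \<comment> \<open>The centre lies within \<delta> of \<open>w x\<close> and, where
      \<open>u\<close> is positive, within \<delta> of \<open>w y\<close>; hence the requirement 2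
      \<delta> < \<epsilon>.\<close>
    obtain \<delta> where \<delta>: "0 < real_of_rat \<delta>" "real_of_rat \<delta> < \<epsilon> / 2"
      using of_rat_dense[of 0 "\<epsilon>/2"] W0(3) by auto
    have "\<exists>q. \<bar>w x - of_rat q\<bar> < real_of_rat \<delta>" for w :: "'a \<Rightarrow> real"
      using of_rat_dense[of "w x - of_rat \<delta>" "w x"] \<delta>(1) by (auto simp: abs_less_iff algebra_simps)
    then obtain q where q: "\<And>w :: 'a \<Rightarrow> real. \<bar>w x - of_rat (q w)\<bar> < real_of_rat \<delta>" by metis
    obtain ws where ws: "set ws = W0" using W0(1) finite_list by blast
    define p where "p = (map (\<lambda>w. (w, q w)) ws, \<delta>)"
    have up: "u p y = (\<Prod>w\<leftarrow>ws. max 0 (of_rat \<delta> - \<bar>w y - of_rat (q w)\<bar>))" for y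
      by (simp add: u_def p_def o_def)
    have "u p x > 0"
      unfolding up using q by (induction ws) (auto simp: less_max_iff_disj intro!: mult_pos_pos)
    moreover have "p \<in> P"
    proof -
      have "y \<in> U" if "y \<in> topspace T" "u p y > 0" for y
      proof (rule W0(4)[OF that(1)])
        fix w assume "w \<in> W0"
        have "max 0 (of_rat \<delta> - \<bar>w y - of_rat (q w)\<bar>) \<noteq> 0"
        proof
          assume *: "max 0 (of_rat \<delta> - \<bar>w y - of_rat (q w)\<bar>) = 0"
          have "u p y = 0" unfolding up prod_list_zero_iff using * \<open>w \<in> W0\<close> ws
            by (auto simp: image_iff intro!: bexI[of _ w])
          with that(2) show False by simp
        qed
        then have "\<bar>w y - of_rat (q w)\<bar> < of_rat \<delta>" by (auto simp: max_def split: if_splits)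
        with q[of w] \<delta>(2) show "\<bar>w y - w x\<bar> < \<epsilon>" by linarith
      qed
      then show ?thesis using W0(2) ws by (auto simp: P_def p_def)
    qed
    ultimately show ?thesis by (auto simp: V_def)
  qed
  define v where "v = from_nat_into V"
  have v: "v j \<in> V" for j unfolding v_def by (rule from_nat_into[OF V(2)])
  \<comment> \<open>The sum contains a given positive \<open>v j x\<close> once k > j, and the
    factor k then pushes it above 1.\<close>
  define h where "h = (\<lambda>k y. min 1 (real k * (\<Sum>j<k. v j y)))"
  show thesis
  proof (rule that)
    fix k
    have *: "(\<lambda>y. real k * (\<Sum>j<k. v j y)) \<in> Q"
      by (intro mult const sum VQ v)
    show "h k \<in> Q"
      unfolding h_def by (rule compose[OF *, of "min 1"]) (auto intro!: continuous_intros)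
    show "0 \<le> h k x \<and> h k x \<le> 1" for x
      using V0[OF v] by (auto simp: h_def intro!: mult_nonneg_nonneg sum_nonneg)
    show "h k x = 0" if "x \<in> topspace T" "x \<notin> U" for x
      using Vzero[OF v that] by (simp add: h_def)
  next
    fix x assume "x \<in> U"
    then obtain v0 where v0: "v0 \<in> V" "v0 x > 0" using Vpos by blast
    obtain j where j: "v j = v0" using v0(1) V by (metis from_nat_into_surj v_def)
    obtain K :: nat where K: "real K * v0 x > 1" using v0(2) ex_less_of_nat_mult by blast
    have "h k x = 1" if k: "k \<ge> max K (Suc j)" for k
    proof -
      have "v j x \<le> (\<Sum>j<k. v j x)"
        by (rule member_le_sum) (use k V0[OF v] in auto)
      then have "real K * v0 x \<le> real k * (\<Sum>j<k. v j x)"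
        using k j v0(2) by (intro mult_mono) auto
      then show ?thesis using K by (simp add: h_def)
    qed
    then show "(\<lambda>k. h k x) \<longlonglongrightarrow> 1"
      by (intro tendsto_eventually) (auto simp: eventually_sequentially intro!: exI[of _ "max K (Suc j)"])
  qed
qed

end

section \<open>The portmanteau theorem from lower bounds on open sets\<close>

lemma staircase_bounds:
  fixes t :: real
  assumes "0 \<le> t" "t \<le> 1" "K > 0"
  defines "s \<equiv> (\<Sum>j=1..K. if t > real j / real K then 1 else 0 :: real) / real K"
  shows "t - 1 / real K \<le> s" "s \<le> t"
proof -
  \<comment> \<open>These are the levels j / K strictly below t. Counting them, with a floor from
    above and a ceiling from below, puts their number between K t - 1 and K t.\<close>
  let ?A = "{j\<in>{1..K}. real j < real K * t}"
  have s: "s = real (card ?A) / real K"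
  proof -
    have "(\<Sum>j=1..K. if t > real j / real K then 1 else 0 :: real) = (\<Sum>j\<in>?A. 1)"
      using \<open>K > 0\<close> by (intro sum.mono_neutral_cong_right) (auto simp: field_simps split: if_splits)
    then show ?thesis by (simp add: s_def)
  qed
  have "?A \<subseteq> {1..nat \<lfloor>real K * t\<rfloor>}" by (auto simp: le_nat_floor)
  then have "card ?A \<le> nat \<lfloor>real K * t\<rfloor>"
    using card_mono[of "{1..nat \<lfloor>real K * t\<rfloor>}"] by fastforce
  then have "real (card ?A) \<le> real K * t" using assms by (simp add: le_nat_iff le_floor_iff)
  then show "s \<le> t" using \<open>K > 0\<close> by (simp add: s field_simps)
  have Kt: "real K * t \<le> real K" using assms by (simp add: mult_left_le)
  have "{1..<nat \<lceil>real K * t\<rceil>} \<subseteq> ?A"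
  proof
    fix j assume "j \<in> {1..<nat \<lceil>real K * t\<rceil>}"
    then have "1 \<le> j" "real j < real K * t" by (auto, linarith)
    then show "j \<in> ?A" using Kt by auto
  qed
  then have "nat \<lceil>real K * t\<rceil> - 1 \<le> card ?A"
    using card_mono[of ?A "{1..<nat \<lceil>real K * t\<rceil>}"] by auto
  then have "real K * t - 1 \<le> real (card ?A)" by linarith
  then have "(real K * t - 1) / real K \<le> s" unfolding s by (intro divide_right_mono) auto
  then show "t - 1 / real K \<le> s" using \<open>K > 0\<close> by (simp add: diff_divide_distrib)
qed

text \<open>Up to 1 / K, f is the mean of the indicators of its superlevel sets, which are open, so
  lower bounds for finitely many open sets carry over to the integral. Half of \<delta> pays for the
  discretisation and half for the open sets. The measures are probabilities only eventually because
  the empirical measure of zero points is not one.\<close>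

lemma portmanteau_lower:
  assumes \<mu>: "\<forall>\<^sub>F a in F. \<mu> a \<in> prob_measures T" and \<nu>: "\<nu> \<in> prob_measures T"
    and op: "\<And>U \<delta>. openin T U \<Longrightarrow> 0 < \<delta> \<Longrightarrow> \<forall>\<^sub>F a in F. measure (\<mu> a) U > measure \<nu> U - \<delta>"
    and f: "f \<in> bcont T" "\<And>x. x \<in> topspace T \<Longrightarrow> 0 \<le> f x \<and> f x \<le> 1" and "\<delta> > 0"
  shows "\<forall>\<^sub>F a in F. integral\<^sup>L (\<mu> a) f > integral\<^sup>L \<nu> f - \<delta>"
proof -
  obtain K :: nat where "2/\<delta> < real K"
    using reals_Archimedean2 by blast
  moreover have "0 < 2/\<delta>" using \<open>\<delta> > 0\<close> by simp
  ultimately have "0 < real K" "2/\<delta> < real K" by linarith+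
  then have K: "1 / real K < \<delta> / 2" "K > 0"
    using \<open>\<delta> > 0\<close> by (simp_all add: field_simps)
  define U where "U = (\<lambda>j. {x \<in> topspace T. f x > real j / real K})"
  have U: "openin T (U j)" for j
  proof -
    have "openin T {x \<in> topspace T. f x \<in> {real j / real K<..}}"
      using f(1) by (auto simp: bcont_def continuous_map_def simp del: greaterThan_iff)
    then show ?thesis by (simp add: U_def)
  qed
  define s where "s = (\<lambda>x. (\<Sum>j=1..K. indicat_real (U j) x) / real K)"
  have s: "f x - 1 / real K \<le> s x" "s x \<le> f x" if "x \<in> topspace T" for x
  proof -
    have "s x = (\<Sum>j=1..K. if f x > real j / real K then 1 else 0) / real K"
      using that by (auto simp: s_def U_def intro!: sum.cong arg_cong[where f="\<lambda>t. t / real K"])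
    then show "f x - 1 / real K \<le> s x" "s x \<le> f x"
      using staircase_bounds[of "f x" K] f(2)[OF that] K(2) by auto
  qed
  have Is: "integrable m s \<and> integral\<^sup>L m s = (\<Sum>j=1..K. measure m (U j)) / real K"
    if "m \<in> prob_measures T" for m
  proof -
    note P = prob_measuresD[OF that]
    interpret prob_space m by fact
    have "U j \<in> sets m" for j using openin_sets_borel_of[OF U] P by auto
    then show ?thesis
      unfolding s_def by (auto simp: Bochner_Integration.integral_sum emeasure_eq_measure)
  qed
  have A: "integral\<^sup>L \<nu> f - 1 / real K \<le> integral\<^sup>L \<nu> s"
  proof -
    note P = prob_measuresD[OF \<nu>]
    interpret prob_space \<nu> by fact
    have "integral\<^sup>L \<nu> f - 1 / real K = integral\<^sup>L \<nu> (\<lambda>x. f x - 1 / real K)"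
      using prob_measures_integrable[OF \<nu> f(1)] by (simp add: prob_space)
    also have "\<dots> \<le> integral\<^sup>L \<nu> s"
      using prob_measures_integrable[OF \<nu> f(1)] Is[OF \<nu>] s(1) P by (intro integral_mono) auto
    finally show ?thesis .
  qed
  have "\<forall>\<^sub>F a in F. \<forall>j\<in>{1..K}. measure (\<mu> a) (U j) > measure \<nu> (U j) - \<delta>/2"
    using op[OF U, of "\<delta>/2"] \<open>\<delta> > 0\<close> by (intro eventually_ball_finite) auto
  then show ?thesis using \<mu>
  proof eventually_elim
    case (elim a)
    note P = prob_measuresD[OF elim(2)]
    have "integral\<^sup>L \<nu> s - \<delta> / 2 = (\<Sum>j=1..K. measure \<nu> (U j) - \<delta>/2) / real K"
      using Is[OF \<nu>] K(2) by (simp add: sum_subtractf diff_divide_distrib)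
    also have "\<dots> \<le> (\<Sum>j=1..K. measure (\<mu> a) (U j)) / real K"
      using elim(1) by (intro divide_right_mono sum_mono) (auto intro: less_imp_le)
    also have "\<dots> = integral\<^sup>L (\<mu> a) s" using Is[OF elim(2)] by simp
    also have "\<dots> \<le> integral\<^sup>L (\<mu> a) f"
      using prob_measures_integrable[OF elim(2) f(1)] Is[OF elim(2)] s(2) P by (intro integral_mono) auto
    finally show ?case using A K(1) by linarith
  qed
qed

text \<open>The one-sided bound is applied to g and to -g, both rescaled affinely into the unit
  interval.\<close>

lemma portmanteau_open:
  assumes \<mu>: "\<forall>\<^sub>F a in F. \<mu> a \<in> prob_measures T" and \<nu>: "\<nu> \<in> prob_measures T"
    and op: "\<And>U \<delta>. openin T U \<Longrightarrow> 0 < \<delta> \<Longrightarrow> \<forall>\<^sub>F a in F. measure (\<mu> a) U > measure \<nu> U - \<delta>"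
    and g: "g \<in> bcont T"
  shows "((\<lambda>a. integral\<^sup>L (\<mu> a) g) \<longlongrightarrow> integral\<^sup>L \<nu> g) F"
proof (rule tendstoI)
  fix e :: real assume "e > 0"
  obtain B where B: "B > 0" "\<And>x. x \<in> topspace T \<Longrightarrow> \<bar>g x\<bar> \<le> B" using g by (metis bcontE)
  define f1 where "f1 = (\<lambda>x. 1/2 + 1/(2*B) * g x)"
  define f2 where "f2 = (\<lambda>x. 1/2 + (-1/(2*B)) * g x)"
  have f: "f1 \<in> bcont T" "f2 \<in> bcont T"
    unfolding f1_def f2_def by (intro bcont_add bcont_mult bcont_const g)+
  have r: "0 \<le> f1 x \<and> f1 x \<le> 1" "0 \<le> f2 x \<and> f2 x \<le> 1" if "x \<in> topspace T" for x
    using B(2)[OF that] B(1) by (auto simp: f1_def f2_def field_simps abs_le_iff)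
  have I: "integral\<^sup>L m f1 = 1/2 + 1/(2*B) * integral\<^sup>L m g"
          "integral\<^sup>L m f2 = 1/2 + (-1/(2*B)) * integral\<^sup>L m g" if "m \<in> prob_measures T" for m
  proof -
    interpret prob_space m by (rule prob_measuresD[OF that])
    show "integral\<^sup>L m f1 = 1/2 + 1/(2*B) * integral\<^sup>L m g"
          "integral\<^sup>L m f2 = 1/2 + (-1/(2*B)) * integral\<^sup>L m g"
      unfolding f1_def f2_def
      by (subst Bochner_Integration.integral_add) (use prob_measures_integrable[OF that g] in \<open>auto simp: prob_space\<close>)
  qed
  have "e / (2*B) > 0" using \<open>e > 0\<close> B(1) by simp
  then have "\<forall>\<^sub>F a in F. integral\<^sup>L (\<mu> a) f1 > integral\<^sup>L \<nu> f1 - e / (2*B)"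
    "\<forall>\<^sub>F a in F. integral\<^sup>L (\<mu> a) f2 > integral\<^sup>L \<nu> f2 - e / (2*B)"
    using portmanteau_lower[OF \<mu> \<nu> op] f r by blast+
  from this \<mu>
  show "\<forall>\<^sub>F a in F. dist (integral\<^sup>L (\<mu> a) g) (integral\<^sup>L \<nu> g) < e"
  proof eventually_elim
    case (elim a)
    from elim(1) have "1/(2*B) * (integral\<^sup>L \<nu> g - integral\<^sup>L (\<mu> a) g) < 1/(2*B) * e"
      unfolding I(1)[OF elim(3)] I(1)[OF \<nu>] by (simp add: algebra_simps)
    then have 1: "integral\<^sup>L \<nu> g - integral\<^sup>L (\<mu> a) g < e" using B(1) by (simp add: divide_strict_right_mono divide_less_cancel)
    from elim(2) have "1/(2*B) * (integral\<^sup>L (\<mu> a) g - integral\<^sup>L \<nu> g) < 1/(2*B) * e"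
      unfolding I(2)[OF elim(3)] I(2)[OF \<nu>] by (simp add: algebra_simps)
    then have 2: "integral\<^sup>L (\<mu> a) g - integral\<^sup>L \<nu> g < e" using B(1) by (simp add: divide_less_cancel)
    from 1 2 show ?case by (simp add: dist_real_def abs_less_iff)
  qed
qed

section \<open>Weak convergence through monomials\<close>

text \<open>Some member of the algebra below the indicator of U has nearly the mass of U as its
  integral under the limit measure. Its integrals converge, and they bound the mass of U from
  below.\<close>

lemma (in uniform_algebra) eventually_measure_open:
  assumes gen: "generates T W" "countable W" and WQ: "W \<subseteq> Q"
    and \<mu>: "\<forall>\<^sub>F a in F. \<mu> a \<in> prob_measures T" and \<nu>: "\<nu> \<in> prob_measures T"
    and Qlim: "\<And>h. h \<in> Q \<Longrightarrow> ((\<lambda>a. integral\<^sup>L (\<mu> a) h) \<longlongrightarrow> integral\<^sup>L \<nu> h) F"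
    and U: "openin T U" and "0 < \<delta>"
  shows "\<forall>\<^sub>F a in F. measure (\<mu> a) U > measure \<nu> U - \<delta>"
proof -
  obtain h :: "nat \<Rightarrow> 'a \<Rightarrow> real" where h: "\<And>k. h k \<in> Q"
    "\<And>k x. x \<in> topspace T \<Longrightarrow> 0 \<le> h k x \<and> h k x \<le> 1"
    "\<And>k x. x \<in> topspace T \<Longrightarrow> x \<notin> U \<Longrightarrow> h k x = 0"
    "\<And>x. x \<in> U \<Longrightarrow> (\<lambda>k. h k x) \<longlonglongrightarrow> 1"
    using open_approx[OF gen WQ U] by metis
  have hb: "h k \<in> bcont T" for k using h(1) sub by auto
  have "(\<lambda>k. integral\<^sup>L \<nu> (h k)) \<longlonglongrightarrow> integral\<^sup>L \<nu> (indicat_real U)"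
  proof (rule integral_dominated_convergence)
    interpret prob_space \<nu> using prob_measuresD[OF \<nu>] by simp
    have "U \<in> sets \<nu>" using openin_sets_borel_of[OF U] prob_measuresD[OF \<nu>] by simp
    then show "indicat_real U \<in> borel_measurable \<nu>" by simp
    show "h k \<in> borel_measurable \<nu>" for k
      using prob_measures_integrable[OF \<nu> hb] by (rule borel_measurable_integrable)
    show "integrable \<nu> (\<lambda>_. 1::real)" by simp
    show "AE x in \<nu>. (\<lambda>k. h k x) \<longlonglongrightarrow> indicator U x"
    proof (rule AE_I2)
      fix x assume "x \<in> space \<nu>"
      then have "x \<in> topspace T" using prob_measuresD[OF \<nu>] by simp
      then show "(\<lambda>k. h k x) \<longlonglongrightarrow> indicator U x"
        using h(3,4)[of x] by (cases "x \<in> U") auto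
    qed
    show "AE x in \<nu>. norm (h k x) \<le> 1" for k
      by (rule AE_I2) (use h(2) prob_measuresD[OF \<nu>] in auto)
  qed
  moreover have "integral\<^sup>L \<nu> (indicat_real U) = measure \<nu> U"
    using openin_subset[OF U] prob_measuresD[OF \<nu>] by (simp add: Int_absorb2)
  ultimately have "\<forall>\<^sub>F k in sequentially. integral\<^sup>L \<nu> (h k) > measure \<nu> U - \<delta> / 2"
    using order_tendstoD(1)[of _ "measure \<nu> U" sequentially "measure \<nu> U - \<delta> / 2"] \<open>0 < \<delta>\<close> by simp
  then obtain k where k: "integral\<^sup>L \<nu> (h k) > measure \<nu> U - \<delta> / 2"
    by (auto dest: eventually_happens)
  have "\<forall>\<^sub>F a in F. integral\<^sup>L (\<mu> a) (h k) > integral\<^sup>L \<nu> (h k) - \<delta> / 2"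
    using order_tendstoD(1)[OF Qlim[OF h(1)]] \<open>0 < \<delta>\<close> by simp
  then show ?thesis using \<mu>
  proof eventually_elim
    case (elim a)
    note P = prob_measuresD[OF elim(2)]
    interpret prob_space "\<mu> a" by fact
    have Us: "U \<in> sets (\<mu> a)" using openin_sets_borel_of[OF U] P by simp
    have "integral\<^sup>L (\<mu> a) (h k) \<le> integral\<^sup>L (\<mu> a) (indicat_real U)"
    proof (rule integral_mono)
      show "h k x \<le> indicator U x" if "x \<in> space (\<mu> a)" for x
        using h(2,3)[of x k] that P by (auto simp: indicator_def)
    qed (use prob_measures_integrable[OF elim(2) hb] Us in \<open>auto simp: emeasure_eq_measure\<close>)
    also have "\<dots> = measure (\<mu> a) U" using Us by simp
    finally show ?case using elim(1) k by linarith
  qed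
qed

text \<open>Convergence of integrals is a linear property, so the functions having it need not form
  an algebra. Multipliers repair this: \<open>R\<close> contains the functions whose products with
  all monomials have convergent integrals, and \<open>Q\<close> the functions that map
  \<open>R\<close> into itself by multiplication. \<open>Q\<close> is closed under products because
  multiplications compose, and it contains W because a factor from W merely lengthens the monomial.
  The filter is arbitrary for the sake of \<open>generates_weak_top\<close>.\<close>

lemma weak_convergence_monomials:
  assumes gen: "generates T W" "countable W"
    and \<mu>: "\<forall>\<^sub>F a in F. \<mu> a \<in> prob_measures T" and \<nu>: "\<nu> \<in> prob_measures T"
    and mono: "\<And>ws. set ws \<subseteq> W \<Longrightarrow>
      ((\<lambda>a. \<integral>x. (\<Prod>w\<leftarrow>ws. w x) \<partial>\<mu> a) \<longlongrightarrow> (\<integral>x. (\<Prod>w\<leftarrow>ws. w x) \<partial>\<nu>)) F"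
    and g: "g \<in> bcont T"
  shows "((\<lambda>a. integral\<^sup>L (\<mu> a) g) \<longlongrightarrow> integral\<^sup>L \<nu> g) F"
proof -
  define m :: "('a \<Rightarrow> real) list \<Rightarrow> 'a \<Rightarrow> real" where "m = (\<lambda>ws x. \<Prod>w\<leftarrow>ws. w x)"
  have mb: "m ws \<in> bcont T" if "set ws \<subseteq> W" for ws
    unfolding m_def by (rule bcont_prod_list) (use that generates_bcont[OF gen(1)] in auto)
  have m1: "\<bar>m ws x\<bar> \<le> 1" if "set ws \<subseteq> W" "x \<in> topspace T" for ws x
    using that(1)
  proof (induction ws)
    case (Cons w ws)
    then show ?case using generates_range[OF gen(1), of w x] that(2)
      by (auto simp: m_def abs_mult intro!: mult_le_one)
  qed (simp add: m_def)
  define R where "R = {q \<in> bcont T. \<forall>ws. set ws \<subseteq> W \<longrightarrow>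
      ((\<lambda>a. \<integral>x. q x * m ws x \<partial>\<mu> a) \<longlongrightarrow> (\<integral>x. q x * m ws x \<partial>\<nu>)) F}"
  define Q where "Q = {p \<in> bcont T. \<forall>q\<in>R. (\<lambda>x. p x * q x) \<in> R}"
  have Rb: "q \<in> bcont T" if "q \<in> R" for q using that by (simp add: R_def)
  have RI: "(\<lambda>x. p x * q x) \<in> R" if "p \<in> Q" "q \<in> R" for p q using that by (simp add: Q_def)
  have RD: "((\<lambda>a. \<integral>x. q x * m ws x \<partial>\<mu> a) \<longlongrightarrow> (\<integral>x. q x * m ws x \<partial>\<nu>)) F"
    if "q \<in> R" "set ws \<subseteq> W" for q ws
    using that by (simp add: R_def)
  interpret uniform_algebra T Q
  proof
    show "Q \<subseteq> bcont T" by (auto simp: Q_def)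
    show "(\<lambda>_. c) \<in> Q" for c
      unfolding Q_def
    proof (intro CollectI conjI ballI bcont_const)
      fix q assume q: "q \<in> R"
      show "(\<lambda>x. c * q x) \<in> R"
        unfolding R_def
      proof (intro CollectI conjI allI impI)
        show "(\<lambda>x. c * q x) \<in> bcont T" by (intro bcont_mult bcont_const Rb q)
        fix ws assume "set ws \<subseteq> W"
        then show "((\<lambda>a. \<integral>x. c * q x * m ws x \<partial>\<mu> a) \<longlongrightarrow> (\<integral>x. c * q x * m ws x \<partial>\<nu>)) F"
          using tendsto_mult[OF tendsto_const RD[OF q], of ws c] by (simp add: mult.assoc)
      qed
    qed
    show "(\<lambda>x. f x + g x) \<in> Q" if "f \<in> Q" "g \<in> Q" for f g
      unfolding Q_def
    proof (intro CollectI conjI ballI)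
      show "(\<lambda>x. f x + g x) \<in> bcont T" using that by (auto simp: Q_def intro: bcont_add)
      fix q assume q: "q \<in> R"
      note fq = RI[OF that(1) q] and gq = RI[OF that(2) q]
      show "(\<lambda>x. (f x + g x) * q x) \<in> R"
        unfolding R_def
      proof (intro CollectI conjI allI impI)
        show "(\<lambda>x. (f x + g x) * q x) \<in> bcont T"
          using bcont_add[OF Rb[OF fq] Rb[OF gq]] by (simp add: algebra_simps)
        fix ws assume ws: "set ws \<subseteq> W"
        have split: "(\<integral>x. (f x + g x) * q x * m ws x \<partial>n) =
            (\<integral>x. f x * q x * m ws x \<partial>n) + (\<integral>x. g x * q x * m ws x \<partial>n)" if "n \<in> prob_measures T" for n
          unfolding distrib_right
          by (intro Bochner_Integration.integral_add prob_measures_integrable[OF that] bcont_mult[OF Rb mb] fq gq ws)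
        have "\<forall>\<^sub>F a in F. (\<integral>x. f x * q x * m ws x \<partial>\<mu> a) + (\<integral>x. g x * q x * m ws x \<partial>\<mu> a)
            = (\<integral>x. (f x + g x) * q x * m ws x \<partial>\<mu> a)"
          using \<mu> by eventually_elim (simp add: split)
        from Lim_transform_eventually[OF tendsto_add[OF RD[OF fq ws] RD[OF gq ws]] this]
        show "((\<lambda>a. \<integral>x. (f x + g x) * q x * m ws x \<partial>\<mu> a) \<longlongrightarrow> (\<integral>x. (f x + g x) * q x * m ws x \<partial>\<nu>)) F"
          by (simp only: split[OF \<nu>])
      qed
    qed
    show "(\<lambda>x. f x * g x) \<in> Q" if "f \<in> Q" "g \<in> Q" for f g
      unfolding Q_def
    proof (intro CollectI conjI ballI)
      show "(\<lambda>x. f x * g x) \<in> bcont T" using that by (intro bcont_mult) (simp_all add: Q_def)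
      fix q assume "q \<in> R"
      then have "(\<lambda>x. f x * (g x * q x)) \<in> R" by (intro RI that)
      then show "(\<lambda>x. f x * g x * q x) \<in> R" by (simp only: mult.assoc)
    qed
    show "f \<in> Q" if f: "f \<in> bcont T"
      and ap: "\<And>\<epsilon>. \<epsilon> > 0 \<Longrightarrow> \<exists>g\<in>Q. \<forall>x\<in>topspace T. \<bar>f x - g x\<bar> \<le> \<epsilon>" for f
      unfolding Q_def
    proof (intro CollectI conjI ballI f)
      fix q assume q: "q \<in> R"
      obtain B where B: "B > 0" "\<And>x. x \<in> topspace T \<Longrightarrow> \<bar>q x\<bar> \<le> B" using Rb[OF q] by (metis bcontE)
      show "(\<lambda>x. f x * q x) \<in> R"
        unfolding R_def
      proof (intro CollectI conjI allI impI bcont_mult f Rb q)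
        fix ws assume ws: "set ws \<subseteq> W"
        show "((\<lambda>a. \<integral>x. f x * q x * m ws x \<partial>\<mu> a) \<longlongrightarrow> (\<integral>x. f x * q x * m ws x \<partial>\<nu>)) F"
        proof (rule tendstoI)
          fix e :: real assume "e > 0"
          \<comment> \<open>One third of e pays for replacing f by g under each of the two measures,
            one third for the convergence. B bounds q, and monomials are bounded by 1.\<close>
          then have "e / (3 * B) > 0" using B(1) by simp
          from ap[OF this] obtain g where g: "g \<in> Q" "\<And>x. x \<in> topspace T \<Longrightarrow> \<bar>f x - g x\<bar> \<le> e / (3 * B)"
            by auto
          note gb = bcont_mult[OF Rb[OF RI[OF g(1) q]] mb[OF ws]]
          have close: "\<bar>(\<integral>x. f x * q x * m ws x \<partial>n) - (\<integral>x. g x * q x * m ws x \<partial>n)\<bar> \<le> e / 3"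
            if n: "n \<in> prob_measures T" for n
          proof -
            interpret prob_space n using prob_measuresD[OF n] by simp
            have I: "integrable n (\<lambda>x. f x * q x * m ws x)" "integrable n (\<lambda>x. g x * q x * m ws x)"
              by (intro prob_measures_integrable[OF n] bcont_mult f Rb[OF q] mb[OF ws])
                 (intro prob_measures_integrable[OF n] gb)
            have "\<bar>(\<integral>x. f x * q x * m ws x \<partial>n) - (\<integral>x. g x * q x * m ws x \<partial>n)\<bar>
                = \<bar>\<integral>x. f x * q x * m ws x - g x * q x * m ws x \<partial>n\<bar>"
              using I by simp
            also have "\<dots> \<le> (\<integral>x. \<bar>f x * q x * m ws x - g x * q x * m ws x\<bar> \<partial>n)"
              by (rule integral_abs_bound)
            also have "\<dots> \<le> (\<integral>x. e / 3 \<partial>n)"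
            proof (rule integral_mono)
              fix x assume "x \<in> space n"
              then have x: "x \<in> topspace T" using prob_measuresD[OF n] by simp
              have "\<bar>f x * q x * m ws x - g x * q x * m ws x\<bar> = \<bar>f x - g x\<bar> * \<bar>q x\<bar> * \<bar>m ws x\<bar>"
                by (simp add: abs_mult[symmetric] algebra_simps)
              also have "\<dots> \<le> e / (3 * B) * B * 1"
                using B(1) \<open>e > 0\<close> by (intro mult_mono g(2) B(2) m1 ws x) auto
              finally show "\<bar>f x * q x * m ws x - g x * q x * m ws x\<bar> \<le> e / 3" using B(1) by simp
            qed (use I in auto)
            finally show ?thesis by (simp add: prob_space)
          qed
          have "\<forall>\<^sub>F a in F. dist (\<integral>x. g x * q x * m ws x \<partial>\<mu> a) (\<integral>x. g x * q x * m ws x \<partial>\<nu>) < e / 3"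
            using tendstoD[OF RD[OF RI[OF g(1) q] ws], of "e/3"] \<open>e > 0\<close> by simp
          then show "\<forall>\<^sub>F a in F. dist (\<integral>x. f x * q x * m ws x \<partial>\<mu> a) (\<integral>x. f x * q x * m ws x \<partial>\<nu>) < e"
            using \<mu>
          proof eventually_elim
            case (elim a)
            with close[OF elim(2)] close[OF \<nu>] show ?case unfolding dist_real_def by linarith
          qed
        qed
      qed
    qed
  qed
  have one: "(\<lambda>_. 1) \<in> R"
    using mono by (auto simp: R_def m_def intro: bcont_const)
  have WQ: "W \<subseteq> Q"
  proof
    fix w assume w: "w \<in> W"
    have "(\<lambda>x. w x * q x) \<in> R" if q: "q \<in> R" for q
      unfolding R_def
    proof (intro CollectI conjI allI impI bcont_mult generates_bcont[OF gen(1) w] Rb[OF q])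
      fix ws assume "set ws \<subseteq> W"
      then have "set (w # ws) \<subseteq> W" using w by simp
      from RD[OF q this]
      show "((\<lambda>a. \<integral>x. w x * q x * m ws x \<partial>\<mu> a) \<longlongrightarrow> (\<integral>x. w x * q x * m ws x \<partial>\<nu>)) F"
        by (simp add: m_def mult_ac)
    qed
    then show "w \<in> Q" using generates_bcont[OF gen(1) w] by (simp add: Q_def)
  qed
  have Qlim: "((\<lambda>a. integral\<^sup>L (\<mu> a) h) \<longlongrightarrow> integral\<^sup>L \<nu> h) F" if "h \<in> Q" for h
    using RD[OF RI[OF that one], of "[]"] by (simp add: m_def)
  show ?thesis
    by (rule portmanteau_open[OF \<mu> \<nu> _ g]) (rule eventually_measure_open[OF gen WQ \<mu> \<nu> Qlim])
qed

section \<open>Generating families for metric spaces and for the weak topology\<close>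

lemma (in Metric_space) continuous_map_dist:
  "continuous_map mtopology euclideanreal (d x)" if "x \<in> M"
  unfolding continuous_map_def
proof (intro conjI allI impI)
  fix V :: "real set" assume "openin euclideanreal V"
  then have V: "open V" by simp
  show "openin mtopology {y \<in> topspace mtopology. d x y \<in> V}"
    unfolding openin_mtopology
  proof (intro conjI allI impI)
    fix y assume y: "y \<in> {y \<in> topspace mtopology. d x y \<in> V}"
    then obtain \<epsilon> where \<epsilon>: "\<epsilon> > 0" "\<And>t. \<bar>t - d x y\<bar> < \<epsilon> \<Longrightarrow> t \<in> V"
      using V unfolding open_dist dist_real_def by blast
    have "d x z \<in> V" if "z \<in> mball y \<epsilon>" for z
      by (rule \<epsilon>(2)) (use triangle[of x y z] triangle[of x z y] that \<open>x \<in> M\<close> in \<open>auto simp: abs_less_iff commute\<close>)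
    then show "\<exists>r>0. mball y r \<subseteq> {y \<in> topspace mtopology. d x y \<in> V}"
      using \<epsilon>(1) by (intro exI[of _ \<epsilon>]) auto
  qed auto
qed auto

text \<open>A single function suffices at each point x: the truncated distance to a point of D close
  to x.\<close>

lemma (in Metric_space) generates_dist:
  assumes "D \<subseteq> M" "mtopology closure_of D = M"
  shows "generates mtopology ((\<lambda>x y. min 1 (d x y)) ` D)"
  unfolding generates_def
proof (intro conjI ballI allI impI)
  fix w assume "w \<in> (\<lambda>x y. min 1 (d x y)) ` D"
  then obtain x where x: "x \<in> D" "w = (\<lambda>y. min 1 (d x y))" by blast
  then show "continuous_map mtopology euclideanreal w"
    using assms(1) by (auto intro!: continuous_map_real_min continuous_map_dist)
  show "0 \<le> w y" "w y \<le> 1" for y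
    using x by auto
next
  fix U x assume U: "openin mtopology U" and x: "x \<in> U"
  then have xM: "x \<in> M" using openin_subset by force
  obtain r where r: "r > 0" "mball x r \<subseteq> U" using U x by (metis openin_mtopology)
  \<comment> \<open>From d x x0 < \<rho> and d x0 y < 2 \<rho> it follows that d x y < 3 \<rho>
    \<le> r. Since 3 \<rho> \<le> 1, the truncation at 1 is inactive at these distances.\<close>
  define \<rho> where "\<rho> = min r 1 / 3"
  have \<rho>: "\<rho> > 0" "3 * \<rho> \<le> r" "3 * \<rho> \<le> 1" using r(1) by (auto simp: \<rho>_def)
  have "x \<in> mtopology closure_of D" using assms(2) xM by simp
  then obtain x0 where x0: "x0 \<in> D" "x0 \<in> mball x \<rho>"
    unfolding metric_closure_of using \<rho>(1) by blast
  have x0M: "x0 \<in> M" using x0 by simp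
  show "\<exists>W0 \<epsilon>. finite W0 \<and> W0 \<subseteq> (\<lambda>x y. min 1 (d x y)) ` D \<and> 0 < \<epsilon> \<and>
      (\<forall>y\<in>topspace mtopology. (\<forall>w\<in>W0. \<bar>w y - w x\<bar> < \<epsilon>) \<longrightarrow> y \<in> U)"
  proof (intro exI[of _ "{\<lambda>y. min 1 (d x0 y)}"] exI[of _ \<rho>] conjI ballI impI)
    fix y assume y: "y \<in> topspace mtopology" and *: "\<forall>w\<in>{\<lambda>y. min 1 (d x0 y)}. \<bar>w y - w x\<bar> < \<rho>"
    have "d x0 x < \<rho>" using x0 by (simp add: commute)
    moreover have "\<bar>min 1 (d x0 y) - min 1 (d x0 x)\<bar> < \<rho>" using * by simp
    ultimately have "d x0 y < 2 * \<rho>" using \<rho> by (auto simp: min_def split: if_splits)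
    then have "d x y < r" using triangle[of x x0 y] x0 y \<rho> by auto
    then show "y \<in> U" using r(2) xM y by auto
  qed (use x0 \<rho> in auto)
qed

text \<open>The integrals of these functions will generate the weak topology; the integrals of the
  members of W alone do not determine a measure in general.\<close>

definition monomials :: "('a \<Rightarrow> real) set \<Rightarrow> ('a \<Rightarrow> real) set" where
  "monomials W = (\<lambda>ws x. \<Prod>w\<leftarrow>ws. w x) ` lists W"

lemma countable_monomials: "countable W \<Longrightarrow> countable (monomials W)"
  unfolding monomials_def by (intro countable_image countable_lists)

lemma monomials_bcont: "generates T W \<Longrightarrow> m \<in> monomials W \<Longrightarrow> m \<in> bcont T"
  by (auto simp: monomials_def intro!: bcont_prod_list dest: generates_bcont)

lemma monomials_range:
  assumes "generates T W" "m \<in> monomials W" "x \<in> topspace T"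
  shows "0 \<le> m x \<and> m x \<le> 1"
proof -
  obtain ws where "ws \<in> lists W" "m = (\<lambda>x. \<Prod>w\<leftarrow>ws. w x)" using assms(2) by (auto simp: monomials_def)
  then show ?thesis
  proof (induction ws arbitrary: m)
    case (Cons w ws)
    then show ?case using generates_range[OF assms(1), of w x] assms(3) by (auto intro!: mult_le_one)
  qed simp
qed

lemma topspace_weak_top [simp]: "topspace (weak_top X) = prob_measures X"
  by (auto simp: weak_top_def topspace_pullback_topology)

lemma continuous_map_weak_top:
  assumes "f \<in> bcont X"
  shows "continuous_map (weak_top X) euclideanreal (\<lambda>\<mu>. integral\<^sup>L \<mu> f)"
proof -
  have "continuous_map (weak_top X) euclideanreal
      ((\<lambda>x. x f) \<circ> (\<lambda>\<mu>. restrict (\<lambda>f. integral\<^sup>L \<mu> f) (bcont X)))"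
    unfolding weak_top_def
    by (rule continuous_map_pullback)
       (use continuous_map_product_projection[OF assms, of "\<lambda>_. euclideanreal"] in \<open>simp add: euclidean_product_topology\<close>)
  then show ?thesis using assms by (simp add: comp_def)
qed

lemma limitin_weak_topD:
  assumes "limitin (weak_top X) a \<mu> F"
  shows "\<mu> \<in> prob_measures X" "\<forall>\<^sub>F k in F. a k \<in> prob_measures X"
    "f \<in> bcont X \<Longrightarrow> ((\<lambda>k. integral\<^sup>L (a k) f) \<longlongrightarrow> integral\<^sup>L \<mu> f) F"
proof -
  show "\<mu> \<in> prob_measures X" using assms by (auto simp: limitin_def)
  show "\<forall>\<^sub>F k in F. a k \<in> prob_measures X"
    using assms openin_topspace[of "weak_top X"] by (auto simp: limitin_def)
  show "((\<lambda>k. integral\<^sup>L (a k) f) \<longlongrightarrow> integral\<^sup>L \<mu> f) F" if "f \<in> bcont X"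
    using continuous_map_limit[OF continuous_map_weak_top[OF that] assms] by (simp add: comp_def)
qed

lemma limitin_weak_topI:
  assumes "\<mu> \<in> prob_measures X" "\<forall>\<^sub>F k in F. a k \<in> prob_measures X"
    "\<And>f. f \<in> bcont X \<Longrightarrow> ((\<lambda>k. integral\<^sup>L (a k) f) \<longlongrightarrow> integral\<^sup>L \<mu> f) F"
  shows "limitin (weak_top X) a \<mu> F"
proof -
  let ?h = "\<lambda>\<mu>. restrict (\<lambda>f. integral\<^sup>L \<mu> f) (bcont X)"
  let ?P = "product_topology (\<lambda>_. euclideanreal) (bcont X)"
  have lim: "limitin ?P (\<lambda>k. ?h (a k)) (?h \<mu>) F"
    unfolding limitin_componentwise using assms by auto
  show ?thesis
    unfolding limitin_def
  proof (intro conjI allI impI)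
    fix U assume U: "openin (weak_top X) U \<and> \<mu> \<in> U"
    then obtain V where V: "openin ?P V" "U = ?h -` V \<inter> prob_measures X"
      unfolding weak_top_def openin_pullback_topology by blast
    then have "\<forall>\<^sub>F k in F. ?h (a k) \<in> V" using lim U by (auto simp: limitin_def)
    then show "\<forall>\<^sub>F k in F. a k \<in> U" using assms(2) by eventually_elim (simp add: V)
  qed (use assms in simp)
qed

lemma uniform_algebra_bcont: "uniform_algebra T (bcont T)"
proof
  show "f \<in> bcont T" if "f \<in> bcont T" for f :: "'a \<Rightarrow> real" using that .
qed (auto intro: bcont_const bcont_add bcont_mult)

text \<open>The portmanteau theorem in its usual direction, read off with all of
  \<open>bcont T\<close> as the algebra.\<close>

lemma weak_limit_open:
  assumes "generates T W" "countable W" "limitin (weak_top T) \<mu> \<nu> F" "openin T U" "0 < \<delta>"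
  shows "\<forall>\<^sub>F a in F. measure (\<mu> a) U > measure \<nu> U - \<delta>"
  by (rule uniform_algebra.eventually_measure_open[OF uniform_algebra_bcont assms(1,2) _ limitin_weak_topD(2,1)[OF assms(3)]])
     (use assms in \<open>auto intro: limitin_weak_topD(3) generates_bcont\<close>)

text \<open>Let \<open>F\<close> be the filter generated by the sets on which one monomial integral
  is close to that of \<mu>. Along \<open>F\<close> all monomial integrals converge, hence the
  identity map converges weakly to \<mu>, and every weak neighbourhood U of \<mu> belongs to
  \<open>F\<close>. A member of \<open>F\<close> contains a finite intersection of generating sets,
  which is the required basic neighbourhood.\<close>

lemma generates_weak_top:
  assumes gen: "generates X W" "countable W"
  shows "generates (weak_top X) ((\<lambda>m \<mu>. integral\<^sup>L \<mu> m) ` monomials W)"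
  unfolding generates_def
proof (intro conjI ballI allI impI)
  fix w assume "w \<in> (\<lambda>m \<mu>. integral\<^sup>L \<mu> m) ` monomials W"
  then obtain m where m: "m \<in> monomials W" "w = (\<lambda>\<mu>. integral\<^sup>L \<mu> m)" by auto
  show "continuous_map (weak_top X) euclideanreal w"
    unfolding m by (intro continuous_map_weak_top monomials_bcont[OF gen(1) m(1)])
  fix \<mu> assume "\<mu> \<in> topspace (weak_top X)"
  then have \<mu>: "\<mu> \<in> prob_measures X" by simp
  note P = prob_measuresD[OF \<mu>]
  interpret prob_space \<mu> by fact
  show "0 \<le> w \<mu>" "w \<mu> \<le> 1"
    unfolding m using monomials_range[OF gen(1) m(1)] P prob_measures_integrable[OF \<mu> monomials_bcont[OF gen(1) m(1)]]
    by (auto intro!: integral_nonneg_AE integral_le_const)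
next
  fix U \<mu> assume U: "openin (weak_top X) U" and "\<mu> \<in> U"
  then have \<mu>: "\<mu> \<in> prob_measures X" using openin_subset by force
  define G where "G = (\<lambda>(m, \<epsilon>). {\<nu> \<in> prob_measures X. \<bar>integral\<^sup>L \<nu> m - integral\<^sup>L \<mu> m\<bar> < (\<epsilon>::real)})"
  define B where "B = monomials W \<times> {0::real<..}"
  define F where "F = (\<Sqinter>b\<in>B. principal (G b))"
  have ev: "\<forall>\<^sub>F \<nu> in F. \<nu> \<in> G b" if "b \<in> B" for b
    unfolding F_def by (rule eventually_INF1[OF that]) (simp add: eventually_principal)
  \<comment> \<open>Every set \<open>G b\<close> consists of probability measures; the constant
    monomial ensures that there is at least one such set.\<close>
  have one: "(\<lambda>_. 1) \<in> monomials W" by (auto simp: monomials_def intro!: image_eqI[of _ _ "[]"])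
  have evP: "\<forall>\<^sub>F \<nu> in F. \<nu> \<in> prob_measures X"
    using ev[of "(\<lambda>_. 1, 1)"] one by (auto simp: B_def G_def elim: eventually_mono)
  have "limitin (weak_top X) (\<lambda>\<nu>. \<nu>) \<mu> F"
  proof (rule limitin_weak_topI[OF \<mu> evP])
    fix f assume "f \<in> bcont X"
    then show "((\<lambda>\<nu>. integral\<^sup>L \<nu> f) \<longlongrightarrow> integral\<^sup>L \<mu> f) F"
    proof (rule weak_convergence_monomials[OF gen evP \<mu>, rotated])
      fix ws assume "set ws \<subseteq> W"
      then have m: "(\<lambda>x. \<Prod>w\<leftarrow>ws. w x) \<in> monomials W" by (auto simp: monomials_def)
      show "((\<lambda>\<nu>. \<integral>x. (\<Prod>w\<leftarrow>ws. w x) \<partial>\<nu>) \<longlongrightarrow> (\<integral>x. (\<Prod>w\<leftarrow>ws. w x) \<partial>\<mu>)) F"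
      proof (rule tendstoI)
        fix e :: real assume "e > 0"
        then show "\<forall>\<^sub>F \<nu> in F. dist (\<integral>x. (\<Prod>w\<leftarrow>ws. w x) \<partial>\<nu>) (\<integral>x. (\<Prod>w\<leftarrow>ws. w x) \<partial>\<mu>) < e"
          using ev[of "(\<lambda>x. \<Prod>w\<leftarrow>ws. w x, e)"] m
          by (auto simp: B_def G_def dist_real_def elim: eventually_mono)
      qed
    qed
  qed
  then have "\<forall>\<^sub>F \<nu> in F. \<nu> \<in> U" using U \<open>\<mu> \<in> U\<close> by (auto simp: limitin_def)
  then have "\<exists>Z\<subseteq>B. finite Z \<and> (\<forall>\<^sub>F \<nu> in (\<Sqinter>b\<in>Z. principal (G b)). \<nu> \<in> U)"
    unfolding F_def by (subst (asm) eventually_INF)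
  then obtain Z where Z: "Z \<subseteq> B" "finite Z" "\<forall>\<^sub>F \<nu> in (\<Sqinter>b\<in>Z. principal (G b)). \<nu> \<in> U"
    by blast
  from Z(3) have ZU: "\<nu> \<in> U" if "\<And>b. b \<in> Z \<Longrightarrow> \<nu> \<in> G b" for \<nu>
    using that unfolding INF_principal_finite[OF Z(2)] eventually_principal by blast
  define \<epsilon> where "\<epsilon> = Min (insert 1 (snd ` Z))"
  have "\<epsilon> > 0" using Z by (auto simp: \<epsilon>_def B_def)
  have \<epsilon>: "\<epsilon> \<le> snd b" if "b \<in> Z" for b using Z that by (auto simp: \<epsilon>_def)
  show "\<exists>W0 \<epsilon>. finite W0 \<and> W0 \<subseteq> (\<lambda>m \<mu>. integral\<^sup>L \<mu> m) ` monomials W \<and> 0 < \<epsilon> \<and>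
      (\<forall>\<nu>\<in>topspace (weak_top X). (\<forall>w\<in>W0. \<bar>w \<nu> - w \<mu>\<bar> < \<epsilon>) \<longrightarrow> \<nu> \<in> U)"
  proof (intro exI[of _ "(\<lambda>m \<mu>. integral\<^sup>L \<mu> m) ` fst ` Z"] exI[of _ \<epsilon>] conjI ballI impI)
    fix \<nu> assume \<nu>: "\<nu> \<in> topspace (weak_top X)"
      "\<forall>w\<in>(\<lambda>m \<mu>. integral\<^sup>L \<mu> m) ` fst ` Z. \<bar>w \<nu> - w \<mu>\<bar> < \<epsilon>"
    show "\<nu> \<in> U"
    proof (rule ZU)
      fix b assume "b \<in> Z"
      then have "(\<lambda>\<mu>. integral\<^sup>L \<mu> (fst b)) \<in> (\<lambda>m \<mu>. integral\<^sup>L \<mu> m) ` fst ` Z" by (intro imageI)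
      from bspec[OF \<nu>(2) this] have "\<bar>integral\<^sup>L \<nu> (fst b) - integral\<^sup>L \<mu> (fst b)\<bar> < \<epsilon>" .
      then show "\<nu> \<in> G b" using \<nu>(1) \<epsilon>[OF \<open>b \<in> Z\<close>] by (cases b) (auto simp: G_def)
    qed
  qed (use Z \<open>\<epsilon> > 0\<close> in \<open>auto simp: B_def\<close>)
qed

section \<open>Product topologies, and Borel measurability through generating families\<close>

definition coordinate_functions :: "'i set \<Rightarrow> ('i \<Rightarrow> ('a \<Rightarrow> real) set) \<Rightarrow> (('i \<Rightarrow> 'a) \<Rightarrow> real) set" where
  "coordinate_functions I W = (\<Union>i\<in>I. (\<lambda>w x. w (x i)) ` W i)"

lemma countable_coordinate_functions:
  "countable I \<Longrightarrow> (\<And>i. i \<in> I \<Longrightarrow> countable (W i)) \<Longrightarrow> countable (coordinate_functions I W)"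
  by (auto simp: coordinate_functions_def)

lemma generates_product:
  assumes gen: "\<And>i. i \<in> I \<Longrightarrow> generates (T i) (W i)"
  shows "generates (product_topology T I) (coordinate_functions I W)"
  unfolding generates_def
proof (intro conjI ballI allI impI)
  fix w assume "w \<in> coordinate_functions I W"
  then obtain i v where iv: "i \<in> I" "v \<in> W i" "w = (\<lambda>x. v (x i))"
    by (auto simp: coordinate_functions_def)
  have "continuous_map (product_topology T I) euclideanreal (v \<circ> (\<lambda>x. x i))"
    by (rule continuous_map_compose[OF continuous_map_product_projection[OF iv(1)]])
       (use gen[OF iv(1)] iv(2) in \<open>auto simp: generates_def\<close>)
  then show "continuous_map (product_topology T I) euclideanreal w" by (simp add: comp_def iv)
  fix x assume "x \<in> topspace (product_topology T I)"
  then show "0 \<le> w x" "w x \<le> 1"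
    using generates_range[OF gen[OF iv(1)] iv(2), of "x i"] iv by auto
next
  fix U x assume "openin (product_topology T I) U" "x \<in> U"
  then obtain V where V: "finite {i \<in> I. V i \<noteq> topspace (T i)}" "\<And>i. i \<in> I \<Longrightarrow> openin (T i) (V i)"
    "x \<in> Pi\<^sub>E I V" "Pi\<^sub>E I V \<subseteq> U"
    unfolding openin_product_topology_alt by metis
  define J where "J = {i \<in> I. V i \<noteq> topspace (T i)}"
  have "\<exists>W0 \<epsilon>. finite W0 \<and> W0 \<subseteq> W i \<and> \<epsilon> > 0 \<and>
      (\<forall>y\<in>topspace (T i). (\<forall>w\<in>W0. \<bar>w y - w (x i)\<bar> < \<epsilon>) \<longrightarrow> y \<in> V i)" if "i \<in> J" for i
    using gen[of i] V(2)[of i] V(3) that unfolding generates_def by (fastforce simp: J_def PiE_iff)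
  then obtain W0 \<epsilon> where W0: "\<And>i. i \<in> J \<Longrightarrow> finite (W0 i) \<and> W0 i \<subseteq> W i \<and> \<epsilon> i > 0 \<and>
      (\<forall>y\<in>topspace (T i). (\<forall>w\<in>W0 i. \<bar>w y - w (x i)\<bar> < \<epsilon> i) \<longrightarrow> y \<in> V i)"
    by metis
  have J: "finite J" "J \<subseteq> I" using V(1) by (auto simp: J_def)
  define e where "e = Min (insert 1 (\<epsilon> ` J))"
  have "e > 0" using W0 J by (auto simp: e_def)
  have e: "e \<le> \<epsilon> i" if "i \<in> J" for i using J that by (auto simp: e_def)
  show "\<exists>W0 \<epsilon>. finite W0 \<and> W0 \<subseteq> coordinate_functions I W \<and> 0 < \<epsilon> \<and>
      (\<forall>y\<in>topspace (product_topology T I). (\<forall>w\<in>W0. \<bar>w y - w x\<bar> < \<epsilon>) \<longrightarrow> y \<in> U)"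
  proof (intro exI[of _ "coordinate_functions J W0"] exI[of _ e] conjI ballI impI)
    show "finite (coordinate_functions J W0)" using J W0 by (auto simp: coordinate_functions_def)
    show "coordinate_functions J W0 \<subseteq> coordinate_functions I W"
      using J W0 unfolding coordinate_functions_def by blast
    fix y assume y: "y \<in> topspace (product_topology T I)"
      and yw: "\<forall>w\<in>coordinate_functions J W0. \<bar>w y - w x\<bar> < e"
    have "y i \<in> V i" if "i \<in> I" for i
    proof (cases "i \<in> J")
      case True
      have "\<bar>w (y i) - w (x i)\<bar> < \<epsilon> i" if "w \<in> W0 i" for w
        using yw e[OF True] that True unfolding coordinate_functions_def by fastforce
      moreover have "y i \<in> topspace (T i)" using y \<open>i \<in> I\<close> by auto
      ultimately show ?thesis using W0[OF True] by blast
    next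
      case False
      then show ?thesis using y that by (auto simp: J_def)
    qed
    then have "y \<in> Pi\<^sub>E I V" using y by (auto simp: PiE_iff)
    then show "y \<in> U" using V(4) by blast
  qed fact
qed

text \<open>An open set may be an uncountable union of basic ones, and this is where countability of
  W enters: \<open>open_approx\<close> writes U as the set where some \<open>h k\<close> is
  positive. The functions with measurable composite form a uniform algebra because pointwise limits
  preserve measurability.\<close>

lemma measurable_borel_of_generates:
  assumes gen: "generates T W" "countable W" and Y: "Y \<in> space M \<rightarrow> topspace T"
    and meas: "\<And>w. w \<in> W \<Longrightarrow> (\<lambda>\<omega>. w (Y \<omega>)) \<in> borel_measurable M"
  shows "Y \<in> M \<rightarrow>\<^sub>M borel_of T"
proof -
  define Q where "Q = {p \<in> bcont T. (\<lambda>\<omega>. p (Y \<omega>)) \<in> borel_measurable M}"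
  interpret uniform_algebra T Q
  proof
    fix f assume f: "f \<in> bcont T"
      and ap: "\<And>\<epsilon>. \<epsilon> > 0 \<Longrightarrow> \<exists>g\<in>Q. \<forall>x\<in>topspace T. \<bar>f x - g x\<bar> \<le> \<epsilon>"
    have "\<exists>g\<in>Q. \<forall>x\<in>topspace T. \<bar>f x - g x\<bar> \<le> inverse (real (Suc n))" for n
      by (rule ap) simp
    then obtain g where g: "\<And>n. g n \<in> Q" "\<And>n x. x \<in> topspace T \<Longrightarrow> \<bar>f x - g n x\<bar> \<le> inverse (real (Suc n))"
      by metis
    have "(\<lambda>\<omega>. f (Y \<omega>)) \<in> borel_measurable M"
    proof (rule borel_measurable_LIMSEQ_real)
      show "(\<lambda>\<omega>. g n (Y \<omega>)) \<in> borel_measurable M" for n using g(1) by (simp add: Q_def)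
      fix \<omega> assume "\<omega> \<in> space M"
      then have "Y \<omega> \<in> topspace T" using Y by auto
      then have "(\<lambda>n. f (Y \<omega>) - g n (Y \<omega>)) \<longlonglongrightarrow> 0"
        using g(2) by (intro Lim_null_comparison[OF always_eventually LIMSEQ_inverse_real_of_nat]) simp
      from tendsto_diff[OF tendsto_const[of "f (Y \<omega>)"] this]
      show "(\<lambda>n. g n (Y \<omega>)) \<longlonglongrightarrow> f (Y \<omega>)" by simp
    qed
    then show "f \<in> Q" using f by (simp add: Q_def)
  qed (auto simp: Q_def intro: bcont_const bcont_add bcont_mult)
  have WQ: "W \<subseteq> Q" using meas generates_bcont[OF gen(1)] by (auto simp: Q_def)
  show ?thesis
  proof (rule measurable_borel_ofI[OF Y])
    fix U assume U: "openin T U"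
    obtain h :: "nat \<Rightarrow> 'a \<Rightarrow> real" where h: "\<And>k. h k \<in> Q"
      "\<And>k x. x \<in> topspace T \<Longrightarrow> 0 \<le> h k x \<and> h k x \<le> 1"
      "\<And>k x. x \<in> topspace T \<Longrightarrow> x \<notin> U \<Longrightarrow> h k x = 0"
      "\<And>x. x \<in> U \<Longrightarrow> (\<lambda>k. h k x) \<longlonglongrightarrow> 1"
      using open_approx[OF gen WQ U] by metis
    have "x \<in> U \<longleftrightarrow> (\<exists>k. h k x > 0)" if "x \<in> topspace T" for x
    proof
      assume "x \<in> U"
      from order_tendstoD(1)[OF h(4)[OF this], of 0] show "\<exists>k. h k x > 0"
        by (auto dest: eventually_happens)
    next
      assume "\<exists>k. h k x > 0"
      then show "x \<in> U" using h(3)[OF that] by fastforce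
    qed
    then have "Y -` U \<inter> space M = {\<omega> \<in> space M. \<exists>k. h k (Y \<omega>) > 0}" using Y by auto
    moreover have "(\<lambda>\<omega>. h k (Y \<omega>)) \<in> borel_measurable M" for k using h(1) by (simp add: Q_def)
    ultimately show "Y -` U \<inter> space M \<in> sets M" by simp
  qed
qed

section \<open>Averages of equicorrelated sequences\<close>

text \<open>Division by zero makes \<open>average z 0\<close> equal to 0, in agreement with bounds
  such as \<open>average_bounded\<close>.\<close>

definition average :: "(nat \<Rightarrow> real) \<Rightarrow> nat \<Rightarrow> real" where
  "average z k = (\<Sum>n=1..k. z n) / real k"

lemma average_bounded:
  assumes "\<And>n. n \<ge> 1 \<Longrightarrow> \<bar>z n\<bar> \<le> B" "B \<ge> 0"
  shows "\<bar>average z k\<bar> \<le> B"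
proof -
  have "\<bar>\<Sum>n=1..k. z n\<bar> \<le> (\<Sum>n=1..k. \<bar>z n\<bar>)" by (rule sum_abs)
  also have "\<dots> \<le> (\<Sum>n=1..k. B)" by (rule sum_mono) (use assms in auto)
  finally show ?thesis using assms(2) by (cases "k = 0") (auto simp: average_def field_simps)
qed

text \<open>Passing from m to n adds n - m new terms and rescales the old mean; each effect is at
  most (n - m) / n.\<close>

lemma average_diff:
  assumes z: "\<And>n. n \<ge> 1 \<Longrightarrow> \<bar>z n\<bar> \<le> 1" and "1 \<le> m" "m \<le> n"
  shows "\<bar>average z n - average z m\<bar> \<le> 2 * (real n - real m) / real n"
proof -
  have split: "(\<Sum>j=1..n. z j) = (\<Sum>j=1..m. z j) + (\<Sum>j=Suc m..n. z j)"
    using sum.ub_add_nat[of 1 m z "n - m"] assms by simp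
  have "\<bar>\<Sum>j=Suc m..n. z j\<bar> \<le> (\<Sum>j=Suc m..n. \<bar>z j\<bar>)" by (rule sum_abs)
  also have "\<dots> \<le> (\<Sum>j=Suc m..n. 1)" by (rule sum_mono) (use z in auto)
  also have "\<dots> = real n - real m" using assms by (simp add: of_nat_diff)
  finally have a: "\<bar>\<Sum>j=Suc m..n. z j\<bar> \<le> real n - real m" .
  have m: "\<bar>average z m\<bar> \<le> 1" using average_bounded[of z 1] z by simp
  have "\<bar>(real n - real m) * average z m\<bar> \<le> (real n - real m) * 1"
    unfolding abs_mult using assms m by (intro mult_mono) auto
  moreover have "average z n - average z m = ((\<Sum>j=Suc m..n. z j) - (real n - real m) * average z m) / real n"
    using assms split by (simp add: average_def field_simps)
  ultimately have "\<bar>average z n - average z m\<bar> \<le> ((real n - real m) + (real n - real m)) / real n"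
    using a by (simp add: abs_divide divide_right_mono abs_le_iff)
  then show ?thesis by (simp add: field_simps)
qed

text \<open>The relative gap between consecutive cubes tends to 0, so by \<open>average_diff\<close>
  the averages hardly move in between. The cubes are also sparse enough for the summable increments
  of \<open>cube_step\<close>.\<close>

lemma average_convergent_cubes:
  assumes z: "\<And>n. n \<ge> 1 \<Longrightarrow> \<bar>z n\<bar> \<le> 1" and conv: "(\<lambda>k. average z (Suc k ^ 3)) \<longlonglongrightarrow> l"
  shows "average z \<longlonglongrightarrow> l"
proof (rule LIMSEQ_I)
  fix e :: real assume "e > 0"
  have "(\<lambda>k. 2 * (real (Suc (Suc k) ^ 3) - real (Suc k ^ 3)) / real (Suc k ^ 3)) \<longlonglongrightarrow> 0"
    by real_asymp
  from LIMSEQ_D[OF this, of "e/2"] obtain K1 where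
    K1: "\<And>k. k \<ge> K1 \<Longrightarrow> \<bar>2 * (real (Suc (Suc k) ^ 3) - real (Suc k ^ 3)) / real (Suc k ^ 3)\<bar> < e/2"
    using \<open>e > 0\<close> by auto
  from LIMSEQ_D[OF conv, of "e/2"] obtain K2 where
    K2: "\<And>k. k \<ge> K2 \<Longrightarrow> \<bar>average z (Suc k ^ 3) - l\<bar> < e/2"
    using \<open>e > 0\<close> by auto
  define K where "K = max K1 K2"
  show "\<exists>N. \<forall>n\<ge>N. norm (average z n - l) < e"
  proof (intro exI[of _ "Suc K ^ 3"] allI impI)
    fix n assume n: "n \<ge> Suc K ^ 3"
    \<comment> \<open>The least j with n < (j + 1)^3 is positive here, and its predecessor k
      satisfies (k + 1)^3 \<le> n < (k + 2)^3.\<close>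
    define j where "j = (LEAST j. n < Suc j ^ 3)"
    have "n < Suc n ^ 3" using self_le_power[of "Suc n" 3] by simp
    then have j: "n < Suc j ^ 3" unfolding j_def by (rule LeastI)
    have "j > K"
    proof (rule ccontr)
      assume "\<not> j > K"
      then have "Suc j ^ 3 \<le> Suc K ^ 3" by (intro power_mono) auto
      with j n show False by linarith
    qed
    then obtain k where k: "j = Suc k" "k \<ge> K" by (cases j) auto
    have "\<not> n < Suc k ^ 3" using not_less_Least[of k "\<lambda>j. n < Suc j ^ 3"] k j_def by simp
    then have kn: "Suc k ^ 3 \<le> n" by simp
    have "\<bar>average z n - average z (Suc k ^ 3)\<bar> \<le> 2 * (real n - real (Suc k ^ 3)) / real n"
      by (rule average_diff) (use z kn in auto)
    also have "\<dots> \<le> 2 * (real (Suc (Suc k) ^ 3) - real (Suc k ^ 3)) / real (Suc k ^ 3)"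
    proof (rule frac_le)
      show "2 * (real n - real (Suc k ^ 3)) \<le> 2 * (real (Suc (Suc k) ^ 3) - real (Suc k ^ 3))"
      proof (intro mult_left_mono diff_right_mono)
        show "real n \<le> real (Suc (Suc k) ^ 3)" using j k(1) by (simp only: of_nat_le_iff less_imp_le)
      qed simp
      show "0 < real (Suc k ^ 3)" by simp
      show "real (Suc k ^ 3) \<le> real n" using kn by (simp only: of_nat_le_iff)
      have "Suc k ^ 3 \<le> Suc (Suc k) ^ 3" by (intro power_mono) auto
      then show "0 \<le> 2 * (real (Suc (Suc k) ^ 3) - real (Suc k ^ 3))"
        by (intro mult_nonneg_nonneg) (simp_all only: diff_ge_0_iff_ge of_nat_le_iff zero_le_numeral)
    qed
    also have "\<dots> < e / 2" using K1[of k] k(2) by (simp only: K_def) linarith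
    finally have 1: "\<bar>average z n - average z (Suc k ^ 3)\<bar> < e / 2" .
    have 2: "\<bar>average z (Suc k ^ 3) - l\<bar> < e / 2" using K2[of k] k(2) by (simp add: K_def)
    define u where "u = average z (Suc k ^ 3)"
    show "norm (average z n - l) < e" using 1 2 unfolding u_def[symmetric] real_norm_def by linarith
  qed
qed

text \<open>Integrated with a well chosen \<delta>, this does the work of the Cauchy-Schwarz
  inequality in passing from mean square to mean absolute value.\<close>

lemma abs_le_amgm: "\<bar>x\<bar> \<le> (\<delta> + x\<^sup>2 / \<delta>) / 2" if "\<delta> > 0" for x \<delta> :: real
proof -
  have "0 \<le> (\<bar>x\<bar> - \<delta>)\<^sup>2" by simp
  then have "2 * \<bar>x\<bar> * \<delta> \<le> \<delta> * \<delta> + x\<^sup>2" by (simp add: power2_eq_square algebra_simps)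
  then show ?thesis using that by (simp add: field_simps power2_eq_square)
qed

text \<open>Only the second moments of the exchangeable sequence enter: the averages form an explicit
  Cauchy sequence in mean square.\<close>
locale equicorrelated = prob_space M for M :: "'w measure" +
  fixes Z :: "nat \<Rightarrow> 'w \<Rightarrow> real" and a b :: real
  assumes meas: "\<And>n. n \<ge> 1 \<Longrightarrow> Z n \<in> borel_measurable M"
    and bound: "\<And>n \<omega>. n \<ge> 1 \<Longrightarrow> \<omega> \<in> space M \<Longrightarrow> \<bar>Z n \<omega>\<bar> \<le> 1"
    and square: "\<And>n. n \<ge> 1 \<Longrightarrow> (\<integral>\<omega>. Z n \<omega> * Z n \<omega> \<partial>M) = b"
    and cross: "\<And>n m. n \<ge> 1 \<Longrightarrow> m \<ge> 1 \<Longrightarrow> n \<noteq> m \<Longrightarrow> (\<integral>\<omega>. Z n \<omega> * Z m \<omega> \<partial>M) = a"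
begin

definition A :: "nat \<Rightarrow> 'w \<Rightarrow> real" where "A k \<omega> = average (\<lambda>n. Z n \<omega>) k"

lemma A_measurable [measurable]: "A k \<in> borel_measurable M"
  unfolding A_def average_def using meas by (intro borel_measurable_divide borel_measurable_sum) auto

lemma A_bound: "\<omega> \<in> space M \<Longrightarrow> \<bar>A k \<omega>\<bar> \<le> 1"
  unfolding A_def by (rule average_bounded) (use bound in auto)

lemma int_ZZ: "n \<ge> 1 \<Longrightarrow> m \<ge> 1 \<Longrightarrow> integrable M (\<lambda>\<omega>. Z n \<omega> * Z m \<omega>)"
  by (rule integrable_const_bound[where B=1])
     (use bound meas in \<open>auto simp: abs_mult intro!: mult_le_one\<close>)

text \<open>Both second moments lie in [-1, 1]. This constant is what makes the later error bounds
  the same for all systems.\<close>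

lemma moment_diff: "b - a \<le> 2"
proof -
  have "\<bar>\<integral>\<omega>. Z n \<omega> * Z m \<omega> \<partial>M\<bar> \<le> 1" if "n \<ge> 1" "m \<ge> 1" for n m
  proof -
    have "\<bar>\<integral>\<omega>. Z n \<omega> * Z m \<omega> \<partial>M\<bar> \<le> (\<integral>\<omega>. \<bar>Z n \<omega> * Z m \<omega>\<bar> \<partial>M)" by (rule integral_abs_bound)
    also have "\<dots> \<le> (\<integral>\<omega>. 1 \<partial>M)"
      by (rule integral_mono) (use integrable_abs[OF int_ZZ[OF that]] bound that in \<open>auto simp: abs_mult intro!: mult_le_one\<close>)
    finally show ?thesis by (simp add: prob_space)
  qed
  from this[of 1 1] this[of 1 2] show ?thesis using square[of 1] cross[of 1 2] by (simp add: abs_le_iff)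
qed

text \<open>Of the K L pairs exactly K are diagonal, one in each row since K \<le> L; they
  contribute b instead of a.\<close>

lemma moment_A:
  assumes "1 \<le> K" "K \<le> L"
  shows "(\<integral>\<omega>. A K \<omega> * A L \<omega> \<partial>M) = a + (b - a) / real L"
proof -
  have "(\<integral>\<omega>. A K \<omega> * A L \<omega> \<partial>M)
      = (\<integral>\<omega>. (\<Sum>n=1..K. \<Sum>m=1..L. Z n \<omega> * Z m \<omega>) / (real K * real L) \<partial>M)"
    by (simp add: A_def average_def sum_product)
  also have "\<dots> = (\<integral>\<omega>. (\<Sum>n=1..K. \<Sum>m=1..L. Z n \<omega> * Z m \<omega>) \<partial>M) / (real K * real L)"
    by simp
  also have "(\<integral>\<omega>. (\<Sum>n=1..K. \<Sum>m=1..L. Z n \<omega> * Z m \<omega>) \<partial>M)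
      = (\<Sum>n=1..K. \<Sum>m=1..L. (\<integral>\<omega>. Z n \<omega> * Z m \<omega> \<partial>M))"
    by (subst Bochner_Integration.integral_sum)
       (auto intro!: Bochner_Integration.integrable_sum int_ZZ sum.cong Bochner_Integration.integral_sum)
  also have "\<dots> = (\<Sum>n=1..K. \<Sum>m=1..L. a + (if m = n then b - a else 0))"
    using square cross by (intro sum.cong) auto
  also have "\<dots> = (\<Sum>n=1..K. real L * a + (b - a))"
    using assms by (intro sum.cong refl) (auto simp: sum.distrib sum.delta)
  also have "\<dots> / (real K * real L) = a + (b - a) / real L"
    using assms by (simp add: field_simps)
  finally show ?thesis .
qed

lemma int_AA: "integrable M (\<lambda>\<omega>. A K \<omega> * A L \<omega>)"
  by (rule integrable_const_bound[where B=1])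
     (use A_bound in \<open>auto simp: abs_mult intro!: mult_le_one\<close>)

lemma mean_square:
  assumes "1 \<le> K" "K \<le> L"
  shows "(\<integral>\<omega>. (A K \<omega> - A L \<omega>)\<^sup>2 \<partial>M) = (b - a) * (1 / real K - 1 / real L)"
proof -
  have "(\<integral>\<omega>. (A K \<omega> - A L \<omega>)\<^sup>2 \<partial>M) =
      (\<integral>\<omega>. A K \<omega> * A K \<omega> - 2 * (A K \<omega> * A L \<omega>) + A L \<omega> * A L \<omega> \<partial>M)"
    by (simp add: power2_eq_square algebra_simps)
  also have "\<dots> = (\<integral>\<omega>. A K \<omega> * A K \<omega> \<partial>M) - 2 * (\<integral>\<omega>. A K \<omega> * A L \<omega> \<partial>M) + (\<integral>\<omega>. A L \<omega> * A L \<omega> \<partial>M)"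
    using int_AA by simp
  also have "\<dots> = (b - a) * (1 / real K - 1 / real L)"
    using assms by (simp add: moment_A algebra_simps)
  finally show ?thesis .
qed

lemma int_diff_sq: "integrable M (\<lambda>\<omega>. (A K \<omega> - A L \<omega>)\<^sup>2)"
proof (rule integrable_const_bound[where B="2\<^sup>2"])
  show "AE \<omega> in M. norm ((A K \<omega> - A L \<omega>)\<^sup>2) \<le> 2\<^sup>2"
  proof (rule AE_I2)
    fix \<omega> assume "\<omega> \<in> space M"
    then have "\<bar>A K \<omega> - A L \<omega>\<bar> \<le> 2" using A_bound[of \<omega> K] A_bound[of \<omega> L] by linarith
    then have "\<bar>A K \<omega> - A L \<omega>\<bar>\<^sup>2 \<le> 2\<^sup>2" by (intro power_mono) auto
    then show "norm ((A K \<omega> - A L \<omega>)\<^sup>2) \<le> 2\<^sup>2" by simp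
  qed
qed simp

text \<open>By \<open>mean_square\<close>, the mean square increment between neighbouring cubes is
  of order 1 / j^4, so the mean increment is of order 1 / j^2.\<close>

lemma cube_step: "(\<integral>\<omega>. \<bar>A (Suc k ^ 3) \<omega> - A (Suc (Suc k) ^ 3) \<omega>\<bar> \<partial>M) \<le> 8 / real (Suc k) ^ 2"
proof -
  define j where "j = real (Suc k)"
  have j: "j \<ge> 1" "real (Suc (Suc k)) = j + 1" by (simp_all add: j_def)
  have 1: "1 / j ^ 3 - 1 / (j + 1) ^ 3 \<le> 7 / j ^ 4"
  proof -
    have "1 / j ^ 3 - 1 / (j + 1) ^ 3 = ((j + 1) ^ 3 - j ^ 3) / (j ^ 3 * (j + 1) ^ 3)"
      using j(1) by (simp add: field_simps)
    \<comment> \<open>The numerator is 3 j^2 + 3 j + 1, and j \<ge> 1.\<close>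
    also have "\<dots> \<le> (7 * j\<^sup>2) / (j ^ 3 * j ^ 3)"
    proof (rule frac_le)
      have "1 \<le> j\<^sup>2" "j \<le> j\<^sup>2" using j(1) by (auto simp: power2_eq_square intro: order_trans)
      then show "(j + 1) ^ 3 - j ^ 3 \<le> 7 * j\<^sup>2" by (simp add: power3_eq_cube power2_eq_square algebra_simps)
      show "j ^ 3 * j ^ 3 \<le> j ^ 3 * (j + 1) ^ 3" using j(1) by (intro mult_left_mono power_mono) auto
    qed (use j in auto)
    also have "\<dots> = 7 / j ^ 4" using j(1) by (simp add: field_simps power_numeral_reduce)
    finally show ?thesis .
  qed
  have 2: "(b - a) * (1 / j ^ 3 - 1 / (j + 1) ^ 3) \<le> 2 * (1 / j ^ 3 - 1 / (j + 1) ^ 3)"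
    using moment_diff j(1) by (intro mult_right_mono) (auto intro!: divide_left_mono power_mono)
  have 3: "(\<integral>\<omega>. (A (Suc k ^ 3) \<omega> - A (Suc (Suc k) ^ 3) \<omega>)\<^sup>2 \<partial>M) =
      (b - a) * (1 / j ^ 3 - 1 / (j + 1) ^ 3)"
    by (subst mean_square) (auto simp: j_def add.commute intro!: power_mono)
  have sq: "(\<integral>\<omega>. (A (Suc k ^ 3) \<omega> - A (Suc (Suc k) ^ 3) \<omega>)\<^sup>2 \<partial>M) \<le> 14 / j ^ 4"
    unfolding 3 by (rule order_trans[OF 2]) (use mult_left_mono[OF 1, of 2] in simp)
  \<comment> \<open>With \<delta> = 1 / j^2 and mean square at most 14 / j^4, where 14 = 2 * 7, the
    bound becomes (1 + 14) / 2 = 7.5 times 1 / j^2.\<close>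
  have "(\<integral>\<omega>. \<bar>A (Suc k ^ 3) \<omega> - A (Suc (Suc k) ^ 3) \<omega>\<bar> \<partial>M)
     \<le> (\<integral>\<omega>. (1/j\<^sup>2 + (A (Suc k ^ 3) \<omega> - A (Suc (Suc k) ^ 3) \<omega>)\<^sup>2 / (1/j\<^sup>2)) / 2 \<partial>M)"
    using j(1) by (intro integral_mono' abs_le_amgm integrable_divide Bochner_Integration.integrable_add int_diff_sq) auto
  also have "\<dots> = (1/j\<^sup>2 + (\<integral>\<omega>. (A (Suc k ^ 3) \<omega> - A (Suc (Suc k) ^ 3) \<omega>)\<^sup>2 \<partial>M) / (1/j\<^sup>2)) / 2"
    using int_diff_sq by (simp add: prob_space)
  also have "\<dots> \<le> (1/j\<^sup>2 + (14 / j ^ 4) / (1/j\<^sup>2)) / 2"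
    using sq j(1) by (intro divide_right_mono add_left_mono) auto
  also have "\<dots> \<le> 8 / j\<^sup>2" using j(1) by (simp add: field_simps power_numeral_reduce)
  finally show ?thesis by (simp add: j_def)
qed

text \<open>The mean increments along the cubes are summable, so the increments themselves are
  almost surely absolutely summable and telescope to a limit.\<close>

lemma AE_convergent: "AE \<omega> in M. convergent (\<lambda>k. A k \<omega>)"
proof -
  define D where "D = (\<lambda>k \<omega>. \<bar>A (Suc k ^ 3) \<omega> - A (Suc (Suc k) ^ 3) \<omega>\<bar>)"
  have D [measurable]: "D k \<in> borel_measurable M" for k unfolding D_def by simp
  have "(\<integral>\<^sup>+\<omega>. (\<Sum>k. ennreal (D k \<omega>)) \<partial>M) = (\<Sum>k. \<integral>\<^sup>+\<omega>. ennreal (D k \<omega>) \<partial>M)"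
    by (rule nn_integral_suminf) simp
  also have "\<dots> \<le> (\<Sum>k. ennreal (8 / real (Suc k) ^ 2))"
  proof (intro suminf_le allI)
    fix k
    have "integrable M (D k)"
    proof (rule integrable_const_bound[where B=2])
      show "AE \<omega> in M. norm (D k \<omega>) \<le> 2"
      proof (rule AE_I2)
        fix \<omega> assume "\<omega> \<in> space M"
        then have "\<bar>A (Suc k ^ 3) \<omega>\<bar> \<le> 1" "\<bar>A (Suc (Suc k) ^ 3) \<omega>\<bar> \<le> 1" by (simp_all only: A_bound)
        then show "norm (D k \<omega>) \<le> 2" by (simp only: D_def real_norm_def)
      qed
    qed simp
    then have "(\<integral>\<^sup>+\<omega>. ennreal (D k \<omega>) \<partial>M) = ennreal (\<integral>\<omega>. D k \<omega> \<partial>M)"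
      by (rule nn_integral_eq_integral) (simp add: D_def)
    also have "\<dots> \<le> ennreal (8 / real (Suc k) ^ 2)"
      unfolding D_def by (intro ennreal_leI cube_step)
    finally show "(\<integral>\<^sup>+\<omega>. ennreal (D k \<omega>) \<partial>M) \<le> ennreal (8 / real (Suc k) ^ 2)" .
  qed auto
  also have "\<dots> < \<infinity>"
  proof -
    have "summable (\<lambda>k. 8 / real (Suc k) ^ 2)"
      using summable_mult[OF iffD2[OF summable_Suc_iff inverse_power_summable[of 2, where 'a=real]], of 8]
      by (simp add: field_simps)
    then have "(\<Sum>k. ennreal (8 / real (Suc k) ^ 2)) = ennreal (\<Sum>k. 8 / real (Suc k) ^ 2)"
      by (intro suminf_ennreal2) auto
    then show ?thesis by simp
  qed
  finally have "(\<integral>\<^sup>+\<omega>. (\<Sum>k. ennreal (D k \<omega>)) \<partial>M) \<noteq> \<infinity>" by simp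
  then have "AE \<omega> in M. (\<Sum>k. ennreal (D k \<omega>)) \<noteq> \<infinity>"
    by (intro nn_integral_PInf_AE) auto
  then show ?thesis
  proof (rule AE_mp[OF _ AE_I2], intro impI)
    fix \<omega> assume \<omega>: "\<omega> \<in> space M" and "(\<Sum>k. ennreal (D k \<omega>)) \<noteq> \<infinity>"
    then have "summable (\<lambda>k. D k \<omega>)" by (intro summable_suminf_not_top) (auto simp: D_def)
    then have "summable (\<lambda>k. A (Suc k ^ 3) \<omega> - A (Suc (Suc k) ^ 3) \<omega>)"
      unfolding D_def by (rule summable_rabs_cancel)
    then obtain s where "(\<lambda>n. \<Sum>k<n. A (Suc k ^ 3) \<omega> - A (Suc (Suc k) ^ 3) \<omega>) \<longlonglongrightarrow> s"
      by (auto simp: summable_def sums_def)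
    moreover have "(\<Sum>k<n. A (Suc k ^ 3) \<omega> - A (Suc (Suc k) ^ 3) \<omega>) = A (Suc 0 ^ 3) \<omega> - A (Suc n ^ 3) \<omega>" for n
      using sum_lessThan_telescope'[of "\<lambda>k. A (Suc k ^ 3) \<omega>" n] by simp
    ultimately have "(\<lambda>n. A (Suc 0 ^ 3) \<omega> - A (Suc n ^ 3) \<omega>) \<longlonglongrightarrow> s" by simp
    from tendsto_diff[OF tendsto_const[of "A (Suc 0 ^ 3) \<omega>"] this]
    have "(\<lambda>n. A (Suc n ^ 3) \<omega>) \<longlonglongrightarrow> A (Suc 0 ^ 3) \<omega> - s" by simp
    then have "(\<lambda>k. A k \<omega>) \<longlonglongrightarrow> A (Suc 0 ^ 3) \<omega> - s"
      unfolding A_def by (rule average_convergent_cubes[rotated]) (use bound \<omega> in auto)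
    then show "convergent (\<lambda>k. A k \<omega>)" by (rule convergentI)
  qed
qed

text \<open>Letting L tend to infinity in \<open>mean_square\<close> bounds the mean square distance
  by 2 / K. With \<delta> = 1 / sqrt K, \<open>abs_le_amgm\<close> then gives (1 + 2) / 2 times 1 /
  sqrt K.\<close>

lemma mean_abs_limit:
  assumes l [measurable]: "l \<in> borel_measurable M" and lim: "AE \<omega> in M. (\<lambda>k. A k \<omega>) \<longlonglongrightarrow> l \<omega>" and "K \<ge> 1"
  shows "(\<integral>\<omega>. \<bar>A K \<omega> - l \<omega>\<bar> \<partial>M) \<le> 2 / sqrt (real K)"
proof -
  have l1: "AE \<omega> in M. \<bar>l \<omega>\<bar> \<le> 1"
    using lim
  proof (rule AE_mp[OF _ AE_I2], intro impI)
    fix \<omega> assume "\<omega> \<in> space M" "(\<lambda>k. A k \<omega>) \<longlonglongrightarrow> l \<omega>"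
    then show "\<bar>l \<omega>\<bar> \<le> 1"
      using A_bound by (intro LIMSEQ_le_const2[OF tendsto_rabs]) auto
  qed
  have four: "AE \<omega> in M. norm ((A K \<omega> - l \<omega>)\<^sup>2) \<le> 2\<^sup>2"
    using l1
  proof (rule AE_mp[OF _ AE_I2], intro impI)
    fix \<omega> assume "\<omega> \<in> space M" "\<bar>l \<omega>\<bar> \<le> 1"
    then have "\<bar>A K \<omega> - l \<omega>\<bar> \<le> 2" using A_bound[of \<omega> K] by linarith
    then have "\<bar>A K \<omega> - l \<omega>\<bar>\<^sup>2 \<le> 2\<^sup>2" by (intro power_mono) auto
    then show "norm ((A K \<omega> - l \<omega>)\<^sup>2) \<le> 2\<^sup>2" by simp
  qed
  have int: "integrable M (\<lambda>\<omega>. (A K \<omega> - l \<omega>)\<^sup>2)"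
    by (rule integrable_const_bound[OF four]) simp
  have "(\<lambda>L. \<integral>\<omega>. (A K \<omega> - A L \<omega>)\<^sup>2 \<partial>M) \<longlonglongrightarrow> (\<integral>\<omega>. (A K \<omega> - l \<omega>)\<^sup>2 \<partial>M)"
  proof (rule integral_dominated_convergence[where w="\<lambda>_. 2\<^sup>2"])
    show "AE \<omega> in M. (\<lambda>L. (A K \<omega> - A L \<omega>)\<^sup>2) \<longlonglongrightarrow> (A K \<omega> - l \<omega>)\<^sup>2"
      using lim by eventually_elim (auto intro!: tendsto_intros)
    show "AE \<omega> in M. norm ((A K \<omega> - A L \<omega>)\<^sup>2) \<le> 2\<^sup>2" for L
    proof (rule AE_I2)
      fix \<omega> assume "\<omega> \<in> space M"
      then have "\<bar>A K \<omega> - A L \<omega>\<bar> \<le> 2" using A_bound[of \<omega> K] A_bound[of \<omega> L] by linarith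
      then have "\<bar>A K \<omega> - A L \<omega>\<bar>\<^sup>2 \<le> 2\<^sup>2" by (intro power_mono) auto
      then show "norm ((A K \<omega> - A L \<omega>)\<^sup>2) \<le> 2\<^sup>2" by simp
    qed
  qed auto
  then have sq: "(\<integral>\<omega>. (A K \<omega> - l \<omega>)\<^sup>2 \<partial>M) \<le> 2 / real K"
  proof (rule LIMSEQ_le_const2, intro exI[of _ K] allI impI)
    fix L assume L: "K \<le> L"
    have "(b - a) * (1 / real K - 1 / real L) \<le> 2 * (1 / real K - 1 / real L)"
      using moment_diff L \<open>K \<ge> 1\<close> by (intro mult_right_mono) (auto intro!: divide_left_mono)
    also have "\<dots> \<le> 2 / real K" by (simp add: field_simps)
    finally show "(\<integral>\<omega>. (A K \<omega> - A L \<omega>)\<^sup>2 \<partial>M) \<le> 2 / real K"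
      using mean_square[OF \<open>K \<ge> 1\<close> L] by simp
  qed
  define \<delta> where "\<delta> = 1 / sqrt (real K)"
  have \<delta>: "\<delta> > 0" using \<open>K \<ge> 1\<close> by (simp add: \<delta>_def)
  have "(\<integral>\<omega>. \<bar>A K \<omega> - l \<omega>\<bar> \<partial>M) \<le> (\<integral>\<omega>. (\<delta> + (A K \<omega> - l \<omega>)\<^sup>2 / \<delta>) / 2 \<partial>M)"
    using \<delta> int by (intro integral_mono' abs_le_amgm) auto
  also have "\<dots> = (\<delta> + (\<integral>\<omega>. (A K \<omega> - l \<omega>)\<^sup>2 \<partial>M) / \<delta>) / 2"
    using int by (simp add: prob_space)
  also have "\<dots> \<le> (\<delta> + (2 / real K) / \<delta>) / 2"
    using sq \<delta> by (intro divide_right_mono add_left_mono) auto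
  also have "\<dots> = 3 / 2 * \<delta>"
    using \<open>K \<ge> 1\<close> by (simp add: \<delta>_def field_simps)
  also have "\<dots> \<le> 2 * \<delta>" using \<delta> by simp
  also have "\<dots> = 2 / sqrt (real K)" by (simp add: \<delta>_def)
  finally show ?thesis .
qed

end

section \<open>Tight sequences of measures\<close>

text \<open>A countable power of the unit interval is compact by Tychonoff's theorem and metrizable,
  hence sequentially compact. This takes the place of a diagonal argument.\<close>

lemma unit_interval_sequences_convergent_subsequence:
  fixes f :: "nat \<Rightarrow> nat \<Rightarrow> real"
  assumes "\<And>n i. f n i \<in> {0..1}"
  shows "\<exists>r l. strict_mono r \<and> (\<forall>i. (\<lambda>k. f (r k) i) \<longlonglongrightarrow> l i)"
proof -
  have "compactin (product_topology (\<lambda>_. euclidean) UNIV) (Pi\<^sub>E (UNIV :: nat set) (\<lambda>_. {0..1::real}))"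
    by (subst compactin_PiE) auto
  then have "seq_compact (Pi\<^sub>E (UNIV :: nat set) (\<lambda>_. {0..1::real}))"
    by (simp add: euclidean_product_topology compact_eq_seq_compact_metric)
  moreover have "f n \<in> Pi\<^sub>E UNIV (\<lambda>_. {0..1})" for n using assms by auto
  ultimately obtain l r where r: "strict_mono r" "(f \<circ> r) \<longlonglongrightarrow> l" unfolding seq_compact_def by metis
  have "(\<lambda>k. f (r k) i) \<longlonglongrightarrow> l i" for i
    using continuous_on_tendsto_compose[OF continuous_on_product_coordinates[of i] r(2)] by (simp add: comp_def)
  with r(1) show ?thesis by blast
qed

text \<open>After scaling into the unit interval a subsequence converges, and a convergent sequence
  of integers is eventually constant. Dividing by \<open>Suc (L i)\<close> avoids a zero
  denominator.\<close>

lemma bounded_nat_sequences_convergent_subsequence: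
  fixes f :: "nat \<Rightarrow> nat \<Rightarrow> nat"
  assumes "\<And>n i. f n i \<le> L i"
  shows "\<exists>r l. strict_mono r \<and> (\<forall>i. \<forall>\<^sub>F k in sequentially. f (r k) i = l i)"
proof -
  have "real (f n i) / real (Suc (L i)) \<in> {0..1}" for n i
    using assms[of n i] by (simp add: field_simps)
  then obtain r l where r: "strict_mono r" "\<And>i. (\<lambda>k. real (f (r k) i) / real (Suc (L i))) \<longlonglongrightarrow> l i"
    using unit_interval_sequences_convergent_subsequence[of "\<lambda>n i. real (f n i) / real (Suc (L i))"] by blast
  have "\<exists>u. \<forall>\<^sub>F k in sequentially. f (r k) i = u" for i
  proof -
    have "(\<lambda>k. real (f (r k) i)) \<longlonglongrightarrow> l i * real (Suc (L i))"
      using tendsto_mult[OF r(2)[of i] tendsto_const[of "real (Suc (L i))"]] by simp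
    from LIMSEQ_D[OF this, of "1/2"] obtain K where
      K: "\<And>k. k \<ge> K \<Longrightarrow> \<bar>real (f (r k) i) - l i * real (Suc (L i))\<bar> < 1/2" by auto
    have "f (r k) i = f (r K) i" if "k \<ge> K" for k
      using K[OF that] K[OF order_refl] by linarith
    then show ?thesis unfolding eventually_sequentially by blast
  qed
  then obtain u where "\<And>i. \<forall>\<^sub>F k in sequentially. f (r k) i = u i" by metis
  with r(1) show ?thesis by blast
qed

text \<open>The cap L stands for every value from L on, so \<open>trunc m L\<close> has finite range
  although the coordinates are unbounded.\<close>

definition trunc :: "nat \<Rightarrow> nat \<Rightarrow> (nat \<Rightarrow> nat) \<Rightarrow> nat \<Rightarrow> nat" where
  "trunc m L s = (\<lambda>j. if j < m then min (s j) L else 0)"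

text \<open>This algebra is countable and generates the product sigma algebra. Each of its members
  is determined by finitely many truncated coordinates, so it is clopen.\<close>
definition cyl_algebra :: "(nat \<Rightarrow> nat) set set" where
  "cyl_algebra = {A. \<exists>m L. \<forall>s t. trunc m L s = trunc m L t \<longrightarrow> (s \<in> A \<longleftrightarrow> t \<in> A)}"

lemma trunc_eq_mono:
  assumes "trunc m' L' s = trunc m' L' t" "m \<le> m'" "L \<le> L'"
  shows "trunc m L s = trunc m L t"
proof
  fix j
  from fun_cong[OF assms(1), of j] show "trunc m L s j = trunc m L t j"
    using assms(2,3) by (auto simp: trunc_def min_def split: if_splits)
qed

lemma cyl_algebraI:
  assumes "\<And>s t. trunc m L s = trunc m L t \<Longrightarrow> s \<in> A \<Longrightarrow> t \<in> A"
  shows "A \<in> cyl_algebra"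
  unfolding cyl_algebra_def
proof (intro CollectI exI allI impI)
  fix s t assume "trunc m L s = trunc m L t"
  then show "s \<in> A \<longleftrightarrow> t \<in> A" using assms[of s t] assms[of t s] by auto
qed

lemma cyl_algebraD:
  assumes "A \<in> cyl_algebra"
  shows "\<exists>m L. \<forall>s t. trunc m L s = trunc m L t \<longrightarrow> (s \<in> A \<longleftrightarrow> t \<in> A)"
  using assms by (simp add: cyl_algebra_def)

lemma algebra_cyl: "algebra UNIV cyl_algebra"
  unfolding algebra_iff_Un
proof (intro conjI ballI)
  show "{} \<in> cyl_algebra" by (simp add: cyl_algebra_def)
  fix A assume A: "A \<in> cyl_algebra"
  show "UNIV - A \<in> cyl_algebra" using A by (simp add: cyl_algebra_def)
  fix B assume B: "B \<in> cyl_algebra"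
  obtain m L where 1: "\<forall>s t. trunc m L s = trunc m L t \<longrightarrow> (s \<in> A \<longleftrightarrow> t \<in> A)"
    using cyl_algebraD[OF A] by blast
  obtain m' L' where 2: "\<forall>s t. trunc m' L' s = trunc m' L' t \<longrightarrow> (s \<in> B \<longleftrightarrow> t \<in> B)"
    using cyl_algebraD[OF B] by blast
  show "A \<union> B \<in> cyl_algebra"
  proof (rule cyl_algebraI[of "max m m'" "max L L'"])
    fix s t assume eq: "trunc (max m m') (max L L') s = trunc (max m m') (max L L') t" and s: "s \<in> A \<union> B"
    have "trunc m L s = trunc m L t" "trunc m' L' s = trunc m' L' t"
      by (rule trunc_eq_mono[OF eq]; simp)+
    then show "t \<in> A \<union> B" using 1 2 s by blast
  qed
qed auto

lemma finite_range_trunc: "finite (range (trunc m L))"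
proof (rule finite_subset)
  show "range (trunc m L) \<subseteq> {f. \<forall>i. (i \<in> {..<m} \<longrightarrow> f i \<in> {..L}) \<and> (i \<notin> {..<m} \<longrightarrow> f i = 0)}"
    by (auto simp: trunc_def)
  show "finite {f. \<forall>i. (i \<in> {..<m} \<longrightarrow> f i \<in> {..L}) \<and> (i \<notin> {..<m} \<longrightarrow> f i = (0::nat))}"
    by (rule finite_set_of_finite_funs) auto
qed

lemma cyl_algebra_vimage:
  assumes "A \<in> cyl_algebra"
  shows "\<exists>m L. trunc m L -` (trunc m L ` A) = A"
proof -
  obtain m L where "\<forall>s t. trunc m L s = trunc m L t \<longrightarrow> (s \<in> A \<longleftrightarrow> t \<in> A)"
    using cyl_algebraD[OF assms] by blast
  then have "trunc m L -` (trunc m L ` A) = A" by blast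
  then show ?thesis by blast
qed

lemma countable_cyl_algebra: "countable cyl_algebra"
proof (rule countable_subset)
  show "cyl_algebra \<subseteq> (\<Union>p. (\<lambda>B. trunc (fst p) (snd p) -` B) ` Pow (range (trunc (fst p) (snd p))))"
  proof
    fix A assume "A \<in> cyl_algebra"
    then obtain m L where "trunc m L -` (trunc m L ` A) = A" using cyl_algebra_vimage by blast
    then show "A \<in> (\<Union>p. (\<lambda>B. trunc (fst p) (snd p) -` B) ` Pow (range (trunc (fst p) (snd p))))"
      by (intro UN_I[of "(m, L)"]) auto
  qed
  show "countable (\<Union>p :: nat \<times> nat. (\<lambda>B. trunc (fst p) (snd p) -` B) ` Pow (range (trunc (fst p) (snd p))))"
    by (rule countable_UN[OF countableI_type]) (auto intro!: countable_image countable_finite simp: finite_range_trunc)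
qed

abbreviation seq_space :: "(nat \<Rightarrow> nat) measure" where
  "seq_space \<equiv> sigma UNIV cyl_algebra"

lemma sets_seq_space: "sets seq_space = sigma_sets UNIV cyl_algebra"
  by (rule sets_measure_of) simp

lemma cyl_algebra_sets: "A \<in> cyl_algebra \<Longrightarrow> A \<in> sets seq_space"
  by (auto simp: sets_seq_space)

lemma measurable_coordinate [measurable]: "(\<lambda>s. s j) \<in> seq_space \<rightarrow>\<^sub>M count_space UNIV"
proof (rule measurable_count_space_eq2_countable[THEN iffD2], intro conjI ballI)
  fix i :: nat
  have "{s. s j = i} \<in> cyl_algebra"
  \<comment> \<open>With the cap i, the value i could not be told from larger ones; hence
    \<open>Suc i\<close>.\<close>
  proof (rule cyl_algebraI[of "Suc j" "Suc i"])
    fix s t assume "trunc (Suc j) (Suc i) s = trunc (Suc j) (Suc i) t" "s \<in> {s. s j = i}"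
    then have "s j = i" "trunc (Suc j) (Suc i) s j = trunc (Suc j) (Suc i) t j" by simp_all
    then show "t \<in> {s. s j = i}" by (auto simp: trunc_def min_def split: if_splits)
  qed
  then show "(\<lambda>s. s j) -` {i} \<inter> space seq_space \<in> sets seq_space"
    by (simp add: vimage_def cyl_algebra_sets)
qed auto

text \<open>A member of the algebra is a finite union of fibres of some \<open>trunc m L\<close>,
  and a fibre is described by conditions on coordinates.\<close>

lemma measurable_seq_spaceI:
  assumes [measurable]: "\<And>j. (\<lambda>y. c y j) \<in> N \<rightarrow>\<^sub>M count_space UNIV"
  shows "c \<in> N \<rightarrow>\<^sub>M seq_space"
proof (rule measurable_measure_of)
  fix A assume "A \<in> cyl_algebra"
  then obtain m L where A: "trunc m L -` (trunc m L ` A) = A" using cyl_algebra_vimage by blast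
  have "finite (trunc m L ` A)" by (rule finite_subset[OF _ finite_range_trunc[of m L]]) auto
  moreover have "{y \<in> space N. trunc m L (c y) = t} \<in> sets N" for t
  proof -
    have "{y \<in> space N. trunc m L (c y) = t} = {y \<in> space N. \<forall>j. (if j < m then min (c y j) L else 0) = t j}"
      by (auto simp: trunc_def fun_eq_iff)
    also have "\<dots> \<in> sets N" by measurable
    finally show ?thesis .
  qed
  ultimately have "(\<Union>t\<in>trunc m L ` A. {y \<in> space N. trunc m L (c y) = t}) \<in> sets N" by blast
  moreover have "c -` A \<inter> space N = (\<Union>t\<in>trunc m L ` A. {y \<in> space N. trunc m L (c y) = t})"
    by (subst A[symmetric]) auto
  ultimately show "c -` A \<inter> space N \<in> sets N" by simp
qed auto

text \<open>A subsequence converges on all of the countable algebra, and the limit is finitely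
  additive. Countable additivity amounts to continuity at the empty set, which is a compactness
  argument: if decreasing sets keep limit mass \<epsilon>, tightness leaves a point of each set
  inside the compact box of sequences bounded by L, and a limit of such points lies in all of the
  sets.\<close>

lemma tight_sequence_space_limit:
  fixes b :: "nat \<Rightarrow> (nat \<Rightarrow> nat) measure"
  assumes b: "\<And>n. prob_space (b n)" "\<And>n. sets (b n) = sets seq_space"
    and tight: "\<And>j \<epsilon>. \<epsilon> > 0 \<Longrightarrow> \<exists>L. \<forall>n. measure (b n) {s. s j > L} \<le> \<epsilon>"
  obtains r \<nu> where "strict_mono r" "prob_space \<nu>" "sets \<nu> = sets seq_space"
    "\<And>A. A \<in> cyl_algebra \<Longrightarrow> (\<lambda>k. measure (b (r k)) A) \<longlonglongrightarrow> measure \<nu> A"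
proof -
  interpret b: prob_space "b n" for n by (rule b)
  interpret C: algebra UNIV cyl_algebra by (rule algebra_cyl)
  define e where "e = from_nat_into cyl_algebra"
  have "measure (b n) (e i) \<in> {0..1}" for n i by simp
  then obtain r l0 where r: "strict_mono r" "\<And>i. (\<lambda>k. measure (b (r k)) (e i)) \<longlonglongrightarrow> l0 i"
    using unit_interval_sequences_convergent_subsequence[of "\<lambda>n i. measure (b n) (e i)"] by blast
  define l where "l = (\<lambda>A. lim (\<lambda>k. measure (b (r k)) A))"
  have l: "(\<lambda>k. measure (b (r k)) A) \<longlonglongrightarrow> l A" if "A \<in> cyl_algebra" for A
  proof -
    obtain i where "e i = A" unfolding e_def
      using from_nat_into_surj[OF countable_cyl_algebra \<open>A \<in> cyl_algebra\<close>] by blast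
    then show ?thesis using r(2)[of i] unfolding l_def by (metis limI)
  qed
  have bA: "A \<in> sets (b n)" if "A \<in> cyl_algebra" for A n using cyl_algebra_sets[OF that] b(2) by simp
  have l0: "0 \<le> l A" if "A \<in> cyl_algebra" for A
    by (rule LIMSEQ_le_const[OF l[OF that]]) auto
  have lmono: "l A \<le> l B" if "A \<in> cyl_algebra" "B \<in> cyl_algebra" "A \<subseteq> B" for A B
    by (rule LIMSEQ_le[OF l[OF that(1)] l[OF that(2)]]) (use that bA in \<open>auto intro!: b.finite_measure_mono\<close>)
  have empty: "l {} = 0" using l[of "{}"] LIMSEQ_unique[of "\<lambda>_. 0" 0 "l {}"] by auto
  have UNIV: "l UNIV = 1"
  proof -
    have "measure (b (r k)) UNIV = 1" for k
      using b.prob_space[of "r k"] sets_eq_imp_space_eq[OF b(2)] by simp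
    then show ?thesis using l[of UNIV] LIMSEQ_unique[of "\<lambda>_. 1" 1 "l UNIV"] by auto
  qed
  have add: "l (A \<union> B) = l A + l B" if "A \<in> cyl_algebra" "B \<in> cyl_algebra" "A \<inter> B = {}" for A B
  proof -
    have "measure (b (r k)) (A \<union> B) = measure (b (r k)) A + measure (b (r k)) B" for k
      by (rule b.finite_measure_Union) (use that bA in auto)
    then have "(\<lambda>k. measure (b (r k)) (A \<union> B)) \<longlonglongrightarrow> l A + l B"
      using tendsto_add[OF l[OF that(1)] l[OF that(2)]] by simp
    then show ?thesis using l[of "A \<union> B"] that LIMSEQ_unique by blast
  qed
  have "\<exists>\<mu> :: (nat \<Rightarrow> nat) set \<Rightarrow> ennreal. (\<forall>s\<in>cyl_algebra. \<mu> s = ennreal (l s)) \<and>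
      measure_space UNIV (sigma_sets UNIV cyl_algebra) \<mu>"
  proof (rule C.caratheodory_empty_continuous)
    show "positive cyl_algebra (\<lambda>A. ennreal (l A))" by (simp add: positive_def empty)
    show "additive cyl_algebra (\<lambda>A. ennreal (l A))" by (simp add: additive_def add l0)
    show "ennreal (l A) \<noteq> \<infinity>" for A by simp
    fix A :: "nat \<Rightarrow> (nat \<Rightarrow> nat) set"
    assume "range A \<subseteq> cyl_algebra" and dec: "decseq A" and inter: "(\<Inter>i. A i) = {}"
    then have A: "A i \<in> cyl_algebra" for i by auto
    have "(\<lambda>i. l (A i)) \<longlonglongrightarrow> 0"
    proof (rule ccontr)
      assume no: "\<not> (\<lambda>i. l (A i)) \<longlonglongrightarrow> 0"
      \<comment> \<open>The values decrease in i, so without such an \<epsilon> they would tend to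
        0.\<close>
      have "\<exists>\<epsilon>>0. \<forall>i. \<epsilon> \<le> l (A i)"
      proof (rule ccontr)
        assume *: "\<not> (\<exists>\<epsilon>>0. \<forall>i. \<epsilon> \<le> l (A i))"
        have "(\<lambda>i. l (A i)) \<longlonglongrightarrow> 0"
        proof (rule LIMSEQ_I)
          fix \<epsilon> :: real assume "\<epsilon> > 0"
          with * obtain i where i: "l (A i) < \<epsilon>" by (auto simp: not_le)
          have "norm (l (A j) - 0) < \<epsilon>" if "j \<ge> i" for j
            using lmono[OF A A decseqD[OF dec that]] i l0[OF A, of j] by simp
          then show "\<exists>i. \<forall>j\<ge>i. norm (l (A j) - 0) < \<epsilon>" by blast
        qed
        with no show False ..
      qed
      then obtain \<epsilon> where \<epsilon>: "\<epsilon> > 0" "\<And>i. \<epsilon> \<le> l (A i)" by blast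
      \<comment> \<open>The tails outside the box then weigh at most \<epsilon> / 2 in total, less
        than the mass of \<open>A i\<close> under a suitable \<open>b (r k)\<close>.\<close>
      have "\<exists>L. \<forall>n. measure (b n) {s. s j > L} \<le> \<epsilon> * (1/2) ^ (j + 2)" for j
        by (rule tight) (use \<epsilon>(1) in simp)
      then obtain L where L: "\<And>j n. measure (b n) {s. s j > L j} \<le> \<epsilon> * (1/2) ^ (j + 2)" by metis
      have "\<exists>t. t \<in> A i \<and> (\<forall>j. t j \<le> L j)" for i
      proof -
        obtain m K where mK: "\<And>s t. trunc m K s = trunc m K t \<Longrightarrow> s \<in> A i \<longleftrightarrow> t \<in> A i"
          using cyl_algebraD[OF A[of i]] by blast
        have "\<forall>\<^sub>F k in sequentially. measure (b (r k)) (A i) > \<epsilon> / 2"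
          using order_tendstoD(1)[OF l[OF A[of i]], of "\<epsilon>/2"] \<epsilon>(1) \<epsilon>(2)[of i] by linarith
        then obtain k where k: "measure (b (r k)) (A i) > \<epsilon> / 2" by (auto dest: eventually_happens)
        have Ls: "{s. s j > L j} \<in> sets (b n)" for j n
        proof -
          have "(\<lambda>s. s j) -` {L j<..} \<inter> space seq_space \<in> sets seq_space"
            by (rule measurable_sets[OF measurable_coordinate]) simp
          then show ?thesis using b(2) by (simp add: vimage_def)
        qed
        have "measure (b (r k)) (\<Union>j<m. {s. s j > L j}) \<le> (\<Sum>j<m. measure (b (r k)) {s. s j > L j})"
          by (rule b.finite_measure_subadditive_finite) (use Ls in auto)
        also have "\<dots> \<le> (\<Sum>j<m. \<epsilon> / 4 * (1/2) ^ j)"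
          by (rule sum_mono) (use L[of "r k"] in \<open>simp add: power_add\<close>)
        also have "\<dots> = \<epsilon> / 4 * (\<Sum>j<m. (1/2) ^ j)" by (simp add: sum_distrib_left)
        also have "(\<Sum>j<m. (1/2::real) ^ j) \<le> 2" by (simp add: geometric_sum)
        finally have "measure (b (r k)) (\<Union>j<m. {s. s j > L j}) \<le> \<epsilon> / 2" using \<epsilon>(1) by simp
        then have "\<not> A i \<subseteq> (\<Union>j<m. {s. s j > L j})"
          using k b.finite_measure_mono[of "A i" "\<Union>j<m. {s. s j > L j}" "r k"] Ls by fastforce
        then obtain s where "s \<in> A i" "s \<notin> (\<Union>j<m. {s. s j > L j})" by blast
        then have s: "s \<in> A i" "\<And>j. j < m \<Longrightarrow> s j \<le> L j" by (auto simp: not_less)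
        \<comment> \<open>Since \<open>A i\<close> sees only the first m coordinates, the others may
          be set to 0. So finitely many tail bounds suffice to enter the box.\<close>
        have "(\<lambda>j. if j < m then s j else 0) \<in> A i"
          using mK[of s "\<lambda>j. if j < m then s j else 0"] s(1) by (simp add: trunc_def if_distrib cong: if_cong)
        then show ?thesis using s(2) by (intro exI[of _ "\<lambda>j. if j < m then s j else 0"]) auto
      qed
      then obtain t where t: "\<And>i. t i \<in> A i" "\<And>i j. t i j \<le> L j" by metis
      obtain q u where q: "strict_mono q" "\<And>j. \<forall>\<^sub>F k in sequentially. t (q k) j = u j"
        using bounded_nat_sequences_convergent_subsequence[of t L] t(2) by blast
      have "u \<in> A i" for i
      proof -
        obtain m K where mK: "\<And>s t. trunc m K s = trunc m K t \<Longrightarrow> s \<in> A i \<longleftrightarrow> t \<in> A i"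
          using cyl_algebraD[OF A[of i]] by blast
        have "\<forall>\<^sub>F k in sequentially. (\<forall>j\<in>{..<m}. t (q k) j = u j) \<and> k \<ge> i"
          by (intro eventually_conj eventually_ball_finite eventually_ge_at_top) (use q(2) in auto)
        then obtain k where "(\<forall>j\<in>{..<m}. t (q k) j = u j) \<and> k \<ge> i"
          using eventually_happens'[OF sequentially_bot] by blast
        then have k: "\<And>j. j < m \<Longrightarrow> t (q k) j = u j" "k \<ge> i" by auto
        have "i \<le> q k" using k(2) seq_suble[OF q(1), of k] by simp
        then have "t (q k) \<in> A i" using t(1)[of "q k"] decseqD[OF dec] by blast
        moreover have "trunc m K (t (q k)) = trunc m K u" using k(1) by (auto simp: trunc_def)
        ultimately show ?thesis using mK by blast
      qed
      then show False using inter by blast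
    qed
    from tendsto_ennrealI[OF this] show "(\<lambda>i. ennreal (l (A i))) \<longlonglongrightarrow> 0" by simp
  qed
  then obtain \<mu> where \<mu>: "\<And>A. A \<in> cyl_algebra \<Longrightarrow> \<mu> A = ennreal (l A)"
      "measure_space UNIV (sigma_sets UNIV cyl_algebra) \<mu>" by blast
  define \<nu> where "\<nu> = measure_of UNIV (sigma_sets UNIV cyl_algebra) \<mu>"
  have s\<nu>: "sets \<nu> = sigma_sets UNIV cyl_algebra"
    by (simp add: \<nu>_def sigma_sets_sigma_sets_eq)
  have em: "emeasure \<nu> A = ennreal (l A)" if "A \<in> cyl_algebra" for A
    unfolding \<nu>_def \<mu>(1)[OF that, symmetric]
    by (rule emeasure_measure_of_sigma) (use \<mu>(2) that in \<open>auto simp: measure_space_def\<close>)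
  have sp: "space \<nu> = UNIV" using sets_eq_imp_space_eq[of \<nu> seq_space] s\<nu> sets_seq_space by simp
  show thesis
  proof
    show "strict_mono r" by (rule r)
    show "prob_space \<nu>" by (rule prob_spaceI) (use em[of UNIV] sp UNIV in simp)
    show "sets \<nu> = sets seq_space" using s\<nu> sets_seq_space by simp
    show "(\<lambda>k. measure (b (r k)) A) \<longlonglongrightarrow> measure \<nu> A" if "A \<in> cyl_algebra" for A
      using l[OF that] em[OF that] l0[OF that] by (simp add: measure_def)
  qed
qed

text \<open>A point is coded by the indices of nearby points of the dense sequence. The limit is built on
  the space of codes and decoded by completeness; this avoids a Riesz representation theorem.\<close>
lemma (in Metric_space) tight_imp_convergent_subsequence:
  assumes complete: mcomplete and x: "range x \<subseteq> M" and dense: "mtopology closure_of range x = M"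
    and a: "\<And>n. a n \<in> prob_measures mtopology"
    and tight: "\<And>m \<epsilon>. \<epsilon> > 0 \<Longrightarrow> \<exists>J::nat. \<forall>n::nat. measure (a n) (\<Union>i\<le>J. mball (x i) ((1/2)^m)) \<ge> 1 - \<epsilon>"
  obtains r \<mu> where "strict_mono r" "limitin (weak_top mtopology) (\<lambda>k. a (r k)) \<mu> sequentially"
proof -
  have xM [simp]: "x i \<in> M" for i using x by auto
  note aD = prob_measuresD[OF a]
  \<comment> \<open>Taking the least index makes \<open>{y \<in> M. c y m \<le> J}\<close> the union
    of the first balls, whose mass the tightness hypothesis controls. Tightness of the laws of the
    codes is then immediate.\<close>
  define c where "c = (\<lambda>y m. LEAST i. d (x i) y < (1/2)^m)"
  have ex: "\<exists>i. d (x i) y < (1/2)^m" if "y \<in> M" for y m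
  proof -
    have "y \<in> mtopology closure_of range x" using dense that by simp
    then have "\<forall>r>0. \<exists>z\<in>range x. z \<in> mball y r"
      by (simp add: metric_closure_of)
    moreover have "(1/2::real)^m > 0" by simp
    ultimately have "\<exists>z\<in>range x. z \<in> mball y ((1/2)^m)" by blast
    then show ?thesis by (auto simp: commute)
  qed
  have c: "d (x (c y m)) y < (1/2)^m" if "y \<in> M" for y m
    unfolding c_def by (rule LeastI_ex[OF ex[OF that]])
  have c_le: "{y \<in> M. c y m \<le> J} = (\<Union>i\<le>J. mball (x i) ((1/2)^m))" for m J
  proof (intro equalityI subsetI)
    fix y assume "y \<in> {y \<in> M. c y m \<le> J}"
    then show "y \<in> (\<Union>i\<le>J. mball (x i) ((1/2)^m))" using c[of y m] by auto
  next
    fix y assume "y \<in> (\<Union>i\<le>J. mball (x i) ((1/2)^m))"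
    then obtain i where "i \<le> J" "y \<in> M" "d (x i) y < (1/2)^m" by auto
    then show "y \<in> {y \<in> M. c y m \<le> J}"
      using Least_le[of "\<lambda>i. d (x i) y < (1/2)^m" i] by (simp add: c_def)
  qed
  have c_le_sets: "{y \<in> M. c y m \<le> J} \<in> sets (borel_of mtopology)" for m J
    unfolding c_le by (intro sets.finite_UN openin_sets_borel_of) auto
  have c_coord: "(\<lambda>y. c y m) \<in> borel_of mtopology \<rightarrow>\<^sub>M count_space UNIV" for m
  proof (rule measurable_count_space_eq2_countable[THEN iffD2], intro conjI ballI)
    fix i :: nat
    have "(\<lambda>y. c y m) -` {i} \<inter> space (borel_of mtopology) = {y \<in> M. c y m \<le> i} - (\<Union>j<i. {y \<in> M. c y m \<le> j})"
      by (auto simp: not_le) (metis lessThan_iff less_irrefl le_neq_implies_less)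
    also have "\<dots> \<in> sets (borel_of mtopology)"
      by (intro sets.Diff sets.finite_UN c_le_sets) auto
    finally show "(\<lambda>y. c y m) -` {i} \<inter> space (borel_of mtopology) \<in> sets (borel_of mtopology)" .
  qed auto
  have c_meas: "c \<in> a n \<rightarrow>\<^sub>M seq_space" for n
    using measurable_seq_spaceI[of c, OF c_coord] measurable_cong_sets[OF aD(2) refl] by blast
  define b where "b = (\<lambda>n. distr (a n) seq_space c)"
  have b_prob: "prob_space (b n)" for n
    unfolding b_def by (rule prob_space.prob_space_distr[OF aD(1) c_meas])
  have b_sets: "sets (b n) = sets seq_space" for n by (simp add: b_def)
  have b_measure: "measure (b n) A = measure (a n) {y \<in> M. c y \<in> A}" if "A \<in> sets seq_space" for n A
    unfolding b_def measure_distr[OF c_meas that] by (rule arg_cong[where f="measure (a n)"]) (auto simp: aD)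
  have b_tight: "\<exists>L. \<forall>n. measure (b n) {s. s j > L} \<le> \<epsilon>" if "\<epsilon> > 0" for j \<epsilon>
  proof -
    obtain J where J: "\<And>n. measure (a n) (\<Union>i\<le>J. mball (x i) ((1/2)^j)) \<ge> 1 - \<epsilon>" using tight[OF \<open>\<epsilon> > 0\<close>] by blast
    have "measure (b n) {s. s j > J} \<le> \<epsilon>" for n
    proof -
      interpret prob_space "a n" by (rule aD)
      have "(\<lambda>s. s j) -` {J<..} \<inter> space seq_space \<in> sets seq_space"
        by (rule measurable_sets[OF measurable_coordinate]) simp
      then have "measure (b n) {s. s j > J} = measure (a n) (space (a n) - {y \<in> M. c y j \<le> J})"
        by (subst b_measure) (auto simp: vimage_def aD intro!: arg_cong[where f="measure (a n)"])
      also have "\<dots> = 1 - measure (a n) {y \<in> M. c y j \<le> J}"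
        by (rule prob_compl) (use c_le_sets aD in simp)
      finally show ?thesis using J[of n] unfolding c_le by simp
    qed
    then show ?thesis by blast
  qed
  obtain r \<nu> where r: "strict_mono r" and \<nu>: "prob_space \<nu>" "sets \<nu> = sets seq_space"
    and lim: "\<And>A. A \<in> cyl_algebra \<Longrightarrow> (\<lambda>k. measure (b (r k)) A) \<longlonglongrightarrow> measure \<nu> A"
    using tight_sequence_space_limit[OF b_prob b_sets b_tight] by blast
  interpret \<nu>: prob_space \<nu> by (rule \<nu>)
  have sp: "space \<nu> = UNIV" using sets_eq_imp_space_eq[OF \<nu>(2)] by simp
  have coord [measurable]: "(\<lambda>s. s j) \<in> \<nu> \<rightarrow>\<^sub>M count_space UNIV" for j
    using measurable_coordinate measurable_cong_sets[OF \<nu>(2) refl] by blast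
  \<comment> \<open>Codes of points satisfy this because 3/2 * (1/2)^m = (1/2)^m + (1/2)^(m+1). The
    condition involves two coordinates at a time, so its failure is a countable union of cylinder
    sets.\<close>
  define Dom where "Dom = {s :: nat \<Rightarrow> nat. \<forall>m. d (x (s m)) (x (s (Suc m))) < 3/2 * (1/2)^m}"
  have c_Dom: "c y \<in> Dom" if "y \<in> M" for y
    unfolding Dom_def
  proof (intro CollectI allI)
    fix m
    have "d (x (c y m)) (x (c y (Suc m))) \<le> d (x (c y m)) y + d (x (c y (Suc m))) y"
      using triangle[of "x (c y m)" y "x (c y (Suc m))"] that by (simp add: commute)
    also have "\<dots> < (1/2)^m + (1/2)^Suc m" by (intro add_strict_mono c that)
    finally show "d (x (c y m)) (x (c y (Suc m))) < 3/2 * (1/2)^m" by simp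
  qed
  define bad where "bad = (\<lambda>m. {(i, j). \<not> d (x i) (x j) < 3/2 * (1/2::real)^m})"
  have cell: "{s. s m = i \<and> s (Suc m) = j} \<in> cyl_algebra" for m i j
  proof (rule cyl_algebraI[of "Suc (Suc m)" "Suc (max i j)"])
    fix s t assume eq: "trunc (Suc (Suc m)) (Suc (max i j)) s = trunc (Suc (Suc m)) (Suc (max i j)) t"
      and "s \<in> {s. s m = i \<and> s (Suc m) = j}"
    then have "s m = i" "s (Suc m) = j" by auto
    moreover from fun_cong[OF eq, of m] fun_cong[OF eq, of "Suc m"]
    have "min (s m) (Suc (max i j)) = min (t m) (Suc (max i j))"
      "min (s (Suc m)) (Suc (max i j)) = min (t (Suc m)) (Suc (max i j))" by (simp_all add: trunc_def)
    ultimately show "t \<in> {s. s m = i \<and> s (Suc m) = j}" by (auto simp: min_def max_def split: if_splits)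
  qed
  have not_Dom: "- Dom = (\<Union>m. \<Union>p\<in>bad m. {s. s m = fst p \<and> s (Suc m) = snd p})"
    by (auto simp: Dom_def bad_def)
  \<comment> \<open>Such a cell contains no code of a point, so every \<open>b n\<close> gives it
    mass 0, and convergence on the algebra passes this to the limit.\<close>
  have cell_null: "{s. s m = fst p \<and> s (Suc m) = snd p} \<in> null_sets \<nu>" if "p \<in> bad m" for m p
  proof -
    have "{y \<in> M. c y \<in> {s. s m = fst p \<and> s (Suc m) = snd p}} = {}"
    proof -
      have "{s. s m = fst p \<and> s (Suc m) = snd p} \<inter> Dom = {}" using that by (auto simp: Dom_def bad_def)
      then show ?thesis using c_Dom by blast
    qed
    then have "measure (b n) {s. s m = fst p \<and> s (Suc m) = snd p} = 0" for n
      unfolding b_measure[OF cyl_algebra_sets[OF cell]] by (simp only: measure_empty)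
    then have "measure \<nu> {s. s m = fst p \<and> s (Suc m) = snd p} = 0"
      using lim[OF cell, of m "fst p" "snd p"] LIMSEQ_unique[OF tendsto_const] by fastforce
    then show ?thesis
      using cyl_algebra_sets[OF cell, of m "fst p" "snd p"] \<nu>(2)
      by (intro null_setsI) (auto simp: \<nu>.emeasure_eq_measure)
  qed
  have null: "- Dom \<in> null_sets \<nu>"
    unfolding not_Dom by (intro null_sets_UN' countableI_type cell_null) (auto simp: bad_def intro: cell_null)
  then have Dom_sets: "Dom \<in> sets \<nu>"
    using sets.compl_sets[OF null_setsD2[OF null]] sp by (simp add: Compl_eq_Diff_UNIV double_diff)
  have AE_Dom: "AE s in \<nu>. s \<in> Dom" using AE_not_in[OF null] by simp
  \<comment> \<open>The consecutive bounds 3/2 * (1/2)^m form a geometric series with sum 3 *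
    (1/2)^m.\<close>
  have step: "d (x (s m)) (x (s (m + p))) \<le> 3 * (1/2)^m" if "s \<in> Dom" for s m p
  proof -
    have "d (x (s m)) (x (s (m + p))) \<le> 3 * (1/2)^m * (1 - (1/2)^p)"
    proof (induction p)
      case (Suc p)
      have "d (x (s m)) (x (s (m + Suc p))) \<le> d (x (s m)) (x (s (m + p))) + d (x (s (m + p))) (x (s (Suc (m + p))))"
        using triangle[of "x (s m)" "x (s (m + p))" "x (s (Suc (m + p)))"] by simp
      also have "\<dots> \<le> 3 * (1/2)^m * (1 - (1/2)^p) + 3/2 * (1/2)^(m + p)"
        using Suc that by (intro add_mono) (auto simp: Dom_def less_imp_le)
      also have "\<dots> = 3 * (1/2)^m * (1 - (1/2)^Suc p)" by (simp add: power_add algebra_simps)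
      finally show ?case .
    qed simp
    also have "\<dots> \<le> 3 * (1/2)^m * 1" by (intro mult_left_mono) auto
    finally show ?thesis by simp
  qed
  have small: "\<exists>m. K * (1/2)^m < (e::real)" if "e > 0" for e K
  proof -
    have "(\<lambda>m. K * (1/2)^m) \<longlonglongrightarrow> K * 0" by (intro tendsto_intros) auto
    from order_tendstoD(2)[OF this, of e] show ?thesis using that by (auto dest: eventually_happens)
  qed
  have "\<exists>y. limitin mtopology (\<lambda>m. x (s m)) y sequentially" if "s \<in> Dom" for s
  proof -
    have "MCauchy (\<lambda>m. x (s m))"
      unfolding MCauchy_def
    proof (intro conjI allI impI)
      fix \<epsilon> :: real assume "\<epsilon> > 0"
      then obtain m where m: "6 * (1/2)^m < \<epsilon>" using small by blast
      have "d (x (s n)) (x (s n')) < \<epsilon>" if "m \<le> n" "m \<le> n'" for n n'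
      proof -
        have "d (x (s n)) (x (s n')) \<le> d (x (s m)) (x (s n)) + d (x (s m)) (x (s n'))"
          using triangle[of "x (s n)" "x (s m)" "x (s n')"] by (simp add: commute)
        then show ?thesis
          using step[OF \<open>s \<in> Dom\<close>, of m "n - m"] step[OF \<open>s \<in> Dom\<close>, of m "n' - m"] that m by simp
      qed
      then show "\<exists>N. \<forall>n n'. N \<le> n \<longrightarrow> N \<le> n' \<longrightarrow> d (x (s n)) (x (s n')) < \<epsilon>" by blast
    qed auto
    then show ?thesis using complete by (simp add: mcomplete_def)
  qed
  then obtain lm where lm: "\<And>s. s \<in> Dom \<Longrightarrow> limitin mtopology (\<lambda>m. x (s m)) (lm s) sequentially" by metis
  \<comment> \<open>The complement of \<open>Dom\<close> is a null set, so any point of the space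
    may serve as the value there.\<close>
  define dec where "dec = (\<lambda>s. if s \<in> Dom then lm s else x 0)"
  have dec_lim: "limitin mtopology (\<lambda>m. x (s m)) (dec s) sequentially" if "s \<in> Dom" for s
    using lm[OF that] that by (simp add: dec_def)
  have dec_M: "dec s \<in> M" for s
    using limitin_topspace[OF lm] by (auto simp: dec_def)
  have dist_lim: "(\<lambda>m. d z (x (s m))) \<longlonglongrightarrow> d z (dec s)" if "s \<in> Dom" "z \<in> M" for s z
    using continuous_map_limit[OF continuous_map_dist[OF that(2)] dec_lim[OF that(1)]] by (simp add: comp_def)
  have dec_close: "d (x (s m)) (dec s) \<le> 3 * (1/2)^m" if "s \<in> Dom" for s m
  proof (rule LIMSEQ_le_const2[OF dist_lim[OF that xM]], intro exI[of _ m] allI impI)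
    fix n assume "m \<le> n"
    then show "d (x (s m)) (x (s n)) \<le> 3 * (1/2)^m" using step[OF that, of m "n - m"] by simp
  qed
  have gen: "generates mtopology ((\<lambda>x y. min 1 (d x y)) ` range x)"
    by (rule generates_dist[OF x dense])
  have dec_meas: "dec \<in> \<nu> \<rightarrow>\<^sub>M borel_of mtopology"
  proof (rule measurable_borel_of_generates[OF gen])
    fix w assume "w \<in> (\<lambda>x y. min 1 (d x y)) ` range x"
    then obtain i where w: "w = (\<lambda>y. min 1 (d (x i) y))" by auto
    show "(\<lambda>s. w (dec s)) \<in> borel_measurable \<nu>"
    proof (rule borel_measurable_LIMSEQ_real)
      fix m
      have "(\<lambda>s. min 1 (d (x i) (x (s m)))) \<in> borel_measurable \<nu>"
        using measurable_compose[OF coord[of m], of "\<lambda>j. min 1 (d (x i) (x j))" borel] by simp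
      then show "(\<lambda>s. if s \<in> Dom then min 1 (d (x i) (x (s m))) else min 1 (d (x i) (x 0))) \<in> borel_measurable \<nu>"
        using Dom_sets by (intro measurable_If) (auto simp: sp)
    next
      fix s
      show "(\<lambda>m. if s \<in> Dom then min 1 (d (x i) (x (s m))) else min 1 (d (x i) (x 0))) \<longlonglongrightarrow> w (dec s)"
        using dist_lim[of s "x i"] by (auto simp: w dec_def intro!: tendsto_intros)
    qed
  qed (auto simp: dec_M)
  define \<mu> where "\<mu> = distr \<nu> (borel_of mtopology) dec"
  have \<mu>: "\<mu> \<in> prob_measures mtopology"
    by (auto simp: prob_measures_def \<mu>_def intro!: \<nu>.prob_space_distr dec_meas)
  have op: "\<forall>\<^sub>F k in sequentially. measure (a (r k)) U > measure \<mu> U - \<delta>"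
    if U: "openin mtopology U" and "0 < \<delta>" for U \<delta>
  proof -
    \<comment> \<open>The factor 4 is above 1, so for (m, i) in \<open>G\<close> every point whose
      code at level m is i belongs to U. Together with the 3 of \<open>dec_close\<close> it accounts
      for the 7 in \<open>cover\<close>.\<close>
    define G where "G = {(m, i). \<forall>y\<in>M. d (x i) y < 4 * (1/2)^m \<longrightarrow> y \<in> U}"
    \<comment> \<open>Bounding both m and the value \<open>s m\<close> by L makes \<open>B L\<close>
      a cylinder set. These sets increase and, up to a null set, cover the codes that are decoded
      into U.\<close>
    define B where "B = (\<lambda>L. {s. \<exists>m<L. (m, s m) \<in> G \<and> s m < L})"
    have B_cyl: "B L \<in> cyl_algebra" for L
    proof (rule cyl_algebraI[of L L])
      fix s t assume eq: "trunc L L s = trunc L L t" and "s \<in> B L"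
      then obtain m where m: "m < L" "(m, s m) \<in> G" "s m < L" by (auto simp: B_def)
      then have "t m = s m" using fun_cong[OF eq, of m] by (auto simp: trunc_def min_def split: if_splits)
      then show "t \<in> B L" using m by (auto simp: B_def)
    qed
    have B_sets: "B L \<in> sets \<nu>" for L using cyl_algebra_sets[OF B_cyl] \<nu>(2) by simp
    have cover: "s \<in> (\<Union>L. B L)" if "s \<in> Dom" "dec s \<in> U" for s
    proof -
      obtain e where e: "e > 0" "mball (dec s) e \<subseteq> U" using U \<open>dec s \<in> U\<close> unfolding openin_mtopology by blast
      obtain m where m: "7 * (1/2)^m < e" using small e(1) by blast
      have "y \<in> U" if "y \<in> M" "d (x (s m)) y < 4 * (1/2)^m" for y
      proof -
        have "d (dec s) y \<le> d (x (s m)) (dec s) + d (x (s m)) y"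
          using triangle[of "dec s" "x (s m)" y] dec_M that by (simp add: commute)
        then have "d (dec s) y < e" using dec_close[OF \<open>s \<in> Dom\<close>, of m] that(2) m by linarith
        then show ?thesis using e(2) dec_M that(1) by auto
      qed
      then have "(m, s m) \<in> G" by (simp add: G_def)
      then have "s \<in> B (Suc (max m (s m)))" by (auto simp: B_def intro!: exI[of _ m])
      then show ?thesis by blast
    qed
    have "measure \<mu> U = measure \<nu> (dec -` U \<inter> space \<nu>)"
      unfolding \<mu>_def by (rule measure_distr[OF dec_meas openin_sets_borel_of[OF U]])
    also have "\<dots> \<le> measure \<nu> (\<Union>L. B L)"
    proof (rule \<nu>.finite_measure_mono_AE)
      show "AE s in \<nu>. s \<in> dec -` U \<inter> space \<nu> \<longrightarrow> s \<in> (\<Union>L. B L)"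
        using AE_Dom by eventually_elim (use cover in auto)
    qed (use B_sets in auto)
    finally have le: "measure \<mu> U \<le> measure \<nu> (\<Union>L. B L)" .
    have "(\<lambda>L. measure \<nu> (B L)) \<longlonglongrightarrow> measure \<nu> (\<Union>L. B L)"
      by (rule \<nu>.finite_Lim_measure_incseq) (use B_sets in \<open>auto simp: incseq_def B_def\<close>, use order_less_le_trans in blast)
    then have "\<forall>\<^sub>F L in sequentially. measure \<nu> (B L) > measure \<mu> U - \<delta> / 2"
      using le \<open>0 < \<delta>\<close> by (intro order_tendstoD(1)) auto
    then obtain L where L: "measure \<nu> (B L) > measure \<mu> U - \<delta> / 2" by (auto dest: eventually_happens)
    have "\<forall>\<^sub>F k in sequentially. measure (b (r k)) (B L) > measure \<nu> (B L) - \<delta> / 2"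
      using \<open>0 < \<delta>\<close> by (intro order_tendstoD(1)[OF lim[OF B_cyl]]) auto
    then show ?thesis
    proof eventually_elim
      case (elim k)
      interpret prob_space "a (r k)" by (rule aD)
      have "y \<in> U" if "y \<in> M" "c y \<in> B L" for y
      proof -
        obtain m where "(m, c y m) \<in> G" using \<open>c y \<in> B L\<close> by (auto simp: B_def)
        moreover have "d (x (c y m)) y < 4 * (1/2)^m"
          using c[OF that(1), of m] zero_less_power[of "1/2::real" m] by linarith
        ultimately show ?thesis using that(1) by (simp add: G_def)
      qed
      then have "measure (b (r k)) (B L) \<le> measure (a (r k)) U"
        unfolding b_measure[OF cyl_algebra_sets[OF B_cyl]]
        by (intro finite_measure_mono) (use openin_sets_borel_of[OF U] aD in auto)
      then show ?case using elim L by linarith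
    qed
  qed
  have "limitin (weak_top mtopology) (\<lambda>k. a (r k)) \<mu> sequentially"
    by (intro limitin_weak_topI \<mu> portmanteau_open[OF _ \<mu> op]) (auto simp: a)
  with r show thesis by (rule that)
qed

section \<open>Empirical and directing measures\<close>

text \<open>The image measure supplies countable additivity, and \<open>integral_distr\<close> then
  turns integrals into averages.\<close>

lemma empirical_eq_distr:
  assumes "k \<ge> 1"
  shows "empirical T z k = distr (uniform_count_measure {1..k}) (borel_of T) z"
proof -
  have "emeasure (uniform_count_measure {1..k}) (z -` A \<inter> space (uniform_count_measure {1..k}))
      = ennreal (real (card {n\<in>{1..k}. z n \<in> A}) / real k)" for A
    by (subst emeasure_uniform_count_measure)
       (auto simp: space_uniform_count_measure intro!: arg_cong[where f=card])
  then show ?thesis by (simp add: empirical_def distr_def)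
qed

lemma measurable_uniform_count:
  assumes "\<And>n. 1 \<le> n \<Longrightarrow> n \<le> k \<Longrightarrow> z n \<in> topspace T"
  shows "z \<in> uniform_count_measure {1..k} \<rightarrow>\<^sub>M borel_of T"
  using assms by (auto simp: measurable_def sets_uniform_count_measure space_uniform_count_measure)

lemma empirical_prob_measures:
  assumes "k \<ge> 1" "\<And>n. 1 \<le> n \<Longrightarrow> n \<le> k \<Longrightarrow> z n \<in> topspace T"
  shows "empirical T z k \<in> prob_measures T"
proof -
  interpret prob_space "uniform_count_measure {1..k}"
    by (rule prob_space_uniform_count_measure) (use assms in auto)
  show ?thesis
    using prob_space_distr[OF measurable_uniform_count[OF assms(2)]]
    by (simp add: empirical_eq_distr[OF assms(1)] prob_measures_def)
qed

lemma integral_empirical: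
  assumes "k \<ge> 1" "\<And>n. 1 \<le> n \<Longrightarrow> n \<le> k \<Longrightarrow> z n \<in> topspace T" "g \<in> borel_measurable (borel_of T)"
  shows "integral\<^sup>L (empirical T z k) g = average (\<lambda>n. g (z n)) k"
  unfolding empirical_eq_distr[OF assms(1)]
  by (subst integral_distr[OF measurable_uniform_count[OF assms(2)] assms(3)])
     (auto simp: integral_uniform_count_measure average_def)

lemma measure_empirical:
  assumes "k \<ge> 1" "\<And>n. 1 \<le> n \<Longrightarrow> n \<le> k \<Longrightarrow> z n \<in> topspace T" "A \<in> sets (borel_of T)"
  shows "measure (empirical T z k) A = average (\<lambda>n. indicator A (z n)) k"
proof -
  have "empirical T z k \<in> prob_measures T" by (rule empirical_prob_measures[OF assms(1)]) (rule assms(2))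
  then have "A \<in> sets (empirical T z k)" using prob_measuresD(2) assms(3) by blast
  then have "measure (empirical T z k) A = integral\<^sup>L (empirical T z k) (indicat_real A)" by simp
  also have "\<dots> = average (\<lambda>n. indicator A (z n)) k"
    by (rule integral_empirical[OF assms(1)]) (use assms in auto)
  finally show ?thesis .
qed

lemma average_mono:
  assumes "\<And>n. 1 \<le> n \<Longrightarrow> n \<le> k \<Longrightarrow> y n \<le> z n"
  shows "average y k \<le> average z k"
  unfolding average_def by (intro divide_right_mono sum_mono) (use assms in auto)

section \<open>A countable criterion for the convergence of empirical measures\<close>

locale dense_sequence = Metric_space M d for M :: "'a set" and d +
  fixes x :: "nat \<Rightarrow> 'a"
  assumes complete: mcomplete and x_range: "range x \<subseteq> M" and x_dense: "mtopology closure_of range x = M"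
begin

definition W :: "('a \<Rightarrow> real) set" where "W = (\<lambda>x y. min 1 (d x y)) ` range x"

lemma gen: "generates mtopology W" and W_countable: "countable W"
  unfolding W_def using generates_dist[OF x_range x_dense] by auto

text \<open>These open sets express tightness in place of compact ones: at each scale m, finitely
  many balls must carry most of the mass.\<close>

definition net :: "nat \<Rightarrow> nat \<Rightarrow> 'a set" where "net m J = (\<Union>i\<le>J. mball (x i) ((1/2)^m))"

lemma openin_net: "openin mtopology (net m J)"
  unfolding net_def by (intro openin_Union) auto

lemma net_sets: "net m J \<in> sets (borel_of mtopology)"
  by (rule openin_sets_borel_of[OF openin_net])

lemma net_mono: "J \<le> J' \<Longrightarrow> net m J \<subseteq> net m J'"
  unfolding net_def by (rule UN_mono) auto

lemma net_cover: "y \<in> M \<Longrightarrow> \<exists>J. y \<in> net m J"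
proof -
  assume y: "y \<in> M"
  then have "y \<in> mtopology closure_of range x" using x_dense by simp
  then have "\<forall>r>0. \<exists>z\<in>range x. z \<in> mball y r" by (simp add: metric_closure_of)
  moreover have "(1/2::real)^m > 0" by simp
  ultimately have "\<exists>z\<in>range x. z \<in> mball y ((1/2)^m)" by blast
  then obtain J where "x J \<in> mball y ((1/2)^m)" by blast
  then show ?thesis by (auto simp: net_def commute intro!: exI[of _ J])
qed

text \<open>Existence of a weak limit quantifies over measures, whereas this equivalent condition is
  countable and hence measurable. Its second half prevents the loss of mass that convergence of
  averages alone would allow.\<close>

definition good :: "(nat \<Rightarrow> 'a) \<Rightarrow> bool" where
  "good z \<longleftrightarrow> (\<forall>h\<in>monomials W. convergent (average (\<lambda>n. h (z n)))) \<and>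
     (\<forall>m p. \<exists>J. \<forall>\<^sub>F k in sequentially. average (\<lambda>n. indicator (net m J) (z n)) k \<ge> 1 - 1 / real (Suc p))"

text \<open>The first K points lie in finitely many balls of the scale, so a larger J covers them
  all. The bound for every k is the form in which \<open>tight_imp_convergent_subsequence\<close>
  asks for tightness.\<close>

lemma net_average_all:
  assumes z: "\<And>n. n \<ge> 1 \<Longrightarrow> z n \<in> M"
    and J: "\<forall>\<^sub>F k in sequentially. average (\<lambda>n. indicator (net m J) (z n)) k \<ge> 1 - \<epsilon>" and "\<epsilon> > 0"
  shows "\<exists>J. \<forall>k\<ge>1. average (\<lambda>n. indicator (net m J) (z n)) k \<ge> 1 - \<epsilon>"
proof -
  obtain K where K: "\<And>k. k \<ge> K \<Longrightarrow> average (\<lambda>n. indicator (net m J) (z n)) k \<ge> 1 - \<epsilon>"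
    using J unfolding eventually_sequentially by blast
  have "\<exists>I. z n \<in> net m I" if "n \<ge> 1" for n using net_cover z that by blast
  then obtain I where I: "\<And>n. n \<ge> 1 \<Longrightarrow> z n \<in> net m (I n)" by metis
  define J' where "J' = Max (insert J (I ` {1..K}))"
  have J': "J \<le> J'" "\<And>n. 1 \<le> n \<Longrightarrow> n \<le> K \<Longrightarrow> I n \<le> J'"
    unfolding J'_def by (rule Max_ge; simp)+
  show ?thesis
  proof (intro exI[of _ J'] allI impI)
    fix k :: nat assume "k \<ge> 1"
    show "average (\<lambda>n. indicator (net m J') (z n)) k \<ge> 1 - \<epsilon>"
    proof (cases "k \<ge> K")
      case True
      have "average (\<lambda>n. indicator (net m J) (z n)) k \<le> average (\<lambda>n. indicator (net m J') (z n) :: real) k"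
        by (rule average_mono) (use net_mono[OF J'(1)] in \<open>auto simp: indicator_def\<close>)
      then show ?thesis using K[OF True] by simp
    next
      case False
      have "z n \<in> net m J'" if "n \<in> {1..k}" for n
        using I[of n] net_mono[OF J'(2), of n m] that False by auto
      then have "average (\<lambda>n. indicator (net m J') (z n)) k = average (\<lambda>n. 1) k"
        unfolding average_def by (intro arg_cong[where f="\<lambda>t. t / real k"] sum.cong) auto
      then show ?thesis using \<open>k \<ge> 1\<close> \<open>\<epsilon> > 0\<close> by (simp add: average_def)
    qed
  qed
qed

text \<open>Given a limit, large nets have limit mass near 1 and, being open, pass it on to the
  empirical measures. Conversely, tightness yields a limit along a subsequence, and convergence of
  the monomial averages forces the whole sequence to it.\<close>

lemma empirical_limit_iff:
  assumes z: "\<And>n. n \<ge> 1 \<Longrightarrow> z n \<in> M"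
  shows "(\<exists>\<mu>. limitin (weak_top mtopology) (\<lambda>k. empirical mtopology z k) \<mu> sequentially) \<longleftrightarrow> good z"
proof
  have zt: "\<And>n k. 1 \<le> n \<Longrightarrow> n \<le> k \<Longrightarrow> z n \<in> topspace mtopology" using z by simp
  have int: "integral\<^sup>L (empirical mtopology z k) h = average (\<lambda>n. h (z n)) k" if "h \<in> bcont mtopology" "k \<ge> 1" for h k
    by (rule integral_empirical[OF that(2) zt bcont_measurable[OF that(1)]])
  have msr: "measure (empirical mtopology z k) (net m J) = average (\<lambda>n. indicator (net m J) (z n)) k" if "k \<ge> 1" for m J k
    by (rule measure_empirical[OF that zt net_sets])
  have ev1: "\<forall>\<^sub>F k in sequentially. (k::nat) \<ge> 1" by (rule eventually_ge_at_top)
  {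
    assume "\<exists>\<mu>. limitin (weak_top mtopology) (\<lambda>k. empirical mtopology z k) \<mu> sequentially"
    then obtain \<mu> where \<mu>: "limitin (weak_top mtopology) (\<lambda>k. empirical mtopology z k) \<mu> sequentially" by blast
    note \<mu>D = prob_measuresD[OF limitin_weak_topD(1)[OF \<mu>]]
    interpret prob_space \<mu> by fact
    show "good z"
      unfolding good_def
    proof (intro conjI ballI allI)
      fix h assume "h \<in> monomials W"
      then have h: "h \<in> bcont mtopology" by (rule monomials_bcont[OF gen])
      have "\<forall>\<^sub>F k in sequentially. integral\<^sup>L (empirical mtopology z k) h = average (\<lambda>n. h (z n)) k"
        using ev1 by eventually_elim (rule int[OF h])
      from Lim_transform_eventually[OF limitin_weak_topD(3)[OF \<mu> h] this]
      show "convergent (average (\<lambda>n. h (z n)))" by (rule convergentI)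
    next
      fix m p :: nat
      have "(\<lambda>J. measure \<mu> (net m J)) \<longlonglongrightarrow> measure \<mu> (\<Union>J. net m J)"
        by (rule finite_Lim_measure_incseq) (use net_sets \<mu>D net_mono in \<open>auto simp: incseq_def\<close>)
      moreover have "(\<Union>J. net m J) = space \<mu>"
        using net_cover openin_subset[OF openin_net] \<mu>D(3) by fastforce
      ultimately have "(\<lambda>J. measure \<mu> (net m J)) \<longlonglongrightarrow> 1" by (simp add: prob_space)
      \<comment> \<open>Half of 1 / (p + 1) is given away here, the other half in
        \<open>weak_limit_open\<close>.\<close>
      from order_tendstoD(1)[OF this, of "1 - 1 / real (Suc p) / 2"]
      obtain J where J: "measure \<mu> (net m J) > 1 - 1 / real (Suc p) / 2"
        by (auto dest: eventually_happens)
      have "\<forall>\<^sub>F k in sequentially. measure (empirical mtopology z k) (net m J) > measure \<mu> (net m J) - 1 / real (Suc p) / 2"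
        by (rule weak_limit_open[OF gen W_countable \<mu> openin_net]) simp
      then have "\<forall>\<^sub>F k in sequentially. average (\<lambda>n. indicator (net m J) (z n)) k \<ge> 1 - 1 / real (Suc p)"
        using ev1
      proof eventually_elim
        case (elim k)
        with J show ?case unfolding msr[OF elim(2)] by linarith
      qed
      then show "\<exists>J. \<forall>\<^sub>F k in sequentially. average (\<lambda>n. indicator (net m J) (z n)) k \<ge> 1 - 1 / real (Suc p)" ..
    qed
  }
  {
    assume g: "good z"
    \<comment> \<open>The shift by one skips the empirical measure of zero points.\<close>
    define a where "a = (\<lambda>k. empirical mtopology z (Suc k))"
    have a: "a k \<in> prob_measures mtopology" for k unfolding a_def by (rule empirical_prob_measures) (use zt in auto)
    have tight: "\<exists>J::nat. \<forall>n::nat. measure (a n) (\<Union>i\<le>J. mball (x i) ((1/2)^m)) \<ge> 1 - \<epsilon>" if "\<epsilon> > 0" for m \<epsilon>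
    proof -
      obtain p where p: "1 / real (Suc p) < \<epsilon>" using nat_approx_posE[OF \<open>\<epsilon> > 0\<close>] by blast
      obtain J where "\<forall>\<^sub>F k in sequentially. average (\<lambda>n. indicator (net m J) (z n)) k \<ge> 1 - 1 / real (Suc p)"
        using g unfolding good_def by blast
      then have "\<forall>\<^sub>F k in sequentially. average (\<lambda>n. indicator (net m J) (z n)) k \<ge> 1 - \<epsilon>"
        by eventually_elim (use p in linarith)
      from net_average_all[OF z this that] obtain J where
        J: "\<And>k. k \<ge> 1 \<Longrightarrow> average (\<lambda>n. indicator (net m J) (z n)) k \<ge> 1 - \<epsilon>" by blast
      have "measure (a n) (net m J) \<ge> 1 - \<epsilon>" for n
        using J[of "Suc n"] unfolding a_def by (subst msr) auto
      then show ?thesis unfolding net_def by blast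
    qed
    obtain r \<mu> where r: "strict_mono r" and \<mu>: "limitin (weak_top mtopology) (\<lambda>k. a (r k)) \<mu> sequentially"
      by (rule tight_imp_convergent_subsequence[OF complete x_range x_dense a tight])
    have ev: "\<forall>\<^sub>F k in sequentially. empirical mtopology z k \<in> prob_measures mtopology"
      using ev1 by eventually_elim (rule empirical_prob_measures, use zt in auto)
    have "limitin (weak_top mtopology) (\<lambda>k. empirical mtopology z k) \<mu> sequentially"
    proof (rule limitin_weak_topI[OF limitin_weak_topD(1)[OF \<mu>] ev])
      fix f assume "f \<in> bcont mtopology"
      then show "(\<lambda>k. integral\<^sup>L (empirical mtopology z k) f) \<longlonglongrightarrow> integral\<^sup>L \<mu> f"
      proof (rule weak_convergence_monomials[OF gen W_countable ev limitin_weak_topD(1)[OF \<mu>], rotated])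
        fix ws assume "set ws \<subseteq> W"
        then have h: "(\<lambda>y. \<Prod>w\<leftarrow>ws. w y) \<in> monomials W" by (auto simp: monomials_def)
        define h where "h = (\<lambda>y. \<Prod>w\<leftarrow>ws. w y)"
        have hb: "h \<in> bcont mtopology" unfolding h_def by (rule monomials_bcont[OF gen h])
        obtain l where l: "average (\<lambda>n. h (z n)) \<longlonglongrightarrow> l"
          using g h by (auto simp: good_def h_def convergent_def)
        have "(\<lambda>k. integral\<^sup>L (a (r k)) h) \<longlonglongrightarrow> l"
          using LIMSEQ_subseq_LIMSEQ[OF LIMSEQ_Suc[OF l] r] int[OF hb] by (simp add: a_def comp_def)
        then have "l = integral\<^sup>L \<mu> h" using limitin_weak_topD(3)[OF \<mu> hb] LIMSEQ_unique by blast
        moreover have "\<forall>\<^sub>F k in sequentially. average (\<lambda>n. h (z n)) k = integral\<^sup>L (empirical mtopology z k) h"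
          using ev1 by eventually_elim (simp add: int[OF hb])
        ultimately have "(\<lambda>k. integral\<^sup>L (empirical mtopology z k) h) \<longlonglongrightarrow> integral\<^sup>L \<mu> h"
          using Lim_transform_eventually[OF l] by simp
        then show "(\<lambda>k. \<integral>y. (\<Prod>w\<leftarrow>ws. w y) \<partial>empirical mtopology z k) \<longlonglongrightarrow> (\<integral>y. (\<Prod>w\<leftarrow>ws. w y) \<partial>\<mu>)"
          by (simp add: h_def)
      qed
    qed
    then show "\<exists>\<mu>. limitin (weak_top mtopology) (\<lambda>k. empirical mtopology z k) \<mu> sequentially" ..
  }
qed

lemma monomial_measurable:
  "h \<in> monomials W \<Longrightarrow> h \<in> borel_measurable (borel_of mtopology)"
  by (intro bcont_measurable monomials_bcont[OF gen])

lemma average_measurable: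
  assumes "\<And>n. n \<ge> 1 \<Longrightarrow> Z n \<in> N \<rightarrow>\<^sub>M borel_of mtopology" "h \<in> borel_measurable (borel_of mtopology)"
  shows "(\<lambda>\<omega>. average (\<lambda>n. h (Z n \<omega>)) k :: real) \<in> borel_measurable N"
  unfolding average_def
  by (intro borel_measurable_divide borel_measurable_sum measurable_compose[OF assms]) auto

lemma good_sets:
  assumes Z: "\<And>n. n \<ge> 1 \<Longrightarrow> Z n \<in> N \<rightarrow>\<^sub>M borel_of mtopology"
  shows "{\<omega> \<in> space N. good (\<lambda>n. Z n \<omega>)} \<in> sets N"
proof -
  have 1: "{\<omega> \<in> space N. convergent (average (\<lambda>n. h (Z n \<omega>)))} \<in> sets N" if "h \<in> monomials W" for h
    using sets_Collect_Cauchy[of "\<lambda>k \<omega>. average (\<lambda>n. h (Z n \<omega>)) k" N] average_measurable[OF Z monomial_measurable[OF that]]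
    by (simp add: Cauchy_convergent_iff)
  have 2: "{\<omega> \<in> space N. average (\<lambda>n. indicator (net m J) (Z n \<omega>)) k \<ge> 1 - 1 / real (Suc p)} \<in> sets N" for m J k p
    using average_measurable[OF Z, where h="indicat_real (net m J)" and k=k] net_sets by simp
  have "{\<omega> \<in> space N. \<exists>J K. \<forall>k. k \<ge> K \<longrightarrow> average (\<lambda>n. indicator (net m J) (Z n \<omega>)) k \<ge> 1 - 1 / real (Suc p)} \<in> sets N" for m p
    by (intro sets.sets_Collect_countable_Ex sets.sets_Collect_countable_All sets.sets_Collect_imp 2) auto
  then have tight: "{\<omega> \<in> space N. (\<forall>m p. \<exists>J K. \<forall>k. k \<ge> K \<longrightarrow> average (\<lambda>n. indicator (net m J) (Z n \<omega>)) k \<ge> 1 - 1 / real (Suc p))} \<in> sets N"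
    by (intro sets.sets_Collect_countable_All)
  have mono: "{\<omega> \<in> space N. \<forall>h\<in>monomials W. convergent (average (\<lambda>n. h (Z n \<omega>)))} \<in> sets N"
    by (rule sets.sets_Collect_countable_All'[OF 1 countable_monomials[OF W_countable]])
  show ?thesis
    unfolding good_def eventually_sequentially by (rule sets.sets_Collect_conj[OF tight mono])
qed

text \<open>The limit frequency \<open>q J\<close> of a net has as its mean the probability that
  \<open>Z 1\<close> lies in the net, and this tends to 1 in J. A Markov estimate shows that almost
  surely some \<open>q J\<close> exceeds 1 - \<delta>. The hypotheses range over Borel functions h
  because indicators of nets are in general not continuous.\<close>

lemma AE_good:
  assumes N: "prob_space N" and Z: "\<And>n. n \<ge> 1 \<Longrightarrow> Z n \<in> N \<rightarrow>\<^sub>M borel_of mtopology"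
    and single: "\<And>h n. h \<in> borel_measurable (borel_of mtopology) \<Longrightarrow> (\<And>y. y \<in> M \<Longrightarrow> \<bar>h y\<bar> \<le> 1) \<Longrightarrow> n \<ge> 1 \<Longrightarrow>
      (\<integral>\<omega>. h (Z n \<omega>) \<partial>N) = (\<integral>\<omega>. h (Z 1 \<omega>) \<partial>N :: real)"
    and conv: "\<And>h. h \<in> borel_measurable (borel_of mtopology) \<Longrightarrow> (\<And>y. y \<in> M \<Longrightarrow> \<bar>h y\<bar> \<le> 1) \<Longrightarrow>
      AE \<omega> in N. convergent (average (\<lambda>n. h (Z n \<omega>) :: real))"
  shows "AE \<omega> in N. good (\<lambda>n. Z n \<omega>)"
proof -
  interpret prob_space N by fact
  have ZM: "Z n \<omega> \<in> M" if "n \<ge> 1" "\<omega> \<in> space N" for n \<omega> using measurable_space[OF Z[OF that(1)] that(2)] by simp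
  have 1: "AE \<omega> in N. \<forall>h\<in>monomials W. convergent (average (\<lambda>n. h (Z n \<omega>)))"
  proof (rule AE_ball_countable[THEN iffD2, OF countable_monomials[OF W_countable]], intro ballI conv)
    fix h assume h: "h \<in> monomials W"
    show "h \<in> borel_measurable (borel_of mtopology)" by (rule monomial_measurable[OF h])
    show "\<bar>h y\<bar> \<le> 1" if "y \<in> M" for y using monomials_range[OF gen h, of y] that by simp
  qed
  have 2: "AE \<omega> in N. \<exists>J. \<forall>\<^sub>F k in sequentially. average (\<lambda>n. indicator (net m J) (Z n \<omega>)) k \<ge> 1 - 1 / real (Suc p)" for m p
  proof -
    define f where "f = (\<lambda>J k \<omega>. average (\<lambda>n. indicat_real (net m J) (Z n \<omega>)) k)"
    define q where "q = (\<lambda>J \<omega>. lim (\<lambda>k. f J k \<omega>))"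
    define \<delta> where "\<delta> = 1 / real (Suc p)"
    have "\<delta> > 0" by (simp add: \<delta>_def)
    have f [measurable]: "f J k \<in> borel_measurable N" for J k
      unfolding f_def by (rule average_measurable[OF Z]) (use net_sets in auto)
    have q [measurable]: "q J \<in> borel_measurable N" for J
      unfolding q_def by (rule borel_measurable_lim_metric) simp
    have f01: "0 \<le> f J k \<omega>" "f J k \<omega> \<le> 1" for J k \<omega>
    proof -
      show "0 \<le> f J k \<omega>" by (auto simp: f_def average_def intro!: divide_nonneg_nonneg sum_nonneg)
      show "f J k \<omega> \<le> 1"
        unfolding f_def by (rule abs_le_D1, rule average_bounded) (auto simp: indicator_def)
    qed
    have lim: "AE \<omega> in N. (\<lambda>k. f J k \<omega>) \<longlonglongrightarrow> q J \<omega>" for J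
    proof -
      have "AE \<omega> in N. convergent (average (\<lambda>n. indicat_real (net m J) (Z n \<omega>)))"
        by (rule conv) (use net_sets in auto)
      then show ?thesis unfolding q_def f_def by (simp add: convergent_LIMSEQ_iff)
    qed
    have q1: "AE \<omega> in N. 0 \<le> q J \<omega> \<and> q J \<omega> \<le> 1" for J
      using lim[of J]
    proof eventually_elim
      case (elim \<omega>)
      then show ?case using f01 LIMSEQ_le_const[OF elim] LIMSEQ_le_const2[OF elim] by blast
    qed
    have Ef: "(\<integral>\<omega>. f J k \<omega> \<partial>N) = measure N (Z 1 -` net m J \<inter> space N)" if "k \<ge> 1" for J k
    proof -
      have ii: "integrable N (\<lambda>\<omega>. indicat_real (net m J) (Z n \<omega>))" if "n \<ge> 1" for n
        by (rule integrable_const_bound[where B=1])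
           (use measurable_compose[OF Z[OF that], of "indicat_real (net m J)"] net_sets in auto)
      have "(\<integral>\<omega>. f J k \<omega> \<partial>N) = (\<Sum>n=1..k. \<integral>\<omega>. indicat_real (net m J) (Z n \<omega>) \<partial>N) / real k"
        unfolding f_def average_def using ii by (simp add: Bochner_Integration.integral_sum)
      also have "\<dots> = (\<Sum>n=1..k. \<integral>\<omega>. indicat_real (net m J) (Z 1 \<omega>) \<partial>N) / real k"
      proof -
        have "(\<integral>\<omega>. indicat_real (net m J) (Z n \<omega>) \<partial>N) = (\<integral>\<omega>. indicat_real (net m J) (Z 1 \<omega>) \<partial>N)" if "n \<in> {1..k}" for n
          by (rule single) (use net_sets that in auto)
        then show ?thesis by (intro arg_cong[where f="\<lambda>t. t / real k"] sum.cong refl)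
      qed
      also have "\<dots> = (\<integral>\<omega>. indicat_real (net m J) (Z 1 \<omega>) \<partial>N)" using that by simp
      also have "\<dots> = (\<integral>\<omega>. indicat_real (Z 1 -` net m J \<inter> space N) \<omega> \<partial>N)"
        by (intro Bochner_Integration.integral_cong) (auto simp: indicator_def)
      finally show ?thesis using measurable_sets[OF Z net_sets] by simp
    qed
    have Eq: "(\<integral>\<omega>. q J \<omega> \<partial>N) = measure N (Z 1 -` net m J \<inter> space N)" for J
    proof -
      have "(\<lambda>k. \<integral>\<omega>. f J k \<omega> \<partial>N) \<longlonglongrightarrow> (\<integral>\<omega>. q J \<omega> \<partial>N)"
        by (rule integral_dominated_convergence[where w="\<lambda>_. 1"]) (use lim f01 in auto)
      moreover have "(\<lambda>k. \<integral>\<omega>. f J k \<omega> \<partial>N) \<longlonglongrightarrow> measure N (Z 1 -` net m J \<inter> space N)"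
        by (rule tendsto_eventually) (use Ef in \<open>auto simp: eventually_sequentially intro!: exI[of _ 1]\<close>)
      ultimately show ?thesis by (rule LIMSEQ_unique)
    qed
    have "(\<lambda>J. measure N (Z 1 -` net m J \<inter> space N)) \<longlonglongrightarrow> measure N (\<Union>J. Z 1 -` net m J \<inter> space N)"
    proof (rule finite_Lim_measure_incseq)
      show "range (\<lambda>J. Z 1 -` net m J \<inter> space N) \<subseteq> sets N" using measurable_sets[OF Z net_sets] by auto
      show "incseq (\<lambda>J. Z 1 -` net m J \<inter> space N)" using net_mono by (fastforce simp: incseq_def)
    qed
    moreover have "(\<Union>J. Z 1 -` net m J \<inter> space N) = space N" using net_cover ZM[of 1] by fastforce
    ultimately have EJ: "(\<lambda>J. \<integral>\<omega>. q J \<omega> \<partial>N) \<longlonglongrightarrow> 1" by (simp add: Eq prob_space)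
    \<comment> \<open>On \<open>B\<close> every \<open>1 - q J \<omega>\<close> is at least
      \<delta>, so \<delta> times the probability of \<open>B\<close> is at most 1 minus the mean of
      \<open>q J\<close>.\<close>
    define B where "B = {\<omega> \<in> space N. \<forall>J. q J \<omega> \<le> 1 - \<delta>}"
    have B [measurable]: "B \<in> sets N" unfolding B_def by measurable
    have "\<delta> * measure N B \<le> 1 - (\<integral>\<omega>. q J \<omega> \<partial>N)" for J
    proof -
      have "integrable N (q J)" by (rule integrable_const_bound[where B=1]) (use q1[of J] in auto)
      then have "1 - (\<integral>\<omega>. q J \<omega> \<partial>N) = (\<integral>\<omega>. 1 - q J \<omega> \<partial>N)" by (simp add: prob_space)
      also have "\<dots> \<ge> (\<integral>\<omega>. \<delta> * indicator B \<omega> \<partial>N)"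
      proof (rule integral_mono_AE)
        show "AE \<omega> in N. \<delta> * indicator B \<omega> \<le> 1 - q J \<omega>"
          using q1[of J] by eventually_elim (auto simp: indicator_def B_def algebra_simps)
      qed (use \<open>integrable N (q J)\<close> B in \<open>auto simp: emeasure_eq_measure\<close>)
      finally show ?thesis using B by simp
    qed
    then have "\<delta> * measure N B \<le> 1 - 1"
      by (intro LIMSEQ_le_const[OF tendsto_diff[OF tendsto_const EJ]]) auto
    then have "measure N B = 0" using \<open>\<delta> > 0\<close> measure_nonneg[of N B] by (simp add: mult_le_0_iff)
    then have "B \<in> null_sets N" by (intro null_setsI) (auto simp: emeasure_eq_measure)
    then have "AE \<omega> in N. \<omega> \<notin> B" by (rule AE_not_in)
    moreover have "AE \<omega> in N. \<forall>J. (\<lambda>k. f J k \<omega>) \<longlonglongrightarrow> q J \<omega>" using lim by (simp add: AE_all_countable)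
    moreover have "AE \<omega> in N. \<omega> \<in> space N" by simp
    ultimately show ?thesis
    proof eventually_elim
      case (elim \<omega>)
      then obtain J where "q J \<omega> > 1 - \<delta>" by (auto simp: B_def not_le)
      then have "\<forall>\<^sub>F k in sequentially. f J k \<omega> > 1 - \<delta>" using elim(2) order_tendstoD(1) by blast
      then have "\<forall>\<^sub>F k in sequentially. f J k \<omega> \<ge> 1 - \<delta>" by eventually_elim simp
      then show ?case unfolding f_def \<delta>_def by blast
    qed
  qed
  then have "AE \<omega> in N. \<forall>m p. \<exists>J. \<forall>\<^sub>F k in sequentially. average (\<lambda>n. indicator (net m J) (Z n \<omega>)) k \<ge> 1 - 1 / real (Suc p)"
    by (simp add: AE_all_countable)
  with 1 show ?thesis by eventually_elim (simp add: good_def)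
qed

end

section \<open>Directing measures on Polish spaces\<close>

lemma Polish_space_dense_sequence:
  assumes "Polish_space S" "topspace S \<noteq> {}"
  obtains M d x where "dense_sequence M d x" "S = Metric_space.mtopology M d"
proof -
  obtain M d where Md: "Metric_space M d" "Metric_space.mcomplete M d" "S = Metric_space.mtopology M d"
    using assms(1) unfolding Polish_space_def completely_metrizable_space_def by blast
  interpret Metric_space M d by (rule Md)
  obtain C where C: "countable C" "C \<subseteq> topspace S" "S closure_of C = topspace S"
    using assms(1) unfolding Polish_space_def separable_space_def by blast
  have "C \<noteq> {}" using C(3) assms(2) closure_of_empty by metis
  then have "range (from_nat_into C) = C" using C(1) by (rule range_from_nat_into)
  then have "dense_sequence M d (from_nat_into C)"
    using C Md by unfold_locales auto
  then show thesis by (rule that[OF _ Md(3)])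
qed

lemma directing_limit:
  assumes "\<exists>\<mu>. limitin (weak_top S) (\<lambda>k. empirical S z k) \<mu> sequentially"
  shows "limitin (weak_top S) (\<lambda>k. empirical S z k) (directing S z) sequentially"
  unfolding directing_def if_P[OF assms] by (rule someI_ex[OF assms])

lemma directing_prob_measures:
  assumes "z 1 \<in> topspace S"
  shows "directing S z \<in> prob_measures S"
proof (cases "\<exists>\<mu>. limitin (weak_top S) (\<lambda>k. empirical S z k) \<mu> sequentially")
  case True
  from limitin_weak_topD(1)[OF directing_limit[OF True]] show ?thesis .
next
  case False
  then show ?thesis using assms by (auto simp: directing_def prob_measures_def intro!: prob_space_return)
qed

text \<open>The formula includes the default branch of \<open>directing\<close>, so it holds at
  every outcome. Measurability is deduced from it, and an almost sure identity would not do for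
  that.\<close>

lemma directing_integral:
  assumes z: "\<And>n. n \<ge> 1 \<Longrightarrow> z n \<in> topspace S" and f: "f \<in> bcont S"
  shows "integral\<^sup>L (directing S z) f =
    (if \<exists>\<mu>. limitin (weak_top S) (\<lambda>k. empirical S z k) \<mu> sequentially
     then lim (average (\<lambda>n. f (z n))) else f (z 1))"
    and "\<exists>\<mu>. limitin (weak_top S) (\<lambda>k. empirical S z k) \<mu> sequentially \<Longrightarrow> convergent (average (\<lambda>n. f (z n)))"
proof -
  have *: "average (\<lambda>n. f (z n)) \<longlonglongrightarrow> integral\<^sup>L (directing S z) f"
    if "\<exists>\<mu>. limitin (weak_top S) (\<lambda>k. empirical S z k) \<mu> sequentially"
  proof (rule Lim_transform_eventually[OF limitin_weak_topD(3)[OF directing_limit[OF that] f]])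
    have "\<forall>\<^sub>F k in sequentially. (k::nat) \<ge> 1" by (rule eventually_ge_at_top)
    then show "\<forall>\<^sub>F k in sequentially. integral\<^sup>L (empirical S z k) f = average (\<lambda>n. f (z n)) k"
      by eventually_elim (rule integral_empirical, use z bcont_measurable[OF f] in auto)
  qed
  show "convergent (average (\<lambda>n. f (z n)))" if "\<exists>\<mu>. limitin (weak_top S) (\<lambda>k. empirical S z k) \<mu> sequentially"
    using *[OF that] by (rule convergentI)
  show "integral\<^sup>L (directing S z) f =
    (if \<exists>\<mu>. limitin (weak_top S) (\<lambda>k. empirical S z k) \<mu> sequentially
     then lim (average (\<lambda>n. f (z n))) else f (z 1))"
    using limI[OF *] z[of 1] bcont_measurable[OF f]
    by (auto simp: directing_def integral_return)
qed

section \<open>Multi-exchangeable systems\<close>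

text \<open>The integral of a function against the measure of one class, as a functional of its values
  along the class. The value 0 on divergent sequences keeps it bounded.\<close>
definition lam :: "enat \<Rightarrow> (nat \<Rightarrow> real) \<Rightarrow> real" where
  "lam N z = (case N of enat k \<Rightarrow> average z k
     | \<infinity> \<Rightarrow> if convergent (average z) then lim (average z) else 0)"

lemma lam_bound:
  assumes "\<And>n. 1 \<le> n \<Longrightarrow> enat n \<le> N \<Longrightarrow> \<bar>z n\<bar> \<le> 1"
  shows "\<bar>lam N z\<bar> \<le> 1"
proof (cases N)
  case (enat k)
  have "average z k = average (\<lambda>n. if n \<le> k then z n else 0) k"
    unfolding average_def by (intro arg_cong[where f="\<lambda>t. t / real k"] sum.cong) auto
  moreover have "\<bar>average (\<lambda>n. if n \<le> k then z n else 0) k\<bar> \<le> 1"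
    by (rule average_bounded) (use assms enat in auto)
  ultimately show ?thesis by (simp add: lam_def enat)
next
  case infinity
  have "\<bar>average z k\<bar> \<le> 1" for k by (rule average_bounded) (use assms infinity in auto)
  then show ?thesis
    using LIMSEQ_le_const2[OF tendsto_rabs, of "average z" "lim (average z)" 1]
    by (auto simp: lam_def infinity convergent_LIMSEQ_iff)
qed

lemma lam_cong:
  assumes "\<And>n. 1 \<le> n \<Longrightarrow> enat n \<le> N \<Longrightarrow> y n = z n"
  shows "lam N y = lam N z"
proof (cases N)
  case (enat k)
  have "average y k = average z k"
    unfolding average_def by (intro arg_cong[where f="\<lambda>t. t / real k"] sum.cong) (use assms enat in auto)
  then show ?thesis by (simp add: lam_def enat)
next
  case infinity
  have "average y = average z"
    unfolding average_def by (intro ext arg_cong[where f="\<lambda>t. t / real _"] sum.cong) (use assms infinity in auto)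
  then show ?thesis by (simp add: lam_def infinity)
qed

lemma lam_measurable:
  assumes "\<And>n. 1 \<le> n \<Longrightarrow> enat n \<le> N \<Longrightarrow> z n \<in> borel_measurable M"
  shows "(\<lambda>\<omega>. lam N (\<lambda>n. z n \<omega>)) \<in> borel_measurable M"
proof (cases N)
  case (enat k)
  then show ?thesis using assms
    by (auto simp: lam_def average_def intro!: borel_measurable_divide borel_measurable_sum)
next
  case infinity
  have avg: "(\<lambda>\<omega>. average (\<lambda>n. z n \<omega>) k) \<in> borel_measurable M" for k
    unfolding average_def using assms infinity by (intro borel_measurable_divide borel_measurable_sum) auto
  have "{\<omega> \<in> space M. convergent (average (\<lambda>n. z n \<omega>))} \<in> sets M"
    using sets_Collect_Cauchy[of "\<lambda>k \<omega>. average (\<lambda>n. z n \<omega>) k", OF avg] by (simp add: Cauchy_convergent_iff)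
  then show ?thesis
    unfolding lam_def infinity using borel_measurable_lim_metric[OF avg]
    by (simp add: measurable_If)
qed

lemma average_transpose:
  assumes "n \<in> {1..k}" "m \<in> {1..k}"
  shows "average (\<lambda>j. z (Transposition.transpose n m j)) k = average z k"
  using sum.permute[OF permutes_swap_id[OF assms], of z] by (simp add: average_def comp_def)

text \<open>In the infinite case the averages over k \<ge> max n m are unchanged, hence so are
  convergence and limit.\<close>

lemma lam_transpose:
  assumes "1 \<le> n" "enat n \<le> N" "1 \<le> m" "enat m \<le> N"
  shows "lam N (\<lambda>j. z (Transposition.transpose n m j)) = lam N z"
proof (cases N)
  case (enat k)
  then show ?thesis using average_transpose[of n k m z] assms by (simp add: lam_def)
next
  case infinity
  let ?y = "\<lambda>j. z (Transposition.transpose n m j)"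
  have "\<forall>\<^sub>F k in sequentially. average ?y k = average z k"
    unfolding eventually_sequentially
    by (intro exI[of _ "max n m"] allI impI average_transpose) (use assms in auto)
  then have "(average ?y \<longlonglongrightarrow> L) \<longleftrightarrow> (average z \<longlonglongrightarrow> L)" for L by (rule tendsto_cong)
  then show ?thesis by (simp add: lam_def infinity convergent_def lim_def)
qed

text \<open>The finitely many exceptional terms contribute a bounded total divided by k. Index 0
  never enters an average, so it is removed from D.\<close>

lemma average_eventually_constant:
  assumes "finite D" "\<And>m. 1 \<le> m \<Longrightarrow> m \<notin> D \<Longrightarrow> e m = c"
  shows "average e \<longlonglongrightarrow> c"
proof -
  have null: "(\<lambda>k. (\<Sum>m\<in>D - {0}. \<bar>e m - c\<bar>) * inverse (real k)) \<longlonglongrightarrow> 0"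
    by (rule tendsto_mult_right_zero[OF lim_inverse_n])
  have "\<bar>average e k - c\<bar> \<le> (\<Sum>m\<in>D - {0}. \<bar>e m - c\<bar>) * inverse (real k)" if "k \<ge> 1" for k
  proof -
    have eq: "average e k - c = (\<Sum>m=1..k. e m - c) * inverse (real k)"
      using that by (simp add: average_def sum_subtractf field_simps)
    have "\<bar>\<Sum>m=1..k. e m - c\<bar> \<le> (\<Sum>m=1..k. \<bar>e m - c\<bar>)" by (rule sum_abs)
    moreover have "(\<Sum>m=1..k. \<bar>e m - c\<bar>) = (\<Sum>m\<in>{1..k} \<inter> D. \<bar>e m - c\<bar>)"
      by (rule sum.mono_neutral_right) (use assms in auto)
    moreover have "\<dots> \<le> (\<Sum>m\<in>D - {0}. \<bar>e m - c\<bar>)"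
      by (rule sum_mono2) (use assms in auto)
    ultimately have "\<bar>\<Sum>m=1..k. e m - c\<bar> \<le> (\<Sum>m\<in>D - {0}. \<bar>e m - c\<bar>)" by linarith
    then show ?thesis unfolding eq abs_mult by (intro mult_mono) auto
  qed
  then have "\<forall>\<^sub>F k in sequentially. norm (average e k - c) \<le> (\<Sum>m\<in>D - {0}. \<bar>e m - c\<bar>) * inverse (real k)"
    unfolding eventually_sequentially real_norm_def by blast
  from Lim_null_comparison[OF this null] show ?thesis by (rule LIM_zero_cancel)
qed

text \<open>Telescoping: one factor is exchanged at a time while the others are bounded by
  1.\<close>

lemma prod_list_diff:
  fixes a b :: "'b \<Rightarrow> real"
  assumes "\<And>l. l \<in> set ls \<Longrightarrow> \<bar>a l\<bar> \<le> 1" "\<And>l. l \<in> set ls \<Longrightarrow> \<bar>b l\<bar> \<le> 1"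
  shows "\<bar>(\<Prod>l\<leftarrow>ls. a l) - (\<Prod>l\<leftarrow>ls. b l)\<bar> \<le> (\<Sum>l\<leftarrow>ls. \<bar>a l - b l\<bar>)"
  using assms
proof (induction ls)
  case (Cons l ls)
  let ?a = "\<Prod>l\<leftarrow>ls. a l" and ?b = "\<Prod>l\<leftarrow>ls. b l"
  have b1: "\<bar>?b\<bar> \<le> 1" using Cons.prems(2) by (induction ls) (auto simp: abs_mult intro!: mult_le_one)
  have "a l * ?a - b l * ?b = a l * (?a - ?b) + (a l - b l) * ?b" by (simp add: algebra_simps)
  then have "\<bar>a l * ?a - b l * ?b\<bar> \<le> \<bar>a l\<bar> * \<bar>?a - ?b\<bar> + \<bar>a l - b l\<bar> * \<bar>?b\<bar>"
    by (simp only: abs_mult[symmetric] abs_triangle_ineq)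
  also have "\<dots> \<le> 1 * \<bar>?a - ?b\<bar> + \<bar>a l - b l\<bar> * 1"
    using Cons.prems(1) b1 by (intro add_mono mult_mono) auto
  finally show ?case using Cons by simp
qed simp

definition unit_bcont :: "'a topology \<Rightarrow> ('a \<Rightarrow> real) set" where
  "unit_bcont T = {g \<in> bcont T. \<forall>y\<in>topspace T. \<bar>g y\<bar> \<le> 1}"

lemma unit_bcont_mult: "f \<in> unit_bcont T \<Longrightarrow> g \<in> unit_bcont T \<Longrightarrow> (\<lambda>y. f y * g y) \<in> unit_bcont T"
  by (auto simp: unit_bcont_def abs_mult intro: bcont_mult mult_le_one)

lemma monomials_unit_bcont: "generates T W \<Longrightarrow> m \<in> monomials W \<Longrightarrow> m \<in> unit_bcont T"
  unfolding unit_bcont_def using monomials_bcont monomials_range by fastforce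

lemma generates_unit_bcont: "generates T W \<Longrightarrow> w \<in> W \<Longrightarrow> w \<in> unit_bcont T"
  unfolding unit_bcont_def using generates_bcont generates_range by fastforce

lemma unit_bcont_bcont: "g \<in> unit_bcont T \<Longrightarrow> g \<in> bcont T"
  by (simp add: unit_bcont_def)

text \<open>One system at a time, that is, a fixed r. The functionals defined inside from S, C and N
  alone are shared by all r.\<close>

locale exch_system =
  fixes S :: "nat \<Rightarrow> 'a topology" and C :: nat and N :: "nat \<Rightarrow> enat"
    and M :: "'w measure" and X :: "'w \<Rightarrow> nat \<times> nat \<Rightarrow> 'a"
  assumes N: "\<And>i. i \<in> {1..C} \<Longrightarrow> N i \<ge> 1"
    and Polish: "\<And>i. i \<in> {1..C} \<Longrightarrow> Polish_space (S i)"
    and sys: "random_system S C N M X"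
    and exch: "multi_exchangeable S C N M X"
begin

abbreviation "I \<equiv> sys_index C N"
abbreviation "PM \<equiv> PiM I (\<lambda>(n, i). borel_of (S i))"

sublocale prob_space M using sys by (simp add: random_system_def)

lemma I_iff: "(n, i) \<in> I \<longleftrightarrow> i \<in> {1..C} \<and> 1 \<le> n \<and> enat n \<le> N i"
  by (auto simp: sys_index_def)

lemma one_I: "i \<in> {1..C} \<Longrightarrow> (1, i) \<in> I"
  using N by (auto simp: I_iff one_enat_def)

lemma X_measurable: "p \<in> I \<Longrightarrow> (\<lambda>\<omega>. X \<omega> p) \<in> M \<rightarrow>\<^sub>M borel_of (S (snd p))"
  using sys by (cases p) (auto simp: random_system_def)

lemma X_space: "p \<in> I \<Longrightarrow> \<omega> \<in> space M \<Longrightarrow> X \<omega> p \<in> topspace (S (snd p))"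
  using measurable_space[OF X_measurable] by simp

lemma topspace_nonempty: "i \<in> {1..C} \<Longrightarrow> topspace (S i) \<noteq> {}"
  using X_space[OF one_I] not_empty by fastforce

lemma coordinate_measurable: "p \<in> I \<Longrightarrow> (\<lambda>x. x p) \<in> PM \<rightarrow>\<^sub>M borel_of (S (snd p))"
  using measurable_component_singleton[of p I "\<lambda>(n, i). borel_of (S i)"] by (simp add: case_prod_beta)

lemma coordinate_fun:
  assumes "p \<in> I" "g \<in> borel_measurable (borel_of (S (snd p)))"
  shows "(\<lambda>x. g (x p) :: real) \<in> borel_measurable PM"
  by (rule measurable_compose[OF coordinate_measurable[OF assms(1)] assms(2)])

lemma X_fun:
  assumes "p \<in> I" "g \<in> borel_measurable (borel_of (S (snd p)))"
  shows "(\<lambda>\<omega>. g (X \<omega> p) :: real) \<in> borel_measurable M"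
  by (rule measurable_compose[OF X_measurable[OF assms(1)] assms(2)])

lemma restrict_measurable:
  assumes "\<And>p. p \<in> I \<Longrightarrow> (\<lambda>\<omega>. Y \<omega> p) \<in> M \<rightarrow>\<^sub>M borel_of (S (snd p))"
  shows "(\<lambda>\<omega>. restrict (Y \<omega>) I) \<in> M \<rightarrow>\<^sub>M PM"
  by (rule measurable_restrict) (use assms in \<open>auto simp: case_prod_beta\<close>)

text \<open>The action on index pairs of a transposition within class i. Every use of
  exchangeability below goes through such a transposition, with the identity in the other
  classes.\<close>

definition sw :: "nat \<Rightarrow> nat \<Rightarrow> nat \<Rightarrow> nat \<times> nat \<Rightarrow> nat \<times> nat" where
  "sw i n m p = (if snd p = i then Transposition.transpose n m (fst p) else fst p, snd p)"

lemma sw_I: "(n, i) \<in> I \<Longrightarrow> (m, i) \<in> I \<Longrightarrow> p \<in> I \<Longrightarrow> sw i n m p \<in> I"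
  by (cases p) (auto simp: sw_def I_iff Transposition.transpose_def)

lemma swap:
  assumes n: "(n, i) \<in> I" and m: "(m, i) \<in> I" and \<Psi>: "\<Psi> \<in> borel_measurable PM"
  shows "(\<integral>\<omega>. \<Psi> (restrict (\<lambda>p. X \<omega> (sw i n m p)) I) \<partial>M) = (\<integral>\<omega>. \<Psi> (restrict (X \<omega>) I) \<partial>M :: real)"
proof -
  define \<sigma> where "\<sigma> = (\<lambda>j. if j = i then Transposition.transpose n m else (\<lambda>k. k))"
  have "\<sigma> j permutes {n. 1 \<le> n \<and> enat n \<le> N j} \<and> finite {n. \<sigma> j n \<noteq> n}" if "j \<in> {1..C}" for j
  proof
    show "\<sigma> j permutes {n. 1 \<le> n \<and> enat n \<le> N j}"
    proof (cases "j = i")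
      case True
      then show ?thesis using n m unfolding \<sigma>_def I_iff by (simp add: permutes_swap_id)
    next
      case False
      then show ?thesis using permutes_id by (simp add: \<sigma>_def id_def)
    qed
    show "finite {n. \<sigma> j n \<noteq> n}"
      by (rule finite_subset[of _ "{n, m}"]) (auto simp: \<sigma>_def Transposition.transpose_def split: if_splits)
  qed
  then have "distr M PM (\<lambda>\<omega>. restrict (\<lambda>(n, i). X \<omega> (\<sigma> i n, i)) I) = distr M PM (\<lambda>\<omega>. restrict (X \<omega>) I)"
    using exch unfolding multi_exchangeable_def by blast
  moreover have "(\<lambda>(n, i). X \<omega> (\<sigma> i n, i)) = (\<lambda>p. X \<omega> (sw i n m p))" for \<omega>
    by (auto simp: \<sigma>_def sw_def fun_eq_iff)
  ultimately have eq: "distr M PM (\<lambda>\<omega>. restrict (\<lambda>p. X \<omega> (sw i n m p)) I) = distr M PM (\<lambda>\<omega>. restrict (X \<omega>) I)"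
    by simp
  have 1: "(\<lambda>\<omega>. restrict (\<lambda>p. X \<omega> (sw i n m p)) I) \<in> M \<rightarrow>\<^sub>M PM"
  proof (rule restrict_measurable)
    fix p assume "p \<in> I"
    then show "(\<lambda>\<omega>. X \<omega> (sw i n m p)) \<in> M \<rightarrow>\<^sub>M borel_of (S (snd p))"
      using X_measurable[OF sw_I[OF n m]] by (simp add: sw_def)
  qed
  have 2: "(\<lambda>\<omega>. restrict (X \<omega>) I) \<in> M \<rightarrow>\<^sub>M PM" by (rule restrict_measurable) (rule X_measurable)
  show ?thesis using integral_distr[OF 1 \<Psi>] integral_distr[OF 2 \<Psi>] eq by simp
qed

text \<open>A transposition changes one index of a pair while the other stays put, and an infinite
  class always has a fresh index; so all off-diagonal moments agree.\<close>

lemma equicorrelated_class: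
  assumes i: "i \<in> {1..C}" and inf: "N i = \<infinity>"
    and h: "h \<in> borel_measurable (borel_of (S i))" "\<And>y. y \<in> topspace (S i) \<Longrightarrow> \<bar>h y\<bar> \<le> 1"
  shows "n \<ge> 1 \<Longrightarrow> (\<integral>\<omega>. h (X \<omega> (n, i)) \<partial>M) = (\<integral>\<omega>. h (X \<omega> (1, i)) \<partial>M)"
    and "\<exists>a b. equicorrelated M (\<lambda>n \<omega>. h (X \<omega> (n, i))) a b"
proof -
  have inI: "(n, i) \<in> I" if "n \<ge> 1" for n using that i inf by (simp add: I_iff)
  have hm: "(\<lambda>x. h (x (n, i))) \<in> borel_measurable PM" if "n \<ge> 1" for n
    by (rule coordinate_fun[OF inI[OF that]]) (simp add: h(1))
  have single: "(\<integral>\<omega>. g (X \<omega> (n, i)) \<partial>M) = (\<integral>\<omega>. g (X \<omega> (1, i)) \<partial>M)"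
    if "n \<ge> 1" "g \<in> borel_measurable (borel_of (S i))" for n and g :: "'a \<Rightarrow> real"
  proof -
    have "(\<lambda>x. g (x (1, i))) \<in> borel_measurable PM"
      by (rule coordinate_fun[OF inI]) (simp_all add: that(2))
    from swap[OF inI[OF that(1)] inI[of 1] this] that(1) show ?thesis
      using inI[of 1] by (simp add: sw_def)
  qed
  show "(\<integral>\<omega>. h (X \<omega> (n, i)) \<partial>M) = (\<integral>\<omega>. h (X \<omega> (1, i)) \<partial>M)" if "n \<ge> 1"
    by (rule single[OF that h(1)])
  define e where "e = (\<lambda>n m. \<integral>\<omega>. h (X \<omega> (n, i)) * h (X \<omega> (m, i)) \<partial>M)"
  have e_sym: "e n m = e m n" for n m by (simp add: e_def mult.commute)
  have e_change: "e n m = e n' m" if "n \<ge> 1" "m \<ge> 1" "n' \<ge> 1" "n \<noteq> m" "n' \<noteq> m" for n m n'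
  proof -
    have "(\<lambda>x. h (x (n', i)) * h (x (m, i))) \<in> borel_measurable PM"
      using hm that by (intro borel_measurable_times) auto
    from swap[OF inI[OF that(1)] inI[OF that(3)] this] that show ?thesis
      using inI[of m] inI[of n'] by (simp add: sw_def e_def)
  qed
  have pair: "e n m = e 1 2" if "n \<ge> 1" "m \<ge> 1" "n \<noteq> m" for n m
  proof -
    \<comment> \<open>An index different from n, m, 1 and 2; every change in the chain below moves
      one index and keeps the other.\<close>
    define p where "p = n + m + 3"
    have "e n m = e m n" by (rule e_sym)
    also have "\<dots> = e p n" by (rule e_change) (use that in \<open>auto simp: p_def\<close>)
    also have "\<dots> = e n p" by (rule e_sym)
    also have "\<dots> = e 1 p" by (rule e_change) (use that in \<open>auto simp: p_def\<close>)
    also have "\<dots> = e p 1" by (rule e_sym)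
    also have "\<dots> = e 2 1" by (rule e_change) (auto simp: p_def)
    also have "\<dots> = e 1 2" by (rule e_sym)
    finally show ?thesis .
  qed
  have "equicorrelated M (\<lambda>n \<omega>. h (X \<omega> (n, i))) (e 1 2) (\<integral>\<omega>. h (X \<omega> (1, i)) * h (X \<omega> (1, i)) \<partial>M)"
  proof (unfold_locales, goal_cases)
    case (1 n)
    show ?case by (rule X_fun[OF inI[OF 1]]) (simp add: h(1))
  next
    case (2 n \<omega>)
    then show ?case using h(2) X_space[OF inI[OF 2(1)]] by simp
  next
    case (3 n)
    then show ?case using single[OF 3, of "\<lambda>y. h y * h y"] h(1) by simp
  next
    case (4 n m)
    then show ?case using pair[OF 4] by (simp only: e_def)
  qed
  then show "\<exists>a b. equicorrelated M (\<lambda>n \<omega>. h (X \<omega> (n, i))) a b" by blast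
qed

lemma AE_convergent_class:
  assumes "i \<in> {1..C}" "N i = \<infinity>" "h \<in> borel_measurable (borel_of (S i))"
    "\<And>y. y \<in> topspace (S i) \<Longrightarrow> \<bar>h y\<bar> \<le> 1"
  shows "AE \<omega> in M. convergent (average (\<lambda>n. h (X \<omega> (n, i))))"
proof -
  obtain a b where "equicorrelated M (\<lambda>n \<omega>. h (X \<omega> (n, i))) a b"
    using equicorrelated_class(2)[OF assms] by blast
  then interpret equicorrelated M "\<lambda>n \<omega>. h (X \<omega> (n, i))" a b .
  show ?thesis using AE_convergent unfolding A_def .
qed

abbreviation "has_directing i \<omega> \<equiv>
  \<exists>\<mu>. limitin (weak_top (S i)) (\<lambda>k. empirical (S i) (\<lambda>n. X \<omega> (n, i)) k) \<mu> sequentially"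

text \<open>Both parts go through the countable condition \<open>good\<close>; the hypotheses of
  \<open>AE_good\<close> hold by exchangeability within the class.\<close>

lemma has_directing:
  assumes i: "i \<in> {1..C}" and inf: "N i = \<infinity>"
  shows "AE \<omega> in M. has_directing i \<omega>" and "{\<omega> \<in> space M. has_directing i \<omega>} \<in> sets M"
proof -
  obtain M' d x where D: "dense_sequence M' d x" and Si: "S i = Metric_space.mtopology M' d"
    using Polish_space_dense_sequence[OF Polish[OF i] topspace_nonempty[OF i]] by blast
  interpret D: dense_sequence M' d x by (rule D)
  have inI: "(n, i) \<in> I" if "n \<ge> 1" for n using that i inf by (simp add: I_iff)
  have Z: "(\<lambda>\<omega>. X \<omega> (n, i)) \<in> M \<rightarrow>\<^sub>M borel_of D.mtopology" if "n \<ge> 1" for n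
    using X_measurable[OF inI[OF that]] by (simp add: Si)
  have iff: "has_directing i \<omega> \<longleftrightarrow> D.good (\<lambda>n. X \<omega> (n, i))" if "\<omega> \<in> space M" for \<omega>
    unfolding Si by (rule D.empirical_limit_iff) (use X_space[OF inI that] in \<open>simp add: Si\<close>)
  have "{\<omega> \<in> space M. D.good (\<lambda>n. X \<omega> (n, i))} \<in> sets M" by (rule D.good_sets[OF Z])
  then show "{\<omega> \<in> space M. has_directing i \<omega>} \<in> sets M"
    using iff by (simp cong: conj_cong)
  have "AE \<omega> in M. D.good (\<lambda>n. X \<omega> (n, i))"
  proof (rule D.AE_good[OF prob_space_axioms Z])
    fix h :: "'a \<Rightarrow> real" and n :: nat
    assume h: "h \<in> borel_measurable (borel_of D.mtopology)" "\<And>y. y \<in> M' \<Longrightarrow> \<bar>h y\<bar> \<le> 1"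
    then show "AE \<omega> in M. convergent (average (\<lambda>n. h (X \<omega> (n, i))))"
      by (intro AE_convergent_class[OF i inf]) (auto simp: Si)
    assume "n \<ge> 1"
    then show "(\<integral>\<omega>. h (X \<omega> (n, i)) \<partial>M) = (\<integral>\<omega>. h (X \<omega> (1, i)) \<partial>M)"
      using h by (intro equicorrelated_class(1)[OF i inf]) (auto simp: Si)
  qed
  then show "AE \<omega> in M. has_directing i \<omega>"
    using iff by (auto elim!: AE_mp intro!: AE_I2)
qed

text \<open>A function of the array rather than of the outcome: this way it lives on the product
  space, where \<open>swap\<close> applies.\<close>

definition cls :: "nat \<Rightarrow> ('a \<Rightarrow> real) \<Rightarrow> (nat \<times> nat \<Rightarrow> 'a) \<Rightarrow> real" where
  "cls i g x = lam (N i) (\<lambda>n. g (x (n, i)))"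

lemma integral_measure_vec_finite:
  assumes "i \<in> {1..C}" "N i = enat k" "\<omega> \<in> space M" "g \<in> bcont (S i)"
  shows "integral\<^sup>L (measure_vec S C N X \<omega> i) g = average (\<lambda>n. g (X \<omega> (n, i))) k"
proof -
  have "k \<ge> 1" using N[OF assms(1)] assms(2) by (simp add: one_enat_def)
  moreover have "X \<omega> (n, i) \<in> topspace (S i)" if "1 \<le> n" "n \<le> k" for n
    using X_space[of "(n, i)" \<omega>] that assms by (simp add: I_iff)
  ultimately show ?thesis
    using assms integral_empirical[of k "\<lambda>n. X \<omega> (n, i)" "S i" g] bcont_measurable[OF assms(4)]
    by (simp add: measure_vec_def)
qed

lemma class_space:
  assumes "i \<in> {1..C}" "N i = \<infinity>" "\<omega> \<in> space M" "n \<ge> 1"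
  shows "X \<omega> (n, i) \<in> topspace (S i)"
  using X_space[of "(n, i)" \<omega>] assms by (simp add: I_iff)

text \<open>One null set serves all g at once: the exceptional event is that the empirical measures
  of some infinite class have no limit.\<close>

lemma AE_integral_measure_vec:
  "AE \<omega> in M. \<forall>i\<in>{1..C}. \<forall>g\<in>bcont (S i). integral\<^sup>L (measure_vec S C N X \<omega> i) g = cls i g (X \<omega>)"
proof (rule AE_ball_countable[THEN iffD2], simp, intro ballI)
  fix i assume i: "i \<in> {1..C}"
  show "AE \<omega> in M. \<forall>g\<in>bcont (S i). integral\<^sup>L (measure_vec S C N X \<omega> i) g = cls i g (X \<omega>)"
  proof (cases "N i")
    case (enat k)
    then show ?thesis
      by (intro AE_I2) (simp add: integral_measure_vec_finite[OF i] cls_def lam_def)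
  next
    case infinity
    show ?thesis
      using has_directing(1)[OF i infinity]
    proof (rule AE_mp[OF _ AE_I2], intro impI ballI)
      fix \<omega> g assume *: "\<omega> \<in> space M" "has_directing i \<omega>" "g \<in> bcont (S i)"
      show "integral\<^sup>L (measure_vec S C N X \<omega> i) g = cls i g (X \<omega>)"
        using directing_integral[of "\<lambda>n. X \<omega> (n, i)" "S i" g, OF class_space[OF i infinity *(1)] *(3)] *(2) i infinity
        by (simp add: measure_vec_def cls_def lam_def)
    qed
  qed
qed

section \<open>Measurability of the measure vector and of the system for the Borel sets of the
  product topologies\<close>

abbreviation "TP \<equiv> product_topology (\<lambda>i. weak_top (S i)) {1..C}"
abbreviation "TI \<equiv> product_topology (\<lambda>(n, i). S i) I"

lemma measure_vec_space:
  assumes "\<omega> \<in> space M"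
  shows "measure_vec S C N X \<omega> \<in> topspace TP"
proof -
  have "measure_vec S C N X \<omega> i \<in> prob_measures (S i)" if i: "i \<in> {1..C}" for i
  proof (cases "N i")
    case (enat k)
    have "k \<ge> 1" using N[OF i] enat by (simp add: one_enat_def)
    moreover have "X \<omega> (n, i) \<in> topspace (S i)" if "1 \<le> n" "n \<le> k" for n
      using X_space[of "(n, i)" \<omega>] that assms i enat by (simp add: I_iff)
    ultimately show ?thesis using enat i by (simp add: measure_vec_def empirical_prob_measures)
  next
    case infinity
    then show ?thesis
      using i directing_prob_measures[of "\<lambda>n. X \<omega> (n, i)", OF class_space[OF i infinity assms]]
      by (simp add: measure_vec_def)
  qed
  then show ?thesis by (auto simp: measure_vec_def)
qed

text \<open>In an infinite class, the integral of a monomial is a limit of averages on a measurable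
  event and the value at the first point elsewhere, so it is measurable; in a finite class it is an
  average.\<close>

lemma measure_vec_measurable:
  assumes W: "\<And>i. i \<in> {1..C} \<Longrightarrow> generates (S i) (W i)" "\<And>i. i \<in> {1..C} \<Longrightarrow> countable (W i)"
  shows "measure_vec S C N X \<in> M \<rightarrow>\<^sub>M borel_of TP"
proof (rule measurable_borel_of_generates)
  show "generates TP (coordinate_functions {1..C} (\<lambda>i. (\<lambda>m \<mu>. integral\<^sup>L \<mu> m) ` monomials (W i)))"
    by (intro generates_product generates_weak_top W)
  show "countable (coordinate_functions {1..C} (\<lambda>i. (\<lambda>m \<mu>. integral\<^sup>L \<mu> m) ` monomials (W i)))"
    by (intro countable_coordinate_functions countable_image countable_monomials W) auto
  show "measure_vec S C N X \<in> space M \<rightarrow> topspace TP" using measure_vec_space by blast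
  fix w assume "w \<in> coordinate_functions {1..C} (\<lambda>i. (\<lambda>m \<mu>. integral\<^sup>L \<mu> m) ` monomials (W i))"
  then obtain i m where i: "i \<in> {1..C}" and m: "m \<in> monomials (W i)" and w: "w = (\<lambda>x. integral\<^sup>L (x i) m)"
    by (auto simp: coordinate_functions_def)
  have mb: "m \<in> bcont (S i)" by (rule monomials_bcont[OF W(1)[OF i] m])
  have mX: "(\<lambda>\<omega>. m (X \<omega> (n, i))) \<in> borel_measurable M" if "(n, i) \<in> I" for n
    by (rule X_fun[OF that]) (simp add: bcont_measurable[OF mb])
  show "(\<lambda>\<omega>. w (measure_vec S C N X \<omega>)) \<in> borel_measurable M"
  proof (cases "N i")
    case (enat k)
    have "(\<lambda>\<omega>. average (\<lambda>n. m (X \<omega> (n, i))) k) \<in> borel_measurable M"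
      unfolding average_def using enat i by (intro borel_measurable_divide borel_measurable_sum mX) (auto simp: I_iff)
    then show ?thesis unfolding w
      by (subst measurable_cong[OF integral_measure_vec_finite[OF i enat _ mb]])
  next
    case infinity
    have avg: "(\<lambda>\<omega>. average (\<lambda>n. m (X \<omega> (n, i))) k) \<in> borel_measurable M" for k
      unfolding average_def using infinity i by (intro borel_measurable_divide borel_measurable_sum mX) (auto simp: I_iff)
    have "(\<lambda>\<omega>. if has_directing i \<omega> then lim (average (\<lambda>n. m (X \<omega> (n, i)))) else m (X \<omega> (1, i))) \<in> borel_measurable M"
      by (rule measurable_If[OF borel_measurable_lim_metric[OF avg] mX[OF one_I[OF i]] has_directing(2)[OF i infinity]])
    moreover have "w (measure_vec S C N X \<omega>) =
        (if has_directing i \<omega> then lim (average (\<lambda>n. m (X \<omega> (n, i)))) else m (X \<omega> (1, i)))" if "\<omega> \<in> space M" for \<omega>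
      using directing_integral(1)[of "\<lambda>n. X \<omega> (n, i)" "S i" m, OF class_space[OF i infinity that] mb] i infinity
      by (simp add: w measure_vec_def)
    ultimately show ?thesis by (subst measurable_cong) auto
  qed
qed

lemma X_measurable_TI:
  assumes W: "\<And>i. i \<in> {1..C} \<Longrightarrow> generates (S i) (W i)" "\<And>i. i \<in> {1..C} \<Longrightarrow> countable (W i)"
  shows "(\<lambda>\<omega>. restrict (X \<omega>) I) \<in> M \<rightarrow>\<^sub>M borel_of TI"
proof (rule measurable_borel_of_generates)
  show "generates TI (coordinate_functions I (\<lambda>(n, i). W i))"
    by (rule generates_product) (use W in \<open>auto simp: I_iff\<close>)
  show "countable (coordinate_functions I (\<lambda>(n, i). W i))"
    by (rule countable_coordinate_functions) (use W in \<open>auto simp: I_iff\<close>)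
  show "(\<lambda>\<omega>. restrict (X \<omega>) I) \<in> space M \<rightarrow> topspace TI" using X_space by fastforce
  fix w assume "w \<in> coordinate_functions I (\<lambda>(n, i). W i)"
  then obtain n i v where v: "(n, i) \<in> I" "v \<in> W i" "w = (\<lambda>x. v (x (n, i)))"
    by (auto simp: coordinate_functions_def)
  then have "v \<in> borel_measurable (borel_of (S i))"
    using W(1) by (intro bcont_measurable generates_bcont) (auto simp: I_iff)
  then show "(\<lambda>\<omega>. w (restrict (X \<omega>) I)) \<in> borel_measurable M"
    using X_fun[OF v(1), of v] v by simp
qed

section \<open>Mixed moments of class measures and coordinates\<close>

definition valid :: "(nat \<times> ('a \<Rightarrow> real)) list \<Rightarrow> bool" where
  "valid gs \<longleftrightarrow> (\<forall>(i, g)\<in>set gs. i \<in> {1..C} \<and> g \<in> unit_bcont (S i))"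

text \<open>These products interpolate between the two sides: with J empty their means are moments
  of the measure vector, with gs empty they are moments of the system. As J is a set, each
  coordinate occurs in one factor only.\<close>

definition term_fun :: "(nat \<times> ('a \<Rightarrow> real)) list \<Rightarrow> (nat \<times> nat) set \<Rightarrow> (nat \<times> nat \<Rightarrow> 'a \<Rightarrow> real) \<Rightarrow>
    (nat \<times> nat \<Rightarrow> 'a) \<Rightarrow> real" where
  "term_fun gs J f x = (\<Prod>(i, g)\<leftarrow>gs. cls i g x) * (\<Prod>p\<in>J. f p (x p))"

lemma cls_bound:
  assumes "i \<in> {1..C}" "g \<in> unit_bcont (S i)" "\<And>p. p \<in> I \<Longrightarrow> x p \<in> topspace (S (snd p))"
  shows "\<bar>cls i g x\<bar> \<le> 1"
  unfolding cls_def
proof (rule lam_bound)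
  fix n assume "1 \<le> n" "enat n \<le> N i"
  then have "x (n, i) \<in> topspace (S i)" using assms(3)[of "(n, i)"] assms(1) by (simp add: I_iff)
  then show "\<bar>g (x (n, i))\<bar> \<le> 1" using assms(2) by (simp add: unit_bcont_def)
qed

lemma cls_measurable:
  assumes "i \<in> {1..C}" "g \<in> unit_bcont (S i)"
  shows "cls i g \<in> borel_measurable PM"
  unfolding cls_def
proof (rule lam_measurable)
  fix n assume "1 \<le> n" "enat n \<le> N i"
  then have "(n, i) \<in> I" using assms by (simp add: I_iff)
  then show "(\<lambda>x. g (x (n, i))) \<in> borel_measurable PM"
    by (rule coordinate_fun) (simp add: bcont_measurable[OF unit_bcont_bcont[OF assms(2)]])
qed

lemma cls_restrict:
  assumes "i \<in> {1..C}"
  shows "cls i g (restrict x I) = cls i g x"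
  unfolding cls_def by (rule lam_cong) (use assms in \<open>simp add: I_iff\<close>)

lemma prod_cls_bound:
  assumes "valid gs" "\<And>p. p \<in> I \<Longrightarrow> x p \<in> topspace (S (snd p))"
  shows "\<bar>\<Prod>(i, g)\<leftarrow>gs. cls i g x\<bar> \<le> 1"
  using assms(1) by (induction gs) (auto simp: valid_def abs_mult intro!: mult_le_one cls_bound assms(2))

lemma term_fun_bound:
  assumes "valid gs" "J \<subseteq> I" "\<And>p. p \<in> J \<Longrightarrow> f p \<in> unit_bcont (S (snd p))"
    "\<And>p. p \<in> I \<Longrightarrow> x p \<in> topspace (S (snd p))"
  shows "\<bar>term_fun gs J f x\<bar> \<le> 1"
proof -
  have "\<bar>\<Prod>p\<in>J. f p (x p)\<bar> \<le> 1"
    unfolding abs_prod by (rule prod_le_1) (use assms in \<open>auto simp: unit_bcont_def\<close>)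
  then show ?thesis unfolding term_fun_def abs_mult
    using prod_cls_bound[OF assms(1,4)] by (intro mult_le_one) auto
qed

lemma term_fun_measurable:
  assumes "valid gs" "J \<subseteq> I" "\<And>p. p \<in> J \<Longrightarrow> f p \<in> unit_bcont (S (snd p))"
  shows "term_fun gs J f \<in> borel_measurable PM"
proof -
  have "(\<lambda>x. \<Prod>(i, g)\<leftarrow>gs. cls i g x) \<in> borel_measurable PM"
    using assms(1)
  proof (induction gs)
    case (Cons a gs)
    then show ?case by (cases a) (auto simp: valid_def intro!: borel_measurable_times cls_measurable)
  qed simp
  moreover have "(\<lambda>x. f p (x p)) \<in> borel_measurable PM" if "p \<in> J" for p
    by (rule coordinate_fun) (use assms(2) that bcont_measurable[OF unit_bcont_bcont[OF assms(3)[OF that]]] in auto)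
  ultimately show ?thesis unfolding term_fun_def by (intro borel_measurable_times borel_measurable_prod)
qed

lemma term_fun_restrict:
  assumes "valid gs" "J \<subseteq> I"
  shows "term_fun gs J f (restrict x I) = term_fun gs J f x"
proof -
  have "(\<Prod>(i, g)\<leftarrow>gs. cls i g (restrict x I)) = (\<Prod>(i, g)\<leftarrow>gs. cls i g x)"
    using assms(1) by (intro arg_cong[where f=prod_list] map_cong) (auto simp: valid_def cls_restrict)
  moreover have "(\<Prod>p\<in>J. f p (restrict x I p)) = (\<Prod>p\<in>J. f p (x p))"
    by (rule prod.cong) (use assms(2) in auto)
  ultimately show ?thesis by (simp add: term_fun_def)
qed

lemma restrict_X_measurable: "(\<lambda>\<omega>. restrict (X \<omega>) I) \<in> M \<rightarrow>\<^sub>M PM"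
  by (rule restrict_measurable) (rule X_measurable)

lemma cls_X_measurable:
  assumes "i \<in> {1..C}" "g \<in> unit_bcont (S i)"
  shows "(\<lambda>\<omega>. cls i g (X \<omega>)) \<in> borel_measurable M"
  using measurable_compose[OF restrict_X_measurable cls_measurable[OF assms]]
  by (simp only: cls_restrict[OF assms(1)])

lemma term_fun_X_measurable:
  assumes "valid gs" "J \<subseteq> I" "\<And>p. p \<in> J \<Longrightarrow> f p \<in> unit_bcont (S (snd p))"
  shows "(\<lambda>\<omega>. term_fun gs J f (X \<omega>)) \<in> borel_measurable M"
  using measurable_compose[OF restrict_X_measurable term_fun_measurable[OF assms]]
  by (simp only: term_fun_restrict[OF assms(1,2)])

lemma cls_swap:
  assumes "(n, i) \<in> I" "(m, i) \<in> I" "j \<in> {1..C}"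
  shows "cls j g (restrict (\<lambda>p. x (sw i n m p)) I) = cls j g x"
proof (cases "j = i")
  case True
  then show ?thesis
    unfolding cls_restrict[OF assms(3)] unfolding cls_def
    using assms lam_transpose[of n "N i" m "\<lambda>k. g (x (k, i))"] by (simp add: sw_def I_iff)
next
  case False
  then show ?thesis unfolding cls_restrict[OF assms(3)] by (simp add: cls_def sw_def)
qed

text \<open>Both indices lie outside J, so the transposition fixes the coordinate factors; the class
  factors are symmetric.\<close>

lemma term_fun_swap:
  assumes gs: "valid gs" and J: "finite J" "J \<subseteq> I" "(n, i) \<notin> J" "(m, i) \<notin> J"
    and n: "(n, i) \<in> I" and m: "(m, i) \<in> I"
    and f: "\<And>p. p \<in> J \<Longrightarrow> f p \<in> unit_bcont (S (snd p))" and h: "h \<in> unit_bcont (S i)"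
  shows "(\<integral>\<omega>. term_fun gs J f (X \<omega>) * h (X \<omega> (m, i)) \<partial>M) = (\<integral>\<omega>. term_fun gs J f (X \<omega>) * h (X \<omega> (n, i)) \<partial>M)"
proof -
  define \<Psi> where "\<Psi> = (\<lambda>x. term_fun gs J f x * h (x (n, i)))"
  have "\<Psi> \<in> borel_measurable PM"
    unfolding \<Psi>_def
  proof (intro borel_measurable_times term_fun_measurable gs J(2) f)
    show "(\<lambda>x. h (x (n, i))) \<in> borel_measurable PM"
      by (rule coordinate_fun[OF n]) (simp add: bcont_measurable[OF unit_bcont_bcont[OF h]])
  qed
  from swap[OF n m this]
  have "(\<integral>\<omega>. \<Psi> (restrict (\<lambda>p. X \<omega> (sw i n m p)) I) \<partial>M) = (\<integral>\<omega>. \<Psi> (restrict (X \<omega>) I) \<partial>M)" .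
  moreover have "\<Psi> (restrict (\<lambda>p. X \<omega> (sw i n m p)) I) = term_fun gs J f (X \<omega>) * h (X \<omega> (m, i))" for \<omega>
  proof -
    have "(\<Prod>(j, g)\<leftarrow>gs. cls j g (restrict (\<lambda>p. X \<omega> (sw i n m p)) I)) = (\<Prod>(j, g)\<leftarrow>gs. cls j g (X \<omega>))"
      using gs cls_swap[OF n m] by (intro arg_cong[where f=prod_list] map_cong) (auto simp: valid_def)
    moreover have "(\<Prod>p\<in>J. f p (restrict (\<lambda>p. X \<omega> (sw i n m p)) I p)) = (\<Prod>p\<in>J. f p (X \<omega> p))"
    proof (rule prod.cong)
      fix p assume "p \<in> J"
      then have "p \<in> I" "p \<noteq> (n, i)" "p \<noteq> (m, i)" using J by auto
      then have "sw i n m p = p" by (cases p) (auto simp: sw_def Transposition.transpose_def)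
      then show "f p (restrict (\<lambda>p. X \<omega> (sw i n m p)) I p) = f p (X \<omega> p)" using \<open>p \<in> I\<close> by simp
    qed simp
    ultimately show ?thesis using n by (simp add: \<Psi>_def term_fun_def sw_def)
  qed
  moreover have "\<Psi> (restrict (X \<omega>) I) = term_fun gs J f (X \<omega>) * h (X \<omega> (n, i))" for \<omega>
    using n by (simp add: \<Psi>_def term_fun_restrict[OF gs J(2)])
  ultimately show ?thesis by simp
qed

lemma term_times_integrable:
  assumes "valid gs" "finite J" "J \<subseteq> I" "\<And>p. p \<in> J \<Longrightarrow> f p \<in> unit_bcont (S (snd p))"
    and "p \<in> I" "h \<in> unit_bcont (S (snd p))"
  shows "integrable M (\<lambda>\<omega>. term_fun gs J f (X \<omega>) * h (X \<omega> p))"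
proof (rule integrable_const_bound[where B=1])
  show "AE \<omega> in M. norm (term_fun gs J f (X \<omega>) * h (X \<omega> p)) \<le> 1"
  proof (rule AE_I2)
    fix \<omega> assume "\<omega> \<in> space M"
    then have "\<bar>term_fun gs J f (X \<omega>)\<bar> \<le> 1" "\<bar>h (X \<omega> p)\<bar> \<le> 1"
      using term_fun_bound[OF assms(1,3,4), of "X \<omega>"] X_space assms by (auto simp: unit_bcont_def)
    then show "norm (term_fun gs J f (X \<omega>) * h (X \<omega> p)) \<le> 1" by (simp add: abs_mult mult_le_one)
  qed
  show "(\<lambda>\<omega>. term_fun gs J f (X \<omega>) * h (X \<omega> p)) \<in> borel_measurable M"
    by (intro borel_measurable_times term_fun_X_measurable X_fun bcont_measurable unit_bcont_bcont assms)
qed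

lemma average_term:
  assumes "valid gs" "finite J" "J \<subseteq> I" "\<And>p. p \<in> J \<Longrightarrow> f p \<in> unit_bcont (S (snd p))"
    and h: "h \<in> unit_bcont (S i)" and k: "\<And>m. 1 \<le> m \<Longrightarrow> m \<le> k \<Longrightarrow> (m, i) \<in> I"
  shows "(\<integral>\<omega>. term_fun gs J f (X \<omega>) * average (\<lambda>m. h (X \<omega> (m, i))) k \<partial>M) =
    average (\<lambda>m. \<integral>\<omega>. term_fun gs J f (X \<omega>) * h (X \<omega> (m, i)) \<partial>M) k"
proof -
  have "(\<integral>\<omega>. term_fun gs J f (X \<omega>) * average (\<lambda>m. h (X \<omega> (m, i))) k \<partial>M) =
      (\<integral>\<omega>. (\<Sum>m=1..k. term_fun gs J f (X \<omega>) * h (X \<omega> (m, i))) / real k \<partial>M)"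
    by (simp add: average_def sum_distrib_left)
  also have "\<dots> = (\<Sum>m=1..k. \<integral>\<omega>. term_fun gs J f (X \<omega>) * h (X \<omega> (m, i)) \<partial>M) / real k"
    using term_times_integrable[OF assms(1-4) k] h
    by (simp add: Bochner_Integration.integral_sum)
  finally show ?thesis by (simp add: average_def)
qed

text \<open>All new indices of the class contribute the same value, and only finitely many indices
  are not new. The average over the first k indices therefore tends to that value, while by
  dominated convergence it tends to the moment with the class integral of h.\<close>

lemma term_infinite:
  assumes inf: "N i = \<infinity>" and n: "(n, i) \<in> I" "(n, i) \<notin> J"
    and V: "valid gs" "finite J" "J \<subseteq> I" "\<And>p. p \<in> J \<Longrightarrow> f p \<in> unit_bcont (S (snd p))"
    and h: "h \<in> unit_bcont (S i)"
  shows "(\<integral>\<omega>. term_fun gs J f (X \<omega>) * h (X \<omega> (n, i)) \<partial>M) = (\<integral>\<omega>. term_fun ((i, h) # gs) J f (X \<omega>) \<partial>M)"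
proof -
  have i: "i \<in> {1..C}" using n(1) by (simp add: I_iff)
  have inI: "(m, i) \<in> I" if "m \<ge> 1" for m using that i inf by (simp add: I_iff)
  have hb: "h \<in> borel_measurable (borel_of (S i))" by (rule bcont_measurable[OF unit_bcont_bcont[OF h]])
  have h1: "\<bar>h y\<bar> \<le> 1" if "y \<in> topspace (S i)" for y using h that by (simp add: unit_bcont_def)
  have conv: "AE \<omega> in M. convergent (average (\<lambda>m. h (X \<omega> (m, i))))"
    by (rule AE_convergent_class[OF i inf hb h1])
  define e where "e = (\<lambda>m. \<integral>\<omega>. term_fun gs J f (X \<omega>) * h (X \<omega> (m, i)) \<partial>M)"
  have L1: "average e \<longlonglongrightarrow> e n"
  proof (rule average_eventually_constant)
    show "finite (fst ` J)" using V(2) by simp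
    fix m assume "1 \<le> m" "m \<notin> fst ` J"
    then have "(m, i) \<notin> J" by force
    then show "e m = e n" unfolding e_def
      using term_fun_swap[OF V(1-3) n(2) _ n(1) inI[OF \<open>1 \<le> m\<close>] V(4) h] by blast
  qed
  have L2: "average e k = (\<integral>\<omega>. term_fun gs J f (X \<omega>) * average (\<lambda>m. h (X \<omega> (m, i))) k \<partial>M)" for k
    unfolding e_def by (rule average_term[OF V h inI, symmetric])
  have L3: "(\<lambda>k. \<integral>\<omega>. term_fun gs J f (X \<omega>) * average (\<lambda>m. h (X \<omega> (m, i))) k \<partial>M)
      \<longlonglongrightarrow> (\<integral>\<omega>. term_fun gs J f (X \<omega>) * cls i h (X \<omega>) \<partial>M)"
  proof (rule integral_dominated_convergence[where w="\<lambda>_. 1"])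
    have avg: "(\<lambda>\<omega>. average (\<lambda>m. h (X \<omega> (m, i))) k) \<in> borel_measurable M" for k
      unfolding average_def
      using X_fun[OF inI, of _ h] hb
      by (intro borel_measurable_divide borel_measurable_sum) auto
    then show "(\<lambda>\<omega>. term_fun gs J f (X \<omega>) * average (\<lambda>m. h (X \<omega> (m, i))) k) \<in> borel_measurable M" for k
      by (intro borel_measurable_times term_fun_X_measurable V)
    show "(\<lambda>\<omega>. term_fun gs J f (X \<omega>) * cls i h (X \<omega>)) \<in> borel_measurable M"
      by (intro borel_measurable_times term_fun_X_measurable V cls_X_measurable[OF i h])
    show "AE \<omega> in M. (\<lambda>k. term_fun gs J f (X \<omega>) * average (\<lambda>m. h (X \<omega> (m, i))) k)
        \<longlonglongrightarrow> term_fun gs J f (X \<omega>) * cls i h (X \<omega>)"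
      using conv
      by eventually_elim (auto simp: cls_def lam_def inf convergent_LIMSEQ_iff intro!: tendsto_intros)
    show "AE \<omega> in M. norm (term_fun gs J f (X \<omega>) * average (\<lambda>m. h (X \<omega> (m, i))) k) \<le> 1" for k
    proof (rule AE_I2)
      fix \<omega> assume \<omega>: "\<omega> \<in> space M"
      have "\<bar>term_fun gs J f (X \<omega>)\<bar> \<le> 1" by (rule term_fun_bound[OF V(1,3,4) X_space[OF _ \<omega>]])
      moreover have "\<bar>average (\<lambda>m. h (X \<omega> (m, i))) k\<bar> \<le> 1"
        by (rule average_bounded) (use h1 class_space[OF i inf \<omega>] in auto)
      ultimately show "norm (term_fun gs J f (X \<omega>) * average (\<lambda>m. h (X \<omega> (m, i))) k) \<le> 1"
        by (simp add: abs_mult mult_le_one)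
    qed
  qed simp
  have "e n = (\<integral>\<omega>. term_fun gs J f (X \<omega>) * cls i h (X \<omega>) \<partial>M)"
    by (rule LIMSEQ_unique[OF L1 L3[folded L2]])
  then show ?thesis by (simp add: e_def term_fun_def mult_ac)
qed

text \<open>k times the class integral is the sum of h over the whole class. Indices outside D
  contribute equally by exchangeability; at an index in D the function h is multiplied into the
  factor already present. Solving for the common value gives the formula, and the divisor is
  positive because n itself lies outside D.\<close>

lemma term_finite:
  assumes fin: "N i = enat k" and n: "(n, i) \<in> I" "(n, i) \<notin> J"
    and V: "valid gs" "finite J" "J \<subseteq> I" "\<And>p. p \<in> J \<Longrightarrow> f p \<in> unit_bcont (S (snd p))"
    and h: "h \<in> unit_bcont (S i)"
  defines "D \<equiv> {m. (m, i) \<in> J}"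
  shows "card D < k"
    and "(\<integral>\<omega>. term_fun gs J f (X \<omega>) * h (X \<omega> (n, i)) \<partial>M) =
      (real k * (\<integral>\<omega>. term_fun ((i, h) # gs) J f (X \<omega>) \<partial>M) -
        (\<Sum>m\<in>D. \<integral>\<omega>. term_fun gs J (f((m, i) := \<lambda>y. f (m, i) y * h y)) (X \<omega>) \<partial>M)) / (real k - real (card D))"
proof -
  have i: "i \<in> {1..C}" using n(1) by (simp add: I_iff)
  have inI: "(m, i) \<in> I \<longleftrightarrow> m \<in> {1..k}" for m using i fin by (simp add: I_iff)
  have D: "D \<subseteq> {1..k} - {n}" using V(3) n(2) inI by (auto simp: D_def)
  have nk: "n \<in> {1..k}" using n(1) inI by simp
  have "card D \<le> card ({1..k} - {n})" using D by (intro card_mono) auto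
  also have "\<dots> < k" using nk by simp
  finally show less: "card D < k" .
  define e where "e = (\<lambda>m. \<integral>\<omega>. term_fun gs J f (X \<omega>) * h (X \<omega> (m, i)) \<partial>M)"
  have "(\<integral>\<omega>. term_fun ((i, h) # gs) J f (X \<omega>) \<partial>M) =
      (\<integral>\<omega>. term_fun gs J f (X \<omega>) * average (\<lambda>m. h (X \<omega> (m, i))) k \<partial>M)"
    by (simp add: term_fun_def cls_def lam_def fin mult_ac)
  also have "\<dots> = average e k" unfolding e_def by (rule average_term[OF V h]) (simp_all add: inI)
  finally have "real k * (\<integral>\<omega>. term_fun ((i, h) # gs) J f (X \<omega>) \<partial>M) = (\<Sum>m=1..k. e m)"
    using less by (simp add: average_def)
  also have "\<dots> = (\<Sum>m\<in>D. e m) + (\<Sum>m\<in>{1..k} - D. e m)"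
    using D by (subst sum.subset_diff[of D]) auto
  also have "(\<Sum>m\<in>{1..k} - D. e m) = (\<Sum>m\<in>{1..k} - D. e n)"
  proof (rule sum.cong)
    fix m assume m: "m \<in> {1..k} - D"
    then have "(m, i) \<in> I" "(m, i) \<notin> J" using inI by (auto simp: D_def)
    then show "e m = e n" unfolding e_def
      using term_fun_swap[OF V(1-3) n(2) _ n(1) _ V(4) h] by blast
  qed simp
  also have "\<dots> = (real k - real (card D)) * e n"
    using D less finite_subset[OF D] by (simp add: card_Diff_subset of_nat_diff subset_eq)
  finally have 1: "real k * (\<integral>\<omega>. term_fun ((i, h) # gs) J f (X \<omega>) \<partial>M) =
      (\<Sum>m\<in>D. e m) + (real k - real (card D)) * e n" .
  have "e m = (\<integral>\<omega>. term_fun gs J (f((m, i) := \<lambda>y. f (m, i) y * h y)) (X \<omega>) \<partial>M)" if "m \<in> D" for m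
  proof -
    have mJ: "(m, i) \<in> J" using that by (simp add: D_def)
    have "(\<Prod>p\<in>J. (f((m, i) := \<lambda>y. f (m, i) y * h y)) p (x p)) = (\<Prod>p\<in>J. f p (x p)) * h (x (m, i))" for x
    proof -
      have "(\<Prod>p\<in>J - {(m, i)}. (f((m, i) := \<lambda>y. f (m, i) y * h y)) p (x p)) = (\<Prod>p\<in>J - {(m, i)}. f p (x p))"
        by (rule prod.cong) auto
      then show ?thesis
        by (simp add: prod.remove[OF V(2) mJ] mult_ac)
    qed
    then show ?thesis by (simp add: e_def term_fun_def mult_ac)
  qed
  then have 2: "(\<Sum>m\<in>D. e m) = (\<Sum>m\<in>D. \<integral>\<omega>. term_fun gs J (f((m, i) := \<lambda>y. f (m, i) y * h y)) (X \<omega>) \<partial>M)"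
    by (intro sum.cong) auto
  have nz: "real k - real (card D) \<noteq> 0" using less by simp
  have "(real k - real (card D)) * e n = real k * (\<integral>\<omega>. term_fun ((i, h) # gs) J f (X \<omega>) \<partial>M) -
      (\<Sum>m\<in>D. \<integral>\<omega>. term_fun gs J (f((m, i) := \<lambda>y. f (m, i) y * h y)) (X \<omega>) \<partial>M)"
    using 1 unfolding 2 by linarith
  from arg_cong[OF this, of "\<lambda>t. t / (real k - real (card D))"]
  show "(\<integral>\<omega>. term_fun gs J f (X \<omega>) * h (X \<omega> (n, i)) \<partial>M) =
      (real k * (\<integral>\<omega>. term_fun ((i, h) # gs) J f (X \<omega>) \<partial>M) -
        (\<Sum>m\<in>D. \<integral>\<omega>. term_fun gs J (f((m, i) := \<lambda>y. f (m, i) y * h y)) (X \<omega>) \<partial>M)) / (real k - real (card D))"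
    unfolding nonzero_mult_div_cancel_left[OF nz] by (simp only: e_def)
qed

section \<open>Finite averages in place of class integrals\<close>

definition cut :: "nat \<Rightarrow> enat \<Rightarrow> nat" where
  "cut K n = (case n of enat k \<Rightarrow> k | \<infinity> \<Rightarrow> K)"

text \<open>This is continuous in the array, which \<open>cls\<close> in general is not for an
  infinite class. For a finite class the average runs over the whole class and nothing is
  approximated.\<close>

definition approx :: "nat \<Rightarrow> nat \<Rightarrow> ('a \<Rightarrow> real) \<Rightarrow> (nat \<times> nat \<Rightarrow> 'a) \<Rightarrow> real" where
  "approx K i g x = average (\<lambda>n. g (x (n, i))) (cut K (N i))"

lemma cut_I: "i \<in> {1..C} \<Longrightarrow> 1 \<le> n \<Longrightarrow> n \<le> cut K (N i) \<Longrightarrow> (n, i) \<in> I"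
  by (cases "N i") (auto simp: cut_def I_iff)

lemma approx_lam: "approx K i g x = lam (enat (cut K (N i))) (\<lambda>n. g (x (n, i)))"
  by (simp add: approx_def lam_def)

lemma approx_bound:
  assumes "i \<in> {1..C}" "g \<in> unit_bcont (S i)" "\<And>p. p \<in> I \<Longrightarrow> x p \<in> topspace (S (snd p))"
  shows "\<bar>approx K i g x\<bar> \<le> 1"
  unfolding approx_lam
  by (rule lam_bound) (use assms cut_I[OF assms(1)] in \<open>fastforce simp: unit_bcont_def\<close>)

lemma approx_restrict: "i \<in> {1..C} \<Longrightarrow> approx K i g (restrict x I) = approx K i g x"
  unfolding approx_lam by (rule lam_cong) (simp add: cut_I)

lemma approx_bcont:
  assumes "i \<in> {1..C}" "g \<in> unit_bcont (S i)"
  shows "approx K i g \<in> bcont TI"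
proof -
  have coord: "(\<lambda>x. g (x (n, i))) \<in> bcont TI" if n: "(n, i) \<in> I" for n
  proof -
    have "continuous_map TI euclideanreal (g \<circ> (\<lambda>x. x (n, i)))"
      by (rule continuous_map_compose[OF continuous_map_product_projection[OF n]])
         (use assms(2) in \<open>auto simp: unit_bcont_def bcont_def\<close>)
    then show ?thesis
      using assms(2) n by (intro bcontI[where B=1]) (fastforce simp: comp_def unit_bcont_def PiE_iff)+
  qed
  have "(\<lambda>x. \<Sum>n=1..cut K (N i). g (x (n, i))) \<in> bcont TI"
  proof (rule uniform_algebra.sum[OF uniform_algebra_bcont])
    fix n assume "n \<in> {1..cut K (N i)}"
    then show "(\<lambda>x. g (x (n, i))) \<in> bcont TI" by (intro coord cut_I[OF assms(1)]) auto
  qed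
  from bcont_mult[OF this bcont_const[of "1 / real (cut K (N i))"]]
  show ?thesis by (simp add: approx_def[abs_def] average_def)
qed

text \<open>The bound comes from \<open>mean_abs_limit\<close> and does not involve the law of the
  system; this uniformity allows r to tend to infinity while K is fixed.\<close>

lemma cls_approx:
  assumes i: "i \<in> {1..C}" and g: "g \<in> unit_bcont (S i)" and "K \<ge> 1"
  shows "(\<integral>\<omega>. \<bar>cls i g (X \<omega>) - approx K i g (X \<omega>)\<bar> \<partial>M) \<le> 2 / sqrt (real K)"
proof (cases "N i")
  case (enat k)
  then show ?thesis by (simp add: cls_def lam_def approx_def cut_def)
next
  case infinity
  have gb: "g \<in> borel_measurable (borel_of (S i))" by (rule bcont_measurable[OF unit_bcont_bcont[OF g]])
  have g1: "\<bar>g y\<bar> \<le> 1" if "y \<in> topspace (S i)" for y using g that by (simp add: unit_bcont_def)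
  obtain a b where "equicorrelated M (\<lambda>n \<omega>. g (X \<omega> (n, i))) a b"
    using equicorrelated_class(2)[OF i infinity gb g1] by blast
  then interpret E: equicorrelated M "\<lambda>n \<omega>. g (X \<omega> (n, i))" a b .
  have "AE \<omega> in M. (\<lambda>k. E.A k \<omega>) \<longlonglongrightarrow> cls i g (X \<omega>)"
    using E.AE_convergent
    by eventually_elim (simp add: E.A_def cls_def lam_def infinity convergent_LIMSEQ_iff)
  from E.mean_abs_limit[OF cls_X_measurable[OF i g] this \<open>K \<ge> 1\<close>] show ?thesis
    by (simp add: E.A_def approx_def cut_def infinity abs_minus_commute)
qed

lemma approx_X_measurable:
  assumes "i \<in> {1..C}" "g \<in> unit_bcont (S i)"
  shows "(\<lambda>\<omega>. approx K i g (X \<omega>)) \<in> borel_measurable M"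
  unfolding approx_lam
proof (rule lam_measurable)
  fix n assume "1 \<le> n" "enat n \<le> enat (cut K (N i))"
  then have "(n, i) \<in> I" using cut_I assms by simp
  then show "(\<lambda>\<omega>. g (X \<omega> (n, i))) \<in> borel_measurable M"
    by (rule X_fun) (simp add: bcont_measurable[OF unit_bcont_bcont[OF assms(2)]])
qed

text \<open>By \<open>prod_list_diff\<close> the errors of the single factors add up.\<close>

lemma prod_cls_approx:
  assumes gs: "valid gs" and "K \<ge> 1"
  shows "\<bar>(\<integral>\<omega>. (\<Prod>(i, g)\<leftarrow>gs. cls i g (X \<omega>)) \<partial>M) - (\<integral>\<omega>. (\<Prod>(i, g)\<leftarrow>gs. approx K i g (X \<omega>)) \<partial>M)\<bar>
    \<le> real (length gs) * (2 / sqrt (real K))"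
proof -
  define c where "c = (\<lambda>(i, g) \<omega>. cls i g (X \<omega>))"
  define a where "a = (\<lambda>(i, g) \<omega>. approx K i g (X \<omega>))"
  have cb: "\<bar>c l \<omega>\<bar> \<le> 1" and ab: "\<bar>a l \<omega>\<bar> \<le> 1" if "l \<in> set gs" "\<omega> \<in> space M" for l \<omega>
    using that gs cls_bound[OF _ _ X_space] approx_bound[OF _ _ X_space]
    by (auto simp: c_def a_def valid_def split: prod.splits)
  have cm [measurable]: "c l \<in> borel_measurable M" and am [measurable]: "a l \<in> borel_measurable M" if "l \<in> set gs" for l
    using that gs cls_X_measurable approx_X_measurable by (auto simp: c_def a_def valid_def split: prod.splits)
  have pm: "(\<lambda>\<omega>. \<Prod>l\<leftarrow>ls. q l \<omega>) \<in> borel_measurable M" if "\<And>l. l \<in> set ls \<Longrightarrow> q l \<in> borel_measurable M"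
    for ls and q :: "nat \<times> ('a \<Rightarrow> real) \<Rightarrow> 'w \<Rightarrow> real"
    using that by (induction ls) auto
  have pb: "\<bar>\<Prod>l\<leftarrow>ls. q l\<bar> \<le> 1" if "\<And>l. l \<in> set ls \<Longrightarrow> \<bar>q l\<bar> \<le> 1" for ls and q :: "nat \<times> ('a \<Rightarrow> real) \<Rightarrow> real"
    using that by (induction ls) (auto simp: abs_mult intro!: mult_le_one)
  have ic: "integrable M (\<lambda>\<omega>. \<Prod>l\<leftarrow>gs. c l \<omega>)"
    by (rule integrable_const_bound[where B=1]) (use pb[of gs] cb pm[of gs c] cm in auto)
  have ia: "integrable M (\<lambda>\<omega>. \<Prod>l\<leftarrow>gs. a l \<omega>)"
    by (rule integrable_const_bound[where B=1]) (use pb[of gs] ab pm[of gs a] am in auto)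
  have id: "integrable M (\<lambda>\<omega>. \<bar>c l \<omega> - a l \<omega>\<bar>)" if "l \<in> set gs" for l
  proof (rule integrable_abs, rule Bochner_Integration.integrable_diff)
    show "integrable M (c l)" by (rule integrable_const_bound[where B=1]) (use cb cm that in auto)
    show "integrable M (a l)" by (rule integrable_const_bound[where B=1]) (use ab am that in auto)
  qed
  define B where "B = 2 / sqrt (real K)"
  have sumint: "integrable M (\<lambda>\<omega>. \<Sum>l\<leftarrow>ls. \<bar>c l \<omega> - a l \<omega>\<bar>) \<and>
      (\<integral>\<omega>. (\<Sum>l\<leftarrow>ls. \<bar>c l \<omega> - a l \<omega>\<bar>) \<partial>M) \<le> real (length ls) * B"
    if "set ls \<subseteq> set gs" for ls
    using that
  proof (induction ls)
    case (Cons l ls)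
    then have l: "l \<in> set gs" by simp
    have "(\<integral>\<omega>. \<bar>c l \<omega> - a l \<omega>\<bar> \<partial>M) \<le> B"
      using l gs cls_approx[OF _ _ \<open>K \<ge> 1\<close>] by (auto simp: c_def a_def valid_def B_def split: prod.splits)
    then show ?case using Cons id[OF l] by (auto simp: distrib_right)
  qed simp
  have "\<bar>(\<integral>\<omega>. (\<Prod>l\<leftarrow>gs. c l \<omega>) \<partial>M) - (\<integral>\<omega>. (\<Prod>l\<leftarrow>gs. a l \<omega>) \<partial>M)\<bar>
      = \<bar>\<integral>\<omega>. (\<Prod>l\<leftarrow>gs. c l \<omega>) - (\<Prod>l\<leftarrow>gs. a l \<omega>) \<partial>M\<bar>"
    using ic ia by simp
  also have "\<dots> \<le> (\<integral>\<omega>. \<bar>(\<Prod>l\<leftarrow>gs. c l \<omega>) - (\<Prod>l\<leftarrow>gs. a l \<omega>)\<bar> \<partial>M)" by (rule integral_abs_bound)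
  also have "\<dots> \<le> (\<integral>\<omega>. (\<Sum>l\<leftarrow>gs. \<bar>c l \<omega> - a l \<omega>\<bar>) \<partial>M)"
  proof (rule integral_mono)
    show "\<bar>(\<Prod>l\<leftarrow>gs. c l \<omega>) - (\<Prod>l\<leftarrow>gs. a l \<omega>)\<bar> \<le> (\<Sum>l\<leftarrow>gs. \<bar>c l \<omega> - a l \<omega>\<bar>)" if "\<omega> \<in> space M" for \<omega>
      by (rule prod_list_diff) (use cb ab that in auto)
  qed (use ic ia sumint[of gs] in auto)
  also have "\<dots> \<le> real (length gs) * B" using sumint by simp
  finally show ?thesis by (simp add: c_def a_def B_def case_prod_unfold)
qed

end

section \<open>Moments of the two laws as integrals over the sample space\<close>

context exch_system
begin

lemma ex_generates:
  assumes "i \<in> {1..C}"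
  shows "\<exists>W. generates (S i) W \<and> countable W"
proof -
  obtain M' d x where D: "dense_sequence M' d x" and Si: "S i = Metric_space.mtopology M' d"
    using Polish_space_dense_sequence[OF Polish topspace_nonempty] assms by blast
  show ?thesis unfolding Si using dense_sequence.gen[OF D] dense_sequence.W_countable[OF D] by blast
qed

lemma integral_coordinate_bcont:
  assumes "i \<in> {1..C}" "g \<in> unit_bcont (S i)"
  shows "(\<lambda>x. integral\<^sup>L (x i) g) \<in> bcont TP"
proof (rule bcontI)
  have "continuous_map TP euclideanreal ((\<lambda>\<mu>. integral\<^sup>L \<mu> g) \<circ> (\<lambda>x. x i))"
    by (rule continuous_map_compose[OF continuous_map_product_projection[OF assms(1)]])
       (rule continuous_map_weak_top[OF unit_bcont_bcont[OF assms(2)]])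
  then show "continuous_map TP euclideanreal (\<lambda>x. integral\<^sup>L (x i) g)" by (simp add: comp_def)
  fix x assume "x \<in> topspace TP"
  then have x: "x i \<in> prob_measures (S i)" using assms(1) by (auto simp: PiE_iff)
  interpret P: prob_space "x i" by (rule prob_measuresD[OF x])
  have int: "integrable (x i) g" by (rule prob_measures_integrable[OF x unit_bcont_bcont[OF assms(2)]])
  have "\<bar>integral\<^sup>L (x i) g\<bar> \<le> (\<integral>y. \<bar>g y\<bar> \<partial>x i)" by (rule integral_abs_bound)
  also have "\<dots> \<le> (\<integral>y. 1 \<partial>x i)"
    by (rule integral_mono) (use int assms(2) prob_measuresD(3)[OF x] in \<open>auto simp: unit_bcont_def\<close>)
  finally show "\<bar>integral\<^sup>L (x i) g\<bar> \<le> 1" by (simp add: P.prob_space)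
qed

lemma prod_integral_bcont:
  assumes "valid gs"
  shows "(\<lambda>x. \<Prod>(i, g)\<leftarrow>gs. integral\<^sup>L (x i) g) \<in> bcont TP"
  using assms
proof (induction gs)
  case (Cons a gs)
  obtain i g where a: "a = (i, g)" by (cases a)
  have "(\<lambda>x. integral\<^sup>L (x i) g) \<in> bcont TP" "(\<lambda>x. \<Prod>(i, g)\<leftarrow>gs. integral\<^sup>L (x i) g) \<in> bcont TP"
    using Cons integral_coordinate_bcont by (auto simp: valid_def a)
  from bcont_mult[OF this] show ?case by (simp add: a)
qed (simp add: bcont_const)

lemma prod_approx_bcont:
  assumes "valid gs"
  shows "(\<lambda>x. \<Prod>(i, g)\<leftarrow>gs. approx K i g x) \<in> bcont TI"
  using assms
proof (induction gs)
  case (Cons a gs)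
  obtain i g where a: "a = (i, g)" by (cases a)
  have "approx K i g \<in> bcont TI" "(\<lambda>x. \<Prod>(i, g)\<leftarrow>gs. approx K i g x) \<in> bcont TI"
    using Cons approx_bcont by (auto simp: valid_def a)
  from bcont_mult[OF this] show ?case by (simp add: a)
qed (simp add: bcont_const)

lemma measurable_X_TI: "(\<lambda>\<omega>. restrict (X \<omega>) I) \<in> M \<rightarrow>\<^sub>M borel_of TI"
proof -
  obtain W where "\<And>i. i \<in> {1..C} \<Longrightarrow> generates (S i) (W i) \<and> countable (W i)"
    using ex_generates by metis
  then show ?thesis using X_measurable_TI[of W] by blast
qed

lemma measurable_vec_TP: "measure_vec S C N X \<in> M \<rightarrow>\<^sub>M borel_of TP"
proof -
  obtain W where "\<And>i. i \<in> {1..C} \<Longrightarrow> generates (S i) (W i) \<and> countable (W i)"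
    using ex_generates by metis
  then show ?thesis using measure_vec_measurable[of W] by blast
qed

lemma distr_X_prob: "distr M (borel_of TI) (\<lambda>\<omega>. restrict (X \<omega>) I) \<in> prob_measures TI"
  using prob_space_distr[OF measurable_X_TI] by (simp add: prob_measures_def)

lemma distr_vec_prob: "distr M (borel_of TP) (measure_vec S C N X) \<in> prob_measures TP"
  using prob_space_distr[OF measurable_vec_TP] by (simp add: prob_measures_def)

lemma integral_distr_vec:
  assumes gs: "valid gs"
  shows "(\<integral>x. (\<Prod>(i, g)\<leftarrow>gs. integral\<^sup>L (x i) g) \<partial>distr M (borel_of TP) (measure_vec S C N X))
    = (\<integral>\<omega>. (\<Prod>(i, g)\<leftarrow>gs. cls i g (X \<omega>)) \<partial>M)"
proof -
  have m: "(\<lambda>x. \<Prod>(i, g)\<leftarrow>gs. integral\<^sup>L (x i) g) \<in> borel_measurable (borel_of TP)"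
    by (rule bcont_measurable[OF prod_integral_bcont[OF gs]])
  have "(\<integral>x. (\<Prod>(i, g)\<leftarrow>gs. integral\<^sup>L (x i) g) \<partial>distr M (borel_of TP) (measure_vec S C N X))
      = (\<integral>\<omega>. (\<Prod>(i, g)\<leftarrow>gs. integral\<^sup>L (measure_vec S C N X \<omega> i) g) \<partial>M)"
    by (rule integral_distr[OF measurable_vec_TP m])
  also have "\<dots> = (\<integral>\<omega>. (\<Prod>(i, g)\<leftarrow>gs. cls i g (X \<omega>)) \<partial>M)"
  proof (rule integral_cong_AE)
    show "(\<lambda>\<omega>. \<Prod>(i, g)\<leftarrow>gs. integral\<^sup>L (measure_vec S C N X \<omega> i) g) \<in> borel_measurable M"
      by (rule measurable_compose[OF measurable_vec_TP m])
    show "(\<lambda>\<omega>. \<Prod>(i, g)\<leftarrow>gs. cls i g (X \<omega>)) \<in> borel_measurable M"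
      using term_fun_X_measurable[OF gs, of "{}" undefined] by (simp add: term_fun_def)
    show "AE \<omega> in M. (\<Prod>(i, g)\<leftarrow>gs. integral\<^sup>L (measure_vec S C N X \<omega> i) g) = (\<Prod>(i, g)\<leftarrow>gs. cls i g (X \<omega>))"
      using AE_integral_measure_vec
    proof eventually_elim
      case (elim \<omega>)
      have "integral\<^sup>L (measure_vec S C N X \<omega> i) g = cls i g (X \<omega>)" if "(i, g) \<in> set gs" for i g
        using gs elim that unit_bcont_bcont unfolding valid_def by blast
      then show ?case by (intro arg_cong[where f=prod_list] map_cong) auto
    qed
  qed
  finally show ?thesis .
qed

lemma integral_distr_X:
  assumes gs: "valid gs"
  shows "(\<integral>x. (\<Prod>(i, g)\<leftarrow>gs. approx K i g x) \<partial>distr M (borel_of TI) (\<lambda>\<omega>. restrict (X \<omega>) I))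
    = (\<integral>\<omega>. (\<Prod>(i, g)\<leftarrow>gs. approx K i g (X \<omega>)) \<partial>M)"
proof -
  have "(\<integral>x. (\<Prod>(i, g)\<leftarrow>gs. approx K i g x) \<partial>distr M (borel_of TI) (\<lambda>\<omega>. restrict (X \<omega>) I))
      = (\<integral>\<omega>. (\<Prod>(i, g)\<leftarrow>gs. approx K i g (restrict (X \<omega>) I)) \<partial>M)"
    by (rule integral_distr[OF measurable_X_TI bcont_measurable[OF prod_approx_bcont[OF gs]]])
  moreover have "(\<Prod>(i, g)\<leftarrow>gs. approx K i g (restrict (X \<omega>) I)) = (\<Prod>(i, g)\<leftarrow>gs. approx K i g (X \<omega>))" for \<omega>
    using gs by (intro arg_cong[where f=prod_list] map_cong) (auto simp: valid_def approx_restrict)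
  ultimately show ?thesis by simp
qed

end

text \<open>Two limits are exchanged: K is fixed so that both errors are below \<epsilon> / 3,
  uniformly in r, and only then is the limit along F taken.\<close>

lemma tendsto_uniform_approx:
  fixes e :: "'b \<Rightarrow> real"
  assumes ap: "\<And>K r. K \<ge> 1 \<Longrightarrow> \<bar>e r - a K r\<bar> \<le> c * (2 / sqrt (real K))"
    and ap': "\<And>K. K \<ge> 1 \<Longrightarrow> \<bar>e' - a' K\<bar> \<le> c * (2 / sqrt (real K))"
    and lim: "\<And>K. (a K \<longlongrightarrow> a' K) F"
  shows "(e \<longlongrightarrow> e') F"
proof (rule tendstoI)
  fix \<epsilon> :: real assume "\<epsilon> > 0"
  have "(\<lambda>K. c * (2 / sqrt (real K))) \<longlonglongrightarrow> 0" by real_asymp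
  from order_tendstoD(2)[OF this, of "\<epsilon>/3"] \<open>\<epsilon> > 0\<close>
  have "\<forall>\<^sub>F K in sequentially. c * (2 / sqrt (real K)) < \<epsilon>/3 \<and> K \<ge> 1"
    by (intro eventually_conj eventually_ge_at_top) auto
  then obtain K :: nat where K: "c * (2 / sqrt (real K)) < \<epsilon>/3 \<and> K \<ge> 1"
    using eventually_happens'[OF sequentially_bot] by blast
  have "\<forall>\<^sub>F r in F. dist (a K r) (a' K) < \<epsilon>/3" by (rule tendstoD[OF lim]) (use \<open>\<epsilon> > 0\<close> in simp)
  then show "\<forall>\<^sub>F r in F. dist (e r) e' < \<epsilon>"
  proof eventually_elim
    case (elim r)
    with ap[of K r] ap'[of K] K show ?case unfolding dist_real_def by linarith
  qed
qed

text \<open>Factors at the same coordinate are merged, so that J can be a set whose points are later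
  removed one by one. The merged functions may leave the generating family but stay in
  \<open>unit_bcont\<close>.\<close>

lemma coordinate_monomial:
  assumes "set ws \<subseteq> coordinate_functions I W" "\<And>p. p \<in> I \<Longrightarrow> W p \<subseteq> unit_bcont (T p)"
  shows "\<exists>J f. finite J \<and> J \<subseteq> I \<and> (\<forall>p\<in>J. f p \<in> unit_bcont (T p)) \<and>
    (\<forall>x. (\<Prod>w\<leftarrow>ws. w x) = (\<Prod>p\<in>J. f p (x p)))"
  using assms(1)
proof (induction ws)
  case Nil
  show ?case by (rule exI[of _ "{}"]) simp
next
  case (Cons w ws)
  then obtain J f where J: "finite J" "J \<subseteq> I" "\<forall>p\<in>J. f p \<in> unit_bcont (T p)"
    and eq: "\<forall>x. (\<Prod>w\<leftarrow>ws. w x) = (\<Prod>p\<in>J. f p (x p))" by auto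
  obtain q v where q: "q \<in> I" "v \<in> W q" "w = (\<lambda>x. v (x q))"
    using Cons.prems by (auto simp: coordinate_functions_def)
  have v: "v \<in> unit_bcont (T q)" using assms(2)[OF q(1)] q(2) by auto
  show ?case
  proof (cases "q \<in> J")
    case True
    define f' where "f' = f(q := \<lambda>y. f q y * v y)"
    have "(\<Prod>p\<in>J. f' p (x p)) = v (x q) * (\<Prod>p\<in>J. f p (x p))" for x
    proof -
      have "(\<Prod>p\<in>J - {q}. f' p (x p)) = (\<Prod>p\<in>J - {q}. f p (x p))"
        by (rule prod.cong) (auto simp: f'_def)
      then show ?thesis by (simp add: prod.remove[OF J(1) True] f'_def mult_ac)
    qed
    then have "\<forall>x. (\<Prod>w\<leftarrow>w # ws. w x) = (\<Prod>p\<in>J. f' p (x p))" by (simp add: eq q)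
    moreover have "\<forall>p\<in>J. f' p \<in> unit_bcont (T p)" using J v by (auto simp: f'_def intro: unit_bcont_mult)
    ultimately show ?thesis using J by blast
  next
    case False
    define f' where "f' = f(q := v)"
    have "(\<Prod>p\<in>J. f' p (x p)) = (\<Prod>p\<in>J. f p (x p))" for x
      by (rule prod.cong) (use False in \<open>auto simp: f'_def\<close>)
    then have "\<forall>x. (\<Prod>w\<leftarrow>w # ws. w x) = (\<Prod>p\<in>insert q J. f' p (x p))"
      using J(1) False by (simp add: eq q f'_def)
    moreover have "\<forall>p\<in>insert q J. f' p \<in> unit_bcont (T p)" using J v by (auto simp: f'_def)
    ultimately show ?thesis using J q(1) by (intro exI[of _ "insert q J"] exI[of _ f']) auto
  qed
qed

theorem theorem4:
  fixes C :: nat and N :: "nat \<Rightarrow> enat" and S :: "nat \<Rightarrow> 'a topology"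
    and M :: "ennreal \<Rightarrow> 'w measure" and X :: "ennreal \<Rightarrow> 'w \<Rightarrow> nat \<times> nat \<Rightarrow> 'a"
  assumes "C \<ge> 1"
    and "\<forall>i\<in>{1..C}. N i \<ge> 1"
    and "\<forall>i\<in>{1..C}. Polish_space (S i)"
    and "\<forall>r. random_system S C N (M r) (X r)"
    and "\<forall>r. multi_exchangeable S C N (M r) (X r)"
  shows "conv_in_law (product_topology (\<lambda>(n, i). S i) (sys_index C N))
           (\<lambda>r. M (ennreal r)) (\<lambda>r \<omega>. restrict (X (ennreal r) \<omega>) (sys_index C N))
           (M \<infinity>) (\<lambda>\<omega>. restrict (X \<infinity> \<omega>) (sys_index C N))
     \<longleftrightarrow> conv_in_law (product_topology (\<lambda>i. weak_top (S i)) {1..C})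
           (\<lambda>r. M (ennreal r)) (\<lambda>r. measure_vec S C N (X (ennreal r)))
           (M \<infinity>) (measure_vec S C N (X \<infinity>))"
proof -
  have sys: "exch_system S C N (M r) (X r)" for r
    by unfold_locales (use assms in auto)
  \<comment> \<open>The functionals \<open>E.cls\<close>, \<open>E.approx\<close>,
    \<open>E.valid\<close> and \<open>E.term_fun\<close> depend only on S, C and N, so those of this
    one interpretation are used for every r.\<close>
  interpret E: exch_system S C N "M \<infinity>" "X \<infinity>" by (rule sys)
  let ?I = "sys_index C N"
  let ?TI = "product_topology (\<lambda>(n, i). S i) (sys_index C N)"
  let ?TP = "product_topology (\<lambda>i. weak_top (S i)) {1..C}"
  let ?dX = "\<lambda>r. distr (M r) (borel_of ?TI) (\<lambda>\<omega>. restrict (X r \<omega>) ?I)"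
  let ?dV = "\<lambda>r. distr (M r) (borel_of ?TP) (measure_vec S C N (X r))"
  obtain W where W: "\<And>i. i \<in> {1..C} \<Longrightarrow> generates (S i) (W i)" "\<And>i. i \<in> {1..C} \<Longrightarrow> countable (W i)"
    using E.ex_generates by metis
  show ?thesis
  proof
    assume "conv_in_law ?TI (\<lambda>r. M (ennreal r)) (\<lambda>r \<omega>. restrict (X (ennreal r) \<omega>) ?I) (M \<infinity>) (\<lambda>\<omega>. restrict (X \<infinity> \<omega>) ?I)"
    then have H: "((\<lambda>r. integral\<^sup>L (?dX (ennreal r)) g) \<longlongrightarrow> integral\<^sup>L (?dX \<infinity>) g) at_top" if "g \<in> bcont ?TI" for g
      using that unfolding conv_in_law_def by blast
    let ?WP = "coordinate_functions {1..C} (\<lambda>i. (\<lambda>m \<mu>. integral\<^sup>L \<mu> m) ` monomials (W i))"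
    show "conv_in_law ?TP (\<lambda>r. M (ennreal r)) (\<lambda>r. measure_vec S C N (X (ennreal r))) (M \<infinity>) (measure_vec S C N (X \<infinity>))"
      unfolding conv_in_law_def
    proof
      fix g assume g: "g \<in> bcont ?TP"
      show "((\<lambda>r. integral\<^sup>L (?dV (ennreal r)) g) \<longlongrightarrow> integral\<^sup>L (?dV \<infinity>) g) at_top"
      proof (rule weak_convergence_monomials[OF _ _ _ E.distr_vec_prob _ g])
        show "generates ?TP ?WP" by (intro generates_product generates_weak_top W)
        show "countable ?WP"
          by (intro countable_coordinate_functions countable_image countable_monomials W) auto
        show "\<forall>\<^sub>F r in at_top. ?dV (ennreal r) \<in> prob_measures ?TP"
          by (intro always_eventually allI exch_system.distr_vec_prob sys)
        fix ws assume "set ws \<subseteq> ?WP"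
        \<comment> \<open>Writing the generators as the image of a set of pairs lets the list
          \<open>ws\<close> be lifted to a list \<open>gs\<close>.\<close>
        moreover have "?WP = (\<lambda>(i, m) x. integral\<^sup>L (x i) m) ` {(i, m). i \<in> {1..C} \<and> m \<in> monomials (W i)}"
          by (force simp: coordinate_functions_def image_iff)
        ultimately have "ws \<in> lists ((\<lambda>(i, m) x. integral\<^sup>L (x i) m) ` {(i, m). i \<in> {1..C} \<and> m \<in> monomials (W i)})"
          by (auto simp: in_lists_conv_set)
        then obtain gs where gs: "gs \<in> lists {(i, m). i \<in> {1..C} \<and> m \<in> monomials (W i)}"
          and ws: "ws = map (\<lambda>(i, m) x. integral\<^sup>L (x i) m) gs"
          unfolding lists_image by auto
        have valid: "E.valid gs"
          using gs monomials_unit_bcont[OF W(1)] unfolding E.valid_def in_lists_conv_set by blast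
        have prod: "(\<Prod>w\<leftarrow>ws. w x) = (\<Prod>(i, m)\<leftarrow>gs. integral\<^sup>L (x i) m)" for x
          by (simp add: ws comp_def case_prod_unfold)
        have "((\<lambda>r. \<integral>\<omega>. (\<Prod>(i, m)\<leftarrow>gs. E.cls i m (X (ennreal r) \<omega>)) \<partial>M (ennreal r))
            \<longlongrightarrow> (\<integral>\<omega>. (\<Prod>(i, m)\<leftarrow>gs. E.cls i m (X \<infinity> \<omega>)) \<partial>M \<infinity>)) at_top"
        proof (rule tendsto_uniform_approx)
          show "\<bar>(\<integral>\<omega>. (\<Prod>(i, m)\<leftarrow>gs. E.cls i m (X (ennreal r) \<omega>)) \<partial>M (ennreal r)) -
              (\<integral>\<omega>. (\<Prod>(i, m)\<leftarrow>gs. E.approx K i m (X (ennreal r) \<omega>)) \<partial>M (ennreal r))\<bar>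
              \<le> real (length gs) * (2 / sqrt (real K))" if "K \<ge> 1" for K r
            by (rule exch_system.prod_cls_approx[OF sys valid that])
          show "\<bar>(\<integral>\<omega>. (\<Prod>(i, m)\<leftarrow>gs. E.cls i m (X \<infinity> \<omega>)) \<partial>M \<infinity>) -
              (\<integral>\<omega>. (\<Prod>(i, m)\<leftarrow>gs. E.approx K i m (X \<infinity> \<omega>)) \<partial>M \<infinity>)\<bar>
              \<le> real (length gs) * (2 / sqrt (real K))" if "K \<ge> 1" for K
            by (rule E.prod_cls_approx[OF valid that])
          show "((\<lambda>r. \<integral>\<omega>. (\<Prod>(i, m)\<leftarrow>gs. E.approx K i m (X (ennreal r) \<omega>)) \<partial>M (ennreal r))
              \<longlongrightarrow> (\<integral>\<omega>. (\<Prod>(i, m)\<leftarrow>gs. E.approx K i m (X \<infinity> \<omega>)) \<partial>M \<infinity>)) at_top" for K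
            using H[OF E.prod_approx_bcont[OF valid]]
            unfolding exch_system.integral_distr_X[OF sys valid] .
        qed
        then show "((\<lambda>r. \<integral>x. (\<Prod>w\<leftarrow>ws. w x) \<partial>?dV (ennreal r)) \<longlongrightarrow> (\<integral>x. (\<Prod>w\<leftarrow>ws. w x) \<partial>?dV \<infinity>)) at_top"
          unfolding prod exch_system.integral_distr_vec[OF sys valid] .
      qed
    qed
  next
    assume "conv_in_law ?TP (\<lambda>r. M (ennreal r)) (\<lambda>r. measure_vec S C N (X (ennreal r))) (M \<infinity>) (measure_vec S C N (X \<infinity>))"
    then have H: "((\<lambda>r. integral\<^sup>L (?dV (ennreal r)) g) \<longlongrightarrow> integral\<^sup>L (?dV \<infinity>) g) at_top" if "g \<in> bcont ?TP" for g
      using that unfolding conv_in_law_def by blast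
    let ?e = "\<lambda>gs J f r. \<integral>\<omega>. E.term_fun gs J f (X r \<omega>) \<partial>M r"
    \<comment> \<open>The induction on J is for all gs and f at once: the removed coordinate hands
      its function to gs, and in a finite class that function may also be multiplied into a
      remaining factor of f.\<close>
    have moments: "((\<lambda>r. ?e gs J f (ennreal r)) \<longlongrightarrow> ?e gs J f \<infinity>) at_top"
      if "finite J" "J \<subseteq> ?I" "E.valid gs" "\<And>p. p \<in> J \<Longrightarrow> f p \<in> unit_bcont (S (snd p))" for gs J f
      using that
    proof (induction J arbitrary: gs f rule: finite_induct)
      \<comment> \<open>With no coordinates left, the moment is the integral of a bounded continuous
        function of the measure vector, where the hypothesis applies.\<close>
      case empty
      then show ?case
        using H[OF E.prod_integral_bcont[OF \<open>E.valid gs\<close>]]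
        unfolding exch_system.integral_distr_vec[OF sys \<open>E.valid gs\<close>] by (simp add: E.term_fun_def)
    next
      case (insert p J)
      obtain n i where p: "p = (n, i)" by (cases p)
      have n: "(n, i) \<in> ?I" "(n, i) \<notin> J" and J: "J \<subseteq> ?I" using insert p by auto
      have fJ: "\<And>q. q \<in> J \<Longrightarrow> f q \<in> unit_bcont (S (snd q))" using insert.prems by auto
      define h where "h = f (n, i)"
      have h: "h \<in> unit_bcont (S i)" using insert.prems(3)[of p] p by (simp add: h_def)
      have split: "?e gs (insert p J) f r = (\<integral>\<omega>. E.term_fun gs J f (X r \<omega>) * h (X r \<omega> (n, i)) \<partial>M r)" for r
        using insert.hyps by (simp add: E.term_fun_def p h_def mult_ac)
      have valid': "E.valid ((i, h) # gs)"
        using insert.prems(2) n(1) h by (auto simp: E.valid_def E.I_iff)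
      note IH = insert.IH[OF J valid' fJ]
      show ?case
      proof (cases "N i")
        case infinity
        have eq: "?e gs (insert p J) f r = ?e ((i, h) # gs) J f r" for r
          unfolding split
          by (rule exch_system.term_infinite[OF sys infinity n insert.prems(2) insert.hyps(1) J fJ h])
        show ?thesis unfolding eq by (rule IH)
      next
        case (enat k)
        define D where "D = {m. (m, i) \<in> J}"
        have less: "card D < k" unfolding D_def
          by (rule E.term_finite(1)[OF enat n insert.prems(2) insert.hyps(1) J fJ h])
        let ?f = "\<lambda>m. f((m, i) := \<lambda>y. f (m, i) y * h y)"
        have f': "((\<lambda>r. ?e gs J (?f m) (ennreal r)) \<longlongrightarrow> ?e gs J (?f m) \<infinity>) at_top" if "m \<in> D" for m
        proof (rule insert.IH[OF J insert.prems(2)])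
          fix q assume "q \<in> J"
          then show "?f m q \<in> unit_bcont (S (snd q))"
            using fJ[of q] fJ[of "(m, i)"] that h by (auto simp: D_def intro: unit_bcont_mult)
        qed
        \<comment> \<open>The coefficients k and k - card D are the same for all r, and the divisor
          is nonzero, so limits pass through the quotient.\<close>
        have eq: "?e gs (insert p J) f r =
            (real k * ?e ((i, h) # gs) J f r - (\<Sum>m\<in>D. ?e gs J (?f m) r)) / (real k - real (card D))" for r
          unfolding split D_def
          by (rule exch_system.term_finite(2)[OF sys enat n insert.prems(2) insert.hyps(1) J fJ h])
        show ?thesis
          unfolding eq using less
          by (intro tendsto_divide tendsto_diff tendsto_mult tendsto_const tendsto_sum IH f') auto
      qed
    qed
    let ?WI = "coordinate_functions ?I (\<lambda>p. W (snd p))"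
    show "conv_in_law ?TI (\<lambda>r. M (ennreal r)) (\<lambda>r \<omega>. restrict (X (ennreal r) \<omega>) ?I) (M \<infinity>) (\<lambda>\<omega>. restrict (X \<infinity> \<omega>) ?I)"
      unfolding conv_in_law_def
    proof
      fix g assume g: "g \<in> bcont ?TI"
      show "((\<lambda>r. integral\<^sup>L (?dX (ennreal r)) g) \<longlongrightarrow> integral\<^sup>L (?dX \<infinity>) g) at_top"
      proof (rule weak_convergence_monomials[OF _ _ _ E.distr_X_prob _ g])
        have inI: "snd p \<in> {1..C}" if "p \<in> ?I" for p using that by (cases p) (simp add: E.I_iff)
        show gen: "generates ?TI ?WI"
          by (rule generates_product) (use W(1)[OF inI] in \<open>simp add: case_prod_beta\<close>)
        show "countable ?WI" by (rule countable_coordinate_functions) (use W(2)[OF inI] in auto)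
        show "\<forall>\<^sub>F r in at_top. ?dX (ennreal r) \<in> prob_measures ?TI"
          by (intro always_eventually allI exch_system.distr_X_prob sys)
        fix ws assume ws: "set ws \<subseteq> ?WI"
        have "\<exists>J f. finite J \<and> J \<subseteq> ?I \<and> (\<forall>p\<in>J. f p \<in> unit_bcont (S (snd p))) \<and>
            (\<forall>x. (\<Prod>w\<leftarrow>ws. w x) = (\<Prod>p\<in>J. f p (x p)))"
          by (rule coordinate_monomial[OF ws]) (use generates_unit_bcont[OF W(1)[OF inI]] in blast)
        then obtain J f where J: "finite J" "J \<subseteq> ?I" "\<forall>p\<in>J. f p \<in> unit_bcont (S (snd p))"
          and eq: "\<forall>x. (\<Prod>w\<leftarrow>ws. w x) = (\<Prod>p\<in>J. f p (x p))" by blast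
        have meas: "(\<lambda>x. \<Prod>w\<leftarrow>ws. w x) \<in> borel_measurable (borel_of ?TI)"
          by (rule bcont_measurable[OF bcont_prod_list]) (use ws generates_bcont[OF gen] in blast)
        have "(\<integral>x. (\<Prod>w\<leftarrow>ws. w x) \<partial>?dX r) = ?e [] J f r" for r
        proof -
          have "(\<integral>x. (\<Prod>w\<leftarrow>ws. w x) \<partial>?dX r) = (\<integral>\<omega>. (\<Prod>w\<leftarrow>ws. w (restrict (X r \<omega>) ?I)) \<partial>M r)"
            by (rule integral_distr[OF exch_system.measurable_X_TI[OF sys] meas])
          also have "\<dots> = ?e [] J f r"
          proof -
            have "(\<Prod>w\<leftarrow>ws. w (restrict x ?I)) = E.term_fun [] J f x" for x
              using eq E.term_fun_restrict[of "[]" J f x] J(2)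
              by (simp add: E.term_fun_def E.valid_def)
            then show ?thesis by simp
          qed
          finally show ?thesis .
        qed
        then show "((\<lambda>r. \<integral>x. (\<Prod>w\<leftarrow>ws. w x) \<partial>?dX (ennreal r)) \<longlongrightarrow> (\<integral>x. (\<Prod>w\<leftarrow>ws. w x) \<partial>?dX \<infinity>)) at_top"
          using moments[OF J(1,2) _ bspec[OF J(3)], of "[]"] by (simp add: E.valid_def)
      qed
    qed
  qed
qed

end
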